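(* Let $f:\mathbb{R}\to\mathbb{R}$ satisfy condition (F) and let $\{X(t);\,t\in[0,1]\}$ be a real-valued stochastic process with independent increments, $X(0)=0$, and $\mathbb{E} f(X(1))<\infty$. Assume in addition that for Lebesgue-almost every $s\in[0,1)$, $$\liminf_{h\downarrow 0}\ \mathbb{E} f\big(h^{-1/2}[X(s+h)-X(s)]\big)\ \ge\ \mathbb{E} f(X(1)).$$ Then $\{X(t);\,t\in[0,1]\}$ is a Gaussian process that admits the representation $$X(t)=\sigma W(t)+\mathbb{E}X(t)\qquad\text{for all } t\in[0,1],$$ where $\mathbb{E}X(1)=0$, $\sigma=\Psi^{-1}(\mathbb{E} f(X(1)))$, and the function $\Psi(x)=\mathbb{E} f(xW)$ is continuous and strictly increasing for $x>0$.
   Context: Condition (F) on $f:\mathbb{R}\to\mathbb{R}$: $f$ is symmetric ($f(-x)=f(x)$), continuous, convex, strictly increasing on $\mathbb{R}^+$, $f(0)=0$, and there exist $p\in[1,2)$ and $K_0\ge 0$ such that $f(Kx)\le K^p f(x)$ for all $K\ge K_0$ and all $x>0$. $W$ is a standard normal random variable. $\{W(t);\,t\in[0,1]\}$ is the standard Brownian motion, meaning a Gaussian process with independent increments, $\mathbb{E}[W(t)]=0$ and $\mathbb{E}[W(t)W(s)]=\min(t,s)$ (no sample path properties are required). For two processes with independent increments $X$ and $Y$ indexed by $[0,1]$, the equality $X(t)=Y(t)$ means that their increments have the same distribution. $\Psi$ is considered on $[0,\infty)$, with $\Psi(0)=0$. No conditions are imposed on the sample paths of $X$. *)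

theory Defs
  imports "HOL-Probability.Probability"
begin

definition condition_F :: "(real \<Rightarrow> real) \<Rightarrow> bool" where
  "condition_F f \<longleftrightarrow>
     (\<forall>x. f (- x) = f x) \<and>
     continuous_on UNIV f \<and>
     convex_on UNIV f \<and>
     strict_mono_on {0<..} f \<and>
     f 0 = 0 \<and>
     (\<exists>p K0. 1 \<le> p \<and> p < 2 \<and> 0 \<le> K0 \<and>
        (\<forall>K\<ge>K0. \<forall>x>0. f (K * x) \<le> K powr p * f x))"

text \<open>Processes are families of random variables of which only the members with index in
  \<open>[0,1]\<close> matter; they have type \<open>real \<Rightarrow> 'a \<Rightarrow> real\<close>.\<close>

definition independent_increments :: "'a measure \<Rightarrow> (real \<Rightarrow> 'a \<Rightarrow> real) \<Rightarrow> bool" where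
  "independent_increments M X \<longleftrightarrow>
     (\<forall>t\<in>{0..1}. X t \<in> borel_measurable M) \<and>
     (\<forall>(n::nat) t. t ` {..n} \<subseteq> {0..1} \<and> strict_mono_on {..n} t \<longrightarrow>
        prob_space.indep_vars M (\<lambda>_. borel) (\<lambda>i \<omega>. X (t (Suc i)) \<omega> - X (t i) \<omega>) {..<n})"

text \<open>The degenerate (variance zero) case counts as Gaussian; it is listed separately because
  it has no density.\<close>

definition gaussian_rv :: "'a measure \<Rightarrow> ('a \<Rightarrow> real) \<Rightarrow> bool" where
  "gaussian_rv M Z \<longleftrightarrow>
     Z \<in> borel_measurable M \<and>
     ((\<exists>\<mu>. AE \<omega> in M. Z \<omega> = \<mu>) \<or>
      (\<exists>\<mu> \<sigma>. \<sigma> > 0 \<and> distributed M lborel Z (normal_density \<mu> \<sigma>)))"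

definition gaussian_process :: "'a measure \<Rightarrow> (real \<Rightarrow> 'a \<Rightarrow> real) \<Rightarrow> bool" where
  "gaussian_process M X \<longleftrightarrow>
     (\<forall>J c. finite J \<and> J \<subseteq> {0..1} \<longrightarrow> gaussian_rv M (\<lambda>\<omega>. \<Sum>t\<in>J. c t * X t \<omega>))"

text \<open>No sample path regularity is required.\<close>

definition std_brownian_motion :: "'a measure \<Rightarrow> (real \<Rightarrow> 'a \<Rightarrow> real) \<Rightarrow> bool" where
  "std_brownian_motion N W \<longleftrightarrow>
     prob_space N \<and>
     gaussian_process N W \<and>
     independent_increments N W \<and>
     (\<forall>t\<in>{0..1}. (\<integral>\<omega>. W t \<omega> \<partial>N) = 0) \<and>
     (\<forall>s\<in>{0..1}. \<forall>t\<in>{0..1}. (\<integral>\<omega>. W t \<omega> * W s \<omega> \<partial>N) = min t s)"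

text \<open>The meaning of \<open>X(t) = Y(t)\<close> for two processes with independent increments, possibly
  living on different probability spaces.\<close>

definition same_increments ::
    "'a measure \<Rightarrow> (real \<Rightarrow> 'a \<Rightarrow> real) \<Rightarrow> 'b measure \<Rightarrow> (real \<Rightarrow> 'b \<Rightarrow> real) \<Rightarrow> bool" where
  "same_increments M X N Y \<longleftrightarrow>
     (\<forall>s t. 0 \<le> s \<and> s < t \<and> t \<le> 1 \<longrightarrow>
        distr M borel (\<lambda>\<omega>. X t \<omega> - X s \<omega>) = distr N borel (\<lambda>\<omega>. Y t \<omega> - Y s \<omega>))"

text \<open>The law of a standard normal random variable \<open>W\<close>, and \<open>\<Psi>(x) = E f(x W)\<close>.\<close>

definition std_normal :: "real measure" where
  "std_normal = density lborel (\<lambda>w. ennreal (std_normal_density w))"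

definition Psi :: "(real \<Rightarrow> real) \<Rightarrow> real \<Rightarrow> real" where
  "Psi f x = (\<integral>w. f (x * w) \<partial>std_normal)"

end

theory Submission
  imports Defs
begin

text \<open>Only the laws \<open>\<mu> s t\<close> of the centred increments matter; they form a hemigroup under convolution.
  Along the directed set of finite partitions of \<open>[0,1]\<close> the sums of the truncated variances
  \<open>\<integral>y. min (y\<^sup>2) (e\<^sup>2) \<partial>\<mu> s t\<close> have a cluster point, and letting \<open>e\<close> tend to 0 yields an additive interval
  function \<open>Q\<close>, the variance of the Gaussian part. Three facts about \<open>Q\<close> give the theorem.

  At almost every \<open>s\<close> the increment over \<open>[s, s+h]\<close>, divided by \<open>\<surd>h\<close>, is asymptotically normal with variance
  \<open>Q(s, s+h)/h\<close>, and along suitable \<open>h\<close> the drift \<open>(E X(s+h) - E X(s))/\<surd>h\<close> vanishes. As \<open>p < 2\<close> makes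
  the corresponding values of \<open>f\<close> uniformly integrable, the hypothesis on the lower limit says that
  \<open>Q(s, s+h) \<ge> (\<sigma>\<^sup>2 - \<epsilon>) h\<close> for arbitrarily small \<open>h\<close>, and therefore \<open>Q(a, b) \<ge> \<sigma>\<^sup>2 (b - a)\<close>.

  Replacing the increments over a partition by normal ones, one at a time as in Lindeberg's method,
  shows that the centred normal law with variance \<open>Q(a, b)\<close> is below \<open>\<mu> a b\<close> in the convex order.

  Hence \<open>E f(X(1)) \<ge> \<Psi>(\<sigma>) = E f(X(1))\<close>, and equality must hold at every step. Since \<open>f\<close> is the sum of two
  convex functions one of which is a truncated version of \<open>f\<close> close to a multiple of the absolute value,
  equality identifies the integrals of all functions \<open>\<bar>y - k\<bar>\<close>, and these determine the law.\<close>

subsection \<open>Null sets and increments of real functions\<close>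

text \<open>No path regularity is available: the mean function is arbitrary, fixed discontinuities
  are not excluded, increments need not be infinitely divisible, and second moments may be infinite.
  The variance is therefore built from the laws alone, with truncated squares. Sums of these over
  partitions are not monotone under refinement, so a cluster point takes the place of a limit. Local
  statements come from interval functions dominated by increments of monotone functions, whose upper
  right derivatives are finite almost everywhere. The drift admits no such control: only a lower
  limit of \<open>\<bar>m (s + h) - m s\<bar> / sqrt h\<close> is known to vanish. So the variance
  is bounded below merely for some small steps at each good point, and the bound has to be
  propagated along the interval. In the equality case \<open>[0,1]\<close> is cut in two and one
  part is compared with a normal law of positive variance. Its full support turns equality of two
  averages into equality of \<open>E f\<close> for every shift of the other increment.\<close>

text \<open>Continuous induction along \<open>{a..b}\<close>. The exceptional points are covered by an open set of small
  measure, whose part below the current point is charged as an error term.\<close>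

lemma increment_lower_bound:
  fixes \<Phi> :: "real \<Rightarrow> real"
  assumes mono: "mono_on {a..b} \<Phi>" and ab: "a \<le> b" and c: "0 \<le> c" and N: "negligible N"
    and good: "\<And>s \<delta>. s \<in> {a..<b} \<Longrightarrow> s \<notin> N \<Longrightarrow> 0 < \<delta> \<Longrightarrow>
       \<exists>h. 0 < h \<and> h < \<delta> \<and> s + h \<le> b \<and> c * h \<le> \<Phi> (s + h) - \<Phi> s"
  shows "c * (b - a) \<le> \<Phi> b - \<Phi> a"
proof -
  have "c * (b - a) \<le> \<Phi> b - \<Phi> a + c * e" if "0 < e" for e
  proof -
    have Nl: "N \<in> sets lebesgue" and "emeasure lebesgue N = 0"
      using N by (auto simp: negligible_iff_null_sets)
    obtain U where U: "open U" "N \<subseteq> U" "U - N \<in> lmeasurable" "emeasure lebesgue (U - N) < ennreal e"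
      using sets_lebesgue_outer_open[OF Nl \<open>0 < e\<close>] by auto
    have Ul[measurable]: "U \<in> sets lebesgue" using U(1) by auto
    have "emeasure lebesgue U = emeasure lebesgue (U - N)"
      using N U(2) by (intro emeasure_Diff_null_set[symmetric]) (auto simp: negligible_iff_null_sets)
    then have Ue: "emeasure lebesgue U < ennreal e" using U(4) by simp
    then have Um: "U \<in> lmeasurable" using Ul by (auto intro!: fmeasurableI simp: less_top[symmetric] order.strict_trans[OF _ ennreal_less_top])
    have Ume: "measure lebesgue U \<le> e"
      using Ue Um \<open>0 < e\<close> by (simp add: emeasure_eq_measure2 ennreal_less_iff)
    define \<omega> where "\<omega> t = measure lebesgue (U \<inter> {a..t})" for t
    have Il: "U \<inter> {s..t} \<in> lmeasurable" for s t :: real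
      using Um by (auto intro: fmeasurable.Int)
    have \<omega>mono: "\<omega> s \<le> \<omega> t" if "s \<le> t" for s t
      unfolding \<omega>_def using that Il by (intro measure_mono_fmeasurable) auto
    have \<omega>U: "\<omega> (t + h) - \<omega> t \<ge> h" if "0 < h" "{t..t+h} \<subseteq> U" "a \<le> t" for t h
    proof -
      have "measure lebesgue ({a..t} \<inter> U) + measure lebesgue {t<..t+h} = measure lebesgue (({a..t} \<inter> U) \<union> {t<..t+h})"
        using Il[of a t] that(1)
        by (intro measure_Un_AE[symmetric] AE_I2) (auto simp: Int_commute intro!: bounded_set_imp_lmeasurable)
      also have "\<dots> \<le> \<omega> (t + h)"
        unfolding \<omega>_def using that Il by (intro measure_mono_fmeasurable) (auto intro!: sets.Un simp: Int_commute fmeasurableD)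
      finally show ?thesis using that by (simp add: \<omega>_def Int_commute)
    qed
    define R where "R t = \<Phi> t - c * t + c * \<omega> t" for t
    define S where "S = {t\<in>{a..b}. R a \<le> R t}"
    have aS: "a \<in> S" using ab by (simp add: S_def)
    have bdd: "bdd_above S" by (auto simp: S_def)
    define u where "u = Sup S"
    have au: "a \<le> u" using aS bdd by (auto simp: u_def intro: cSup_upper)
    have ub: "u \<le> b" using aS by (auto simp: u_def S_def intro: cSup_least)
    \<comment> \<open>\<open>\<Phi>\<close> may jump, but only upwards, and \<open>\<omega>\<close>
      is increasing. So between \<open>t\<close> and the supremum \<open>u\<close> only the term
      \<open>c * t\<close> can lower \<open>R\<close>, and \<open>S\<close> contains its
      supremum.\<close>
    have "R a \<le> R u"
    proof (rule field_le_epsilon)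
      fix d :: real assume d: "0 < d"
      obtain t where t: "t \<in> S" "u - d / (c + 1) < t"
        using less_cSupD[of S "u - d / (c + 1)"] aS d c by (auto simp: u_def)
      have tu: "t \<le> u" using t bdd by (auto simp: u_def intro: cSup_upper)
      have "\<Phi> t \<le> \<Phi> u" using t tu ub by (intro mono_onD[OF mono]) (auto simp: S_def)
      moreover have "c * \<omega> t \<le> c * \<omega> u" using \<omega>mono[OF tu] c by (simp add: mult_left_mono)
      moreover have "c * (u - t) \<le> d"
      proof -
        have "c * (u - t) \<le> (c + 1) * (u - t)" using tu by (simp add: algebra_simps)
        also have "\<dots> \<le> d" using t c d by (simp add: field_simps)
        finally show ?thesis .
      qed
      ultimately have "R t \<le> R u + d" by (simp add: R_def algebra_simps)
      then show "R a \<le> R u + d" using t by (auto simp: S_def)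
    qed
    have "u = b"
    proof (rule ccontr)
      assume "u \<noteq> b"
      then have ub': "u < b" using ub by simp
      have "\<exists>h>0. u + h \<le> b \<and> R u \<le> R (u + h)"
      \<comment> \<open>At an exceptional point the increment of \<open>\<Phi>\<close> is only known
        to be nonnegative. The loss \<open>c * h\<close> is made up by \<open>\<omega>\<close>,
        since \<open>{u..u+h}\<close> lies in \<open>U\<close>.\<close>
      proof (cases "u \<in> N")
        case True
        then obtain r where r: "0 < r" "cball u r \<subseteq> U" using U open_contains_cball by blast
        define h where "h = min r (b - u)"
        have h: "0 < h" "u + h \<le> b" "{u..u+h} \<subseteq> U"
          using r ub' by (auto simp: h_def subset_iff dist_real_def)
        have "\<Phi> u \<le> \<Phi> (u + h)" using h au by (intro mono_onD[OF mono]) auto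
        moreover have "c * (\<omega> (u + h) - \<omega> u) \<ge> c * h" using \<omega>U[OF h(1,3) au] c by (simp add: mult_left_mono)
        ultimately show ?thesis using h by (intro exI[of _ h]) (auto simp: R_def algebra_simps)
      next
        case False
        then obtain h where h: "0 < h" "u + h \<le> b" "c * h \<le> \<Phi> (u + h) - \<Phi> u"
          using good[of u 1] au ub' by auto
        moreover have "c * \<omega> u \<le> c * \<omega> (u + h)" using \<omega>mono[of u "u+h"] c h by (simp add: mult_left_mono)
        ultimately show ?thesis by (intro exI[of _ h]) (auto simp: R_def algebra_simps)
      qed
      then obtain h where h: "h > 0" "u + h \<le> b" "R u \<le> R (u + h)" by auto
      then have "u + h \<in> S" using \<open>R a \<le> R u\<close> au by (auto simp: S_def)
      then have "u + h \<le> u" unfolding u_def using bdd by (intro cSup_upper) (auto simp: u_def)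
      then show False using h by simp
    qed
    then have "R a \<le> R b" using \<open>R a \<le> R u\<close> by simp
    moreover have "\<omega> b \<le> e"
      using measure_mono_fmeasurable[of "U \<inter> {a..b}" U lebesgue] Il Um Ume by (auto simp: \<omega>_def)
    moreover have "0 \<le> \<omega> a" by (simp add: \<omega>_def)
    ultimately have "\<Phi> a - c * a \<le> \<Phi> b - c * b + c * e"
      using c mult_left_mono[of "\<omega> b" e c] mult_nonneg_nonneg[of c "\<omega> a"] unfolding R_def by linarith
    then show ?thesis by (simp add: algebra_simps)
  qed
  then have *: "c * (b - a) \<le> \<Phi> b - \<Phi> a + e" if "0 < e" for e
  proof -
    have "c * (e / (c + 1)) \<le> e" using c that by (simp add: field_simps)
    then show ?thesis using that c \<open>\<And>e. 0 < e \<Longrightarrow> c * (b - a) \<le> \<Phi> b - \<Phi> a + c * e\<close>[of "e / (c+1)"] by simp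
  qed
  show ?thesis by (rule field_le_epsilon) (use * in auto)
qed

text \<open>Take away the interval with the largest left end \<open>s\<close>. By disjointness the
  others end before \<open>s\<close>, so the induction continues with \<open>s\<close> as the new
  right end.\<close>

lemma sum_disjoint_increments_le:
  fixes \<Phi> :: "real \<Rightarrow> real"
  assumes "finite C" and mono: "mono_on {a..b} \<Phi>" and "a \<le> b"
    and "\<And>s h. (s, h) \<in> C \<Longrightarrow> a \<le> s \<and> 0 < h \<and> s + h \<le> b"
    and "pairwise (\<lambda>i j. disjnt {fst i..fst i + snd i} {fst j..fst j + snd j}) C"
  shows "(\<Sum>(s, h)\<in>C. \<Phi> (s + h) - \<Phi> s) \<le> \<Phi> b - \<Phi> a"
  using assms
proof (induction "card C" arbitrary: C b)
  case 0
  then show ?case by (auto intro: mono_onD)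
next
  case (Suc n)
  have C: "C \<noteq> {}" "finite C" using Suc by auto
  obtain s h where m: "(s, h) \<in> C" "\<And>s' h'. (s', h') \<in> C \<Longrightarrow> s' \<le> s"
  proof -
    have "Max (fst ` C) \<in> fst ` C" using C by auto
    then obtain x where x: "x \<in> C" "Max (fst ` C) = fst x" by auto
    have "s' \<le> fst x" if "(s', h') \<in> C" for s' h'
    proof -
      have "s' \<in> fst ` C" using that by force
      then show ?thesis using C x by (metis Max_ge finite_imageI)
    qed
    then show ?thesis using that[of "fst x" "snd x"] x by auto
  qed
  have sh: "a \<le> s" "0 < h" "s + h \<le> b" using Suc.prems m(1) by blast+
  have "(\<Sum>(s, h)\<in>C - {(s, h)}. \<Phi> (s + h) - \<Phi> s) \<le> \<Phi> s - \<Phi> a"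
  proof (rule Suc.hyps(1))
    show "mono_on {a..s} \<Phi>" using Suc.prems(2) sh by (auto simp: mono_on_def)
    fix s' h' assume i: "(s', h') \<in> C - {(s, h)}"
    then have "disjnt {s'..s' + h'} {s..s + h}" using Suc.prems(5) m(1) by (force simp: pairwise_def)
    moreover have "s' \<le> s" using m i by blast
    moreover have p: "a \<le> s'" "0 < h'" "s' + h' \<le> b" using Suc.prems(4) i by blast+
    ultimately have "s \<notin> {s'..s'+h'}" using sh by (auto simp: disjnt_iff)
    then show "a \<le> s' \<and> 0 < h' \<and> s' + h' \<le> s" using p \<open>s' \<le> s\<close> by auto
  qed (use Suc C m sh in \<open>auto intro: pairwise_subset\<close>)
  moreover have "\<Phi> (s + h) \<le> \<Phi> b" using sh by (intro mono_onD[OF Suc.prems(2)]) auto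
  ultimately show ?case using C m(1) by (subst sum.remove[of _ "(s, h)"]) auto
qed

text \<open>A weak type inequality for the upper right derivative. The intervals
  \<open>{s..s + h}\<close> on which \<open>\<Phi>\<close> grows faster than \<open>c * h\<close>
  form a Vitali cover of \<open>E\<close>, and disjoint ones have total length at most
  \<open>(\<Phi> b - \<Phi> a) / c\<close>. The set \<open>E\<close> need not be measurable, hence
  the outer set \<open>T\<close>; the term \<open>e\<close> pays for the null set that the covering
  misses.\<close>

lemma upper_dini_weak_type:
  fixes \<Phi> :: "real \<Rightarrow> real"
  assumes mono: "mono_on {a..b} \<Phi>" and ab: "a \<le> b" and c: "0 < c" and e: "0 < e"
    and E: "\<And>s \<delta>. s \<in> E \<Longrightarrow> 0 < \<delta> \<Longrightarrow>
       a \<le> s \<and> (\<exists>h. 0 < h \<and> h < \<delta> \<and> s + h \<le> b \<and> c * h < \<Phi> (s + h) - \<Phi> s)"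
  shows "\<exists>T. E \<subseteq> T \<and> T \<in> lmeasurable \<and> measure lebesgue T \<le> (\<Phi> b - \<Phi> a) / c + e"
proof -
  define K where "K = {(s, h). a \<le> s \<and> 0 < h \<and> s + h \<le> b \<and> c * h < \<Phi> (s + h) - \<Phi> s}"
  \<comment> \<open>Midpoint and half length, because the covering theorem speaks of closed balls
    while \<open>s\<close> is the left end of its interval.\<close>
  define m where "m i = fst i + snd i / 2" for i :: "real \<times> real"
  define r where "r i = snd i / 2" for i :: "real \<times> real"
  have cb: "cball (m i) (r i) = {fst i..fst i + snd i}" for i
    unfolding cball_eq_atLeastAtMost m_def r_def by (simp add: field_simps)
  have "\<exists>i. i \<in> K \<and> x \<in> cball (m i) (r i) \<and> r i < d" if xd: "x \<in> E" "0 < d" for x d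
  proof -
    obtain h where h: "a \<le> x" "0 < h" "h < d" "x + h \<le> b" "c * h < \<Phi> (x + h) - \<Phi> x"
      using E[of x d] xd by blast
    then show ?thesis by (intro exI[of _ "(x, h)"]) (auto simp: K_def cb, auto simp: r_def)
  qed
  moreover have "0 < r i" if "i \<in> K" for i using that by (auto simp: K_def r_def)
  ultimately obtain C where C: "countable C" "C \<subseteq> K"
     "pairwise (\<lambda>i j. disjnt (cball (m i) (r i)) (cball (m j) (r j))) C"
     "negligible(E - (\<Union>i \<in> C. cball (m i) (r i)))"
    using Vitali_covering_theorem_cballs[of K r E m] by blast
  define V where "V = (\<Union>i \<in> C. cball (m i) (r i))"
  have Vm: "V \<in> lmeasurable \<and> measure lebesgue V \<le> (\<Phi> b - \<Phi> a) / c"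
    unfolding V_def
  proof (rule fmeasurable_UN_bound[THEN conjI, OF C(1) _ _ measure_UN_bound[OF C(1)]])
    fix I' assume I': "I' \<subseteq> C" "finite I'"
    have "measure lebesgue (\<Union>i\<in>I'. cball (m i) (r i)) \<le> (\<Sum>i\<in>I'. measure lebesgue (cball (m i) (r i)))"
      using I' by (intro measure_UNION_le) auto
    also have "\<dots> = (\<Sum>(s,h)\<in>I'. h)"
      using I' C by (intro sum.cong) (auto simp: cb K_def)
    also have "\<dots> \<le> (\<Sum>(s,h)\<in>I'. (\<Phi> (s + h) - \<Phi> s) / c)"
      using I' C c by (intro sum_mono) (auto simp: K_def field_simps less_imp_le)
    also have "\<dots> = (\<Sum>(s,h)\<in>I'. \<Phi> (s + h) - \<Phi> s) / c"
      by (simp add: sum_divide_distrib case_prod_unfold)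
    also have "\<dots> \<le> (\<Phi> b - \<Phi> a) / c"
    proof (intro divide_right_mono sum_disjoint_increments_le[OF I'(2) mono ab])
      show "\<And>s h. (s, h) \<in> I' \<Longrightarrow> a \<le> s \<and> 0 < h \<and> s + h \<le> b" using I' C by (auto simp: K_def)
      show "pairwise (\<lambda>i j. disjnt {fst i..fst i + snd i} {fst j..fst j + snd j}) I'"
        using pairwise_subset[OF C(3) I'(1)] by (simp add: cb)
    qed (use c in auto)
    finally show "measure lebesgue (\<Union>i\<in>I'. cball (m i) (r i)) \<le> (\<Phi> b - \<Phi> a) / c" .
    then show "measure lebesgue (\<Union>i\<in>I'. cball (m i) (r i)) \<le> (\<Phi> b - \<Phi> a) / c" .
  qed auto
  obtain T where T: "E - V \<subseteq> T" "T \<in> lmeasurable" "measure lebesgue T < e"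
    using C(4) e by (auto simp: negligible_outer V_def[symmetric])
  have "measure lebesgue (V \<union> T) \<le> measure lebesgue V + measure lebesgue T"
    using Vm T by (intro measure_Un_le) auto
  then show ?thesis using Vm T by (intro exI[of _ "V \<union> T"]) auto
qed

text \<open>The finiteness part of Lebesgue's differentiation theorem: at the points in question the
  weak type inequality applies for every \<open>c\<close>, so \<open>c\<close> can be taken large
  compared with \<open>1 / e\<close>.\<close>

lemma mono_finite_upper_dini:
  fixes \<Phi> :: "real \<Rightarrow> real"
  assumes mono: "mono_on {a..b} \<Phi>" and ab: "a \<le> b"
  shows "negligible {s\<in>{a..<b}. \<forall>c. \<forall>\<delta>>0. \<exists>h. 0 < h \<and> h < \<delta> \<and> s + h \<le> b \<and> c * h < \<Phi> (s + h) - \<Phi> s}"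
    (is "negligible ?E")
  unfolding negligible_outer_le
proof (intro allI impI)
  fix e :: real assume e: "0 < e"
  define D where "D = \<Phi> b - \<Phi> a"
  have D: "0 \<le> D" using mono_onD[OF mono, of a b] ab by (simp add: D_def)
  define c where "c = 2 * (D + 1) / e"
  have c: "0 < c" using D e by (simp add: c_def)
  obtain T where T: "?E \<subseteq> T" "T \<in> lmeasurable" "measure lebesgue T \<le> (\<Phi> b - \<Phi> a) / c + e / 2"
    using upper_dini_weak_type[OF mono ab c, of "e/2" ?E] e by auto
  have "D / c \<le> e / 2" using D e by (simp add: c_def field_simps)
  then have "measure lebesgue T \<le> e" using T(3) unfolding D_def by linarith
  then show "\<exists>T. ?E \<subseteq> T \<and> T \<in> lmeasurable \<and> measure lebesgue T \<le> e" using T by blast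
qed

text \<open>Here the threshold stays fixed and the total increment tends to 0. Applied to truncation
  errors, it says that almost every point has a truncation level whose error on
  \<open>[s, s + h]\<close> is at most \<open>c * h\<close> for all small \<open>h\<close>.\<close>

lemma vanishing_upper_dini:
  fixes \<Phi> :: "nat \<Rightarrow> real \<Rightarrow> real"
  assumes mono: "\<And>n. mono_on {a..b} (\<Phi> n)" and ab: "a \<le> b" and c: "0 < c"
    and lim: "(\<lambda>n. \<Phi> n b - \<Phi> n a) \<longlonglongrightarrow> 0"
  shows "negligible {s\<in>{a..<b}. \<forall>n. \<forall>\<delta>>0. \<exists>h. 0 < h \<and> h < \<delta> \<and> s + h \<le> b \<and> c * h < \<Phi> n (s + h) - \<Phi> n s}"
    (is "negligible ?E")
  unfolding negligible_outer_le
proof (intro allI impI)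
  fix e :: real assume e: "0 < e"
  have "eventually (\<lambda>n. \<Phi> n b - \<Phi> n a < c * (e / 2)) sequentially"
    using order_tendstoD(2)[OF lim, of "c * (e/2)"] c e by simp
  then obtain n where n: "\<Phi> n b - \<Phi> n a < c * (e / 2)" by (auto simp: eventually_sequentially)
  obtain T where T: "?E \<subseteq> T" "T \<in> lmeasurable" "measure lebesgue T \<le> (\<Phi> n b - \<Phi> n a) / c + e / 2"
    using upper_dini_weak_type[OF mono[of n] ab c, of "e/2" ?E] e by auto
  have "(\<Phi> n b - \<Phi> n a) / c \<le> e / 2" using n c by (simp add: field_simps)
  then have "measure lebesgue T \<le> e" using T(3) by linarith
  then show "\<exists>T. ?E \<subseteq> T \<and> T \<in> lmeasurable \<and> measure lebesgue T \<le> e" using T by blast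
qed

text \<open>On a short cell with \<open>m\<close> confined to a unit interval, divide the range of \<open>m\<close> into \<open>N\<close> bins. Two
  exceptional points in one bin are at distance \<open>O(1/N\<^sup>2)\<close>, so the bins contribute \<open>O(1/N)\<close> altogether.\<close>

lemma liminf_sqrt_increment_zero:
  fixes m :: "real \<Rightarrow> real"
  shows "negligible {s. \<exists>c>0. \<exists>\<delta>>0. \<forall>h. 0 < h \<and> h < \<delta> \<longrightarrow> c * sqrt h \<le> \<bar>m (s + h) - m s\<bar>}"
    (is "negligible ?E")
proof -
  \<comment> \<open>Countably many pieces: \<open>n\<close> replaces the constants \<open>c\<close>
    and \<open>\<delta>\<close>, the index \<open>i\<close> confines \<open>s\<close> to an interval
    so short that the lower bound applies to any two of its points, and \<open>k\<close> confines
    \<open>m s\<close> to a unit interval.\<close>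
  define A where "A n i k = {s::real. (\<forall>h. 0 < h \<and> h < 1 / Suc n \<longrightarrow> sqrt h / Suc n \<le> \<bar>m (s + h) - m s\<bar>) \<and>
      \<lfloor>s * Suc n\<rfloor> = i \<and> \<lfloor>m s\<rfloor> = k}" for n :: nat and i k :: int
  have "negligible (A n i k)" for n i k
    unfolding negligible_outer_le
  proof (intro allI impI)
    fix e :: real assume e: "0 < e"
    \<comment> \<open>The \<open>N\<close> bins will be covered by intervals of length
      \<open>2 * r\<close>, of total length \<open>2 * (Suc n)\<^sup>2 / N\<close>.\<close>
    obtain N :: nat where N: "2 * (Suc n)\<^sup>2 / e < N" using reals_Archimedean2 by blast
    have "0 \<le> 2 * (Suc n)\<^sup>2 / e" using e by auto
    then have N0: "0 < N" using N by simp
    define w where "w = 1 / real N"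
    define B where "B j = {s\<in>A n i k. \<lfloor>(m s - k) * N\<rfloor> = int j}" for j
    define r where "r = (Suc n * w)\<^sup>2"
    have dist: "\<bar>t - s\<bar> \<le> r" if st: "s \<in> B j" "t \<in> B j" for s t j
    proof -
      have *: "t - s \<le> r" if st: "s \<in> B j" "t \<in> B j" "s < t" for s t
      proof -
        have "\<lfloor>s * Suc n\<rfloor> = \<lfloor>t * Suc n\<rfloor>" using st by (auto simp: B_def A_def)
        then have "t * Suc n - s * Suc n < 1" by linarith
        then have "t - s < 1 / Suc n" by (simp add: field_simps)
        then have "sqrt (t - s) / Suc n \<le> \<bar>m t - m s\<bar>"
          using st by (auto simp: B_def A_def dest!: spec[of _ "t - s"])
        moreover have "\<lfloor>(m s - k) * N\<rfloor> = \<lfloor>(m t - k) * N\<rfloor>" using st by (auto simp: B_def)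
        then have "\<bar>(m t - k) * N - (m s - k) * N\<bar> < 1" by linarith
        then have "\<bar>(m t - m s) * N\<bar> < 1" by (simp add: algebra_simps)
        then have "\<bar>m t - m s\<bar> * N < 1" by (simp add: abs_mult)
        then have "\<bar>m t - m s\<bar> \<le> w" using N0 by (simp add: w_def field_simps)
        ultimately have "sqrt (t - s) / Suc n \<le> w" by linarith
        then have "sqrt (t - s) \<le> Suc n * w" by (simp add: field_simps)
        then have "(sqrt (t - s))\<^sup>2 \<le> (Suc n * w)\<^sup>2" by (rule power_mono) (use st in auto)
        then show ?thesis using st by (simp add: r_def)
      qed
      have "0 \<le> r" by (simp add: r_def)
      then show ?thesis using *[of s t] *[of t s] st by (cases s t rule: linorder_cases) auto
    qed
    \<comment> \<open>\<open>m\<close> is arbitrary, so \<open>B j\<close> need not be measurable;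
      it is covered by an interval around any one of its points.\<close>
    have "\<exists>c. B j \<subseteq> {c - r..c + r}" for j
    proof (cases "B j = {}")
      case False
      then obtain c where "c \<in> B j" by auto
      then show ?thesis using dist[of c j] by (intro exI[of _ c]) (force simp: abs_le_iff)
    qed auto
    then obtain c where c: "\<And>j. B j \<subseteq> {c j - r..c j + r}" by metis
    define T where "T = (\<Union>j<N. {c j - r..c j + r})"
    have "A n i k \<subseteq> T"
    proof
      fix s assume s: "s \<in> A n i k"
      then have "0 \<le> m s - k" "m s - k < 1" by (auto simp: A_def) linarith+
      then have f: "0 \<le> \<lfloor>(m s - k) * N\<rfloor>" "\<lfloor>(m s - k) * N\<rfloor> < N"
        using N0 by (auto simp: floor_less_iff)
      define j where "j = nat \<lfloor>(m s - k) * N\<rfloor>"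
      have "j < N" "s \<in> B j" using f s by (simp_all add: j_def B_def nat_less_iff)
      then show "s \<in> T" using c[of j] unfolding T_def by blast
    qed
    moreover have "T \<in> lmeasurable" unfolding T_def by (intro fmeasurable.finite_UN) auto
    moreover have "measure lebesgue T \<le> (\<Sum>j<N. measure lebesgue {c j - r..c j + r})"
      unfolding T_def by (intro measure_UNION_le) auto
    moreover have "\<dots> = N * (2 * r)" by (simp add: r_def)
    moreover have "N * (2 * r) \<le> e"
    proof -
      have "N * (2 * r) = 2 * (Suc n)\<^sup>2 / N" using N0 by (simp add: r_def w_def power2_eq_square field_simps)
      also have "\<dots> \<le> e" using N N0 e by (simp add: field_simps)
      finally show ?thesis .
    qed
    ultimately show "\<exists>T. A n i k \<subseteq> T \<and> T \<in> lmeasurable \<and> measure lebesgue T \<le> e"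
      by (intro exI[of _ T]) auto
  qed
  then have "negligible (\<Union>(n, i, k). A n i k)"
    by (intro negligible_countable_Union) auto
  moreover have "?E \<subseteq> (\<Union>(n, i, k). A n i k)"
  proof
    fix s assume "s \<in> ?E"
    then obtain c \<delta> where c: "0 < c" "0 < \<delta>" and *: "\<And>h. 0 < h \<Longrightarrow> h < \<delta> \<Longrightarrow> c * sqrt h \<le> \<bar>m (s + h) - m s\<bar>" by auto
    obtain n where n: "1 / Suc n < min c \<delta>" using nat_approx_posE[of "min c \<delta>"] c by auto
    have "sqrt h / Suc n \<le> \<bar>m (s + h) - m s\<bar>" if "0 < h" "h < 1 / Suc n" for h
    proof -
      have "sqrt h * (1 / Suc n) \<le> sqrt h * c" using n that by (intro mult_left_mono) auto
      then show ?thesis using *[of h] that n by (simp add: mult.commute)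
    qed
    then have "s \<in> A n \<lfloor>s * Suc n\<rfloor> \<lfloor>m s\<rfloor>" by (auto simp: A_def)
    then show "s \<in> (\<Union>(n, i, k). A n i k)" by blast
  qed
  ultimately show ?thesis by (rule negligible_subset)
qed

subsection \<open>Sums over partitions\<close>

definition nxt :: "real set \<Rightarrow> real \<Rightarrow> real" where
  "nxt P x = Min {y\<in>P. x < y}"

text \<open>Each cell of \<open>P\<close> is counted by its left end in a half-open range. This
  makes \<open>psum\<close> additive in the interval, which is \<open>psum_split\<close>.\<close>

definition psum :: "(real \<Rightarrow> real \<Rightarrow> real) \<Rightarrow> real set \<Rightarrow> real \<Rightarrow> real \<Rightarrow> real" where
  "psum q P a b = (\<Sum>x\<in>P \<inter> {a..<b}. q x (nxt P x))"

lemma nxt: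
  assumes "finite P" "b \<in> P" "x < b"
  shows "x < nxt P x" "nxt P x \<in> P" "nxt P x \<le> b"
proof -
  have "nxt P x \<in> {y\<in>P. x < y}" unfolding nxt_def using assms by (intro Min_in) auto
  then show "x < nxt P x" "nxt P x \<in> P" by auto
  show "nxt P x \<le> b" unfolding nxt_def using assms by (intro Min_le) auto
qed

lemma nxt_least: "finite P \<Longrightarrow> y \<in> P \<Longrightarrow> x < y \<Longrightarrow> nxt P x \<le> y"
  unfolding nxt_def by (intro Min_le) auto

lemma psum_split:
  assumes "finite P" "a \<le> b" "b \<le> c"
  shows "psum q P a c = psum q P a b + psum q P b c"
proof -
  have "P \<inter> {a..<c} = (P \<inter> {a..<b}) \<union> (P \<inter> {b..<c})" using assms by auto
  then show ?thesis unfolding psum_def using assms by (simp only:) (rule sum.union_disjoint, auto)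
qed

lemma psum_refl[simp]: "psum q P a a = 0"
  by (simp add: psum_def)

lemma psum_nxt:
  assumes "finite P" "c \<in> P" "b \<in> P" "c < b" "a \<le> c"
  shows "psum q P a (nxt P c) = psum q P a c + q c (nxt P c)"
proof -
  note n = nxt[OF assms(1,3,4)]
  have "P \<inter> {c..<nxt P c} = {c}" using assms n nxt_least[OF assms(1), of _ c] by force
  then have "psum q P c (nxt P c) = q c (nxt P c)" by (simp add: psum_def)
  then show ?thesis using psum_split[of P a c "nxt P c" q] assms n by simp
qed

text \<open>Induction upwards through the points of a partition. It carries the telescoping sums,
  the product of characteristic functions and the replacement of increments by normal ones.\<close>

lemma partition_induct [consumes 4, case_names base step]:
  assumes P: "finite P" "a \<in> P" "b \<in> P" "a \<le> b"
    and base: "R a"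
    and step: "\<And>c. c \<in> P \<Longrightarrow> a \<le> c \<Longrightarrow> c < b \<Longrightarrow> c < nxt P c \<Longrightarrow> nxt P c \<in> P \<Longrightarrow> nxt P c \<le> b \<Longrightarrow> R c \<Longrightarrow> R (nxt P c)"
  shows "R b"
  using P(3,4) step
proof (induction "card (P \<inter> {a..<b})" arbitrary: b rule: less_induct)
  case less
  show ?case
  proof (cases "a = b")
    case False
    define c where "c = Max (P \<inter> {a..<b})"
    have "c \<in> P \<inter> {a..<b}" unfolding c_def using P less.prems False by (intro Max_in) auto
    then have c: "c \<in> P" "a \<le> c" "c < b" by auto
    note n = nxt[OF P(1) less.prems(1) c(3)]
    have "nxt P c = b"
    proof (rule ccontr)
      assume "nxt P c \<noteq> b"
      then have "nxt P c \<in> P \<inter> {a..<b}" using n c by auto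
      then have "nxt P c \<le> c" unfolding c_def using P by (intro Max_ge) auto
      then show False using n by simp
    qed
    have "P \<inter> {a..<c} \<subset> P \<inter> {a..<b}" using c by auto
    then have "card (P \<inter> {a..<c}) < card (P \<inter> {a..<b})" using P by (intro psubset_card_mono) auto
    then have "R c"
    proof (rule less.hyps)
      fix d assume "d \<in> P" "a \<le> d" "d < c" "d < nxt P d" "nxt P d \<in> P" "nxt P d \<le> c" "R d"
      then show "R (nxt P d)" using less.prems(3) c by auto
    qed (use c in auto)
    then show ?thesis using less.prems(3)[OF c n] \<open>nxt P c = b\<close> by simp
  qed (use base in simp)
qed

lemma psum_mono:
  assumes "finite P" "b \<in> P" "\<And>x y. x \<in> P \<Longrightarrow> y \<in> P \<Longrightarrow> a \<le> x \<Longrightarrow> x < y \<Longrightarrow> y \<le> b \<Longrightarrow> q x y \<le> r x y"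
  shows "psum q P a b \<le> psum r P a b"
  unfolding psum_def using assms nxt[OF assms(1,2)] by (intro sum_mono) auto

lemma psum_nonneg:
  assumes "finite P" "b \<in> P" "\<And>x y. x \<in> P \<Longrightarrow> y \<in> P \<Longrightarrow> a \<le> x \<Longrightarrow> x < y \<Longrightarrow> y \<le> b \<Longrightarrow> 0 \<le> q x y"
  shows "0 \<le> psum q P a b"
  unfolding psum_def using assms nxt[OF assms(1,2)] by (intro sum_nonneg) auto

lemma psum_telescope:
  assumes "finite P" "a \<in> P" "b \<in> P" "a \<le> b"
  shows "psum (\<lambda>s t. g t - g s) P a b = g b - g a"
  using assms
proof (induction rule: partition_induct)
  case (step c)
  then show ?case using psum_nxt[of P c b a "\<lambda>s t. g t - g s"] assms by simp
qed simp

text \<open>By Tychonoff's theorem the interval functions \<open>psum (q k) P\<close> have a cluster point along the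
  directed set of partitions. All its coordinates are approximated by one and the same partition,
  so additivity in the interval and monotonicity in \<open>q\<close> pass to the cluster point.\<close>

lemma partition_cluster_point:
  fixes q :: "'i \<Rightarrow> real \<Rightarrow> real \<Rightarrow> real" and B :: "'i \<Rightarrow> real"
  assumes bnd: "\<And>k P a b. finite P \<Longrightarrow> P \<subseteq> {0..1} \<Longrightarrow> a \<in> P \<Longrightarrow> b \<in> P \<Longrightarrow> a \<le> b \<Longrightarrow>
      0 \<le> psum (q k) P a b \<and> psum (q k) P a b \<le> B k"
  obtains L :: "'i \<Rightarrow> real \<Rightarrow> real \<Rightarrow> real" where
    "\<And>J P0 \<eta>. finite J \<Longrightarrow> (\<And>k a b. (k, a, b) \<in> J \<Longrightarrow> 0 \<le> a \<and> a \<le> b \<and> b \<le> 1) \<Longrightarrow>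
        finite P0 \<Longrightarrow> P0 \<subseteq> {0..1} \<Longrightarrow> 0 < \<eta> \<Longrightarrow>
      \<exists>P. finite P \<and> P0 \<subseteq> P \<and> P \<subseteq> {0..1} \<and> (\<forall>(k, a, b)\<in>J. a \<in> P \<and> b \<in> P \<and> \<bar>psum (q k) P a b - L k a b\<bar> < \<eta>)"
proof -
  \<comment> \<open>The default 0 for intervals whose ends are not in \<open>P\<close> is harmless:
    along the directed set of partitions every given point eventually belongs to
    \<open>P\<close>.\<close>
  define v where "v P = (\<lambda>(k, a, b). if a \<in> P \<and> b \<in> P \<and> a \<le> b then psum (q k) P a b else 0)" for P
  define F where "F = filtermap v (finite_subsets_at_top {0..1})"
  define U where "U = Pi\<^sub>E UNIV (\<lambda>(k::'i, a::real, b::real). {0..max 0 (B k)})"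
  have "compactin (product_topology (\<lambda>_. euclidean) UNIV) U"
    unfolding U_def compactin_PiE by (auto simp: compactin_euclidean_iff)
  then have "compact U" by (simp add: euclidean_product_topology compactin_euclidean_iff)
  moreover have "F \<noteq> bot" by (simp add: F_def filtermap_bot_iff)
  moreover have "eventually (\<lambda>x. x \<in> U) F"
    unfolding F_def eventually_filtermap
    by (rule eventually_mono[OF eventually_finite_subsets_at_top_weakI[of "{0..1}" "\<lambda>P. finite P \<and> P \<subseteq> {0..1}"]])
       (auto simp: U_def v_def PiE_iff bnd le_max_iff_disj)
  ultimately obtain x where x: "inf (nhds x) F \<noteq> bot" by (auto simp: compact_filter)
  show ?thesis
  proof (rule that[of "\<lambda>k a b. x (k, a, b)"])
    fix J :: "('i \<times> real \<times> real) set" and P0 :: "real set" and \<eta> :: real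
    assume J: "finite J" "\<And>k a b. (k, a, b) \<in> J \<Longrightarrow> 0 \<le> a \<and> a \<le> b \<and> b \<le> 1"
      and P0: "finite P0" "P0 \<subseteq> {0..1}" and \<eta>: "0 < \<eta>"
    have "eventually (\<lambda>y. \<bar>y j - x j\<bar> < \<eta>) (nhds x)" for j
    proof -
      have "open {y. \<bar>y j - x j\<bar> < \<eta>}"
        by (intro open_Collect_less continuous_intros continuous_on_product_coordinates)
      from eventually_nhds_in_open[OF this, of x] show ?thesis using \<eta> by simp
    qed
    then have 1: "eventually (\<lambda>y. \<forall>j\<in>J. \<bar>y j - x j\<bar> < \<eta>) (nhds x)"
      using J(1) by (intro eventually_ball_finite) auto
    define P1 where "P1 = P0 \<union> (\<lambda>(k, a, b). a) ` J \<union> (\<lambda>(k, a, b). b) ` J"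
    have P1: "finite P1" "P1 \<subseteq> {0..1}" using J P0 by (auto simp: P1_def) force+
    have 2: "eventually (\<lambda>y. \<exists>P. finite P \<and> P1 \<subseteq> P \<and> P \<subseteq> {0..1} \<and> y = v P) F"
      unfolding F_def eventually_filtermap eventually_finite_subsets_at_top using P1 by blast
    have "eventually (\<lambda>y. (\<forall>j\<in>J. \<bar>y j - x j\<bar> < \<eta>) \<and> (\<exists>P. finite P \<and> P1 \<subseteq> P \<and> P \<subseteq> {0..1} \<and> y = v P)) (inf (nhds x) F)"
      using 1 2 unfolding eventually_inf by blast
    then obtain P where P: "finite P" "P1 \<subseteq> P" "P \<subseteq> {0..1}" "\<forall>j\<in>J. \<bar>v P j - x j\<bar> < \<eta>"
      using eventually_happens'[OF x] by blast
    have "a \<in> P \<and> b \<in> P \<and> \<bar>psum (q k) P a b - x (k, a, b)\<bar> < \<eta>" if "(k, a, b) \<in> J" for k a b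
    proof -
      have "a \<in> P" "b \<in> P" using that P(2) by (force simp: P1_def)+
      then show ?thesis using P(4) that J(2)[OF that] by (force simp: v_def)
    qed
    then show "\<exists>P. finite P \<and> P0 \<subseteq> P \<and> P \<subseteq> {0..1} \<and> (\<forall>(k, a, b)\<in>J. a \<in> P \<and> b \<in> P \<and> \<bar>psum (q k) P a b - x (k, a, b)\<bar> < \<eta>)"
      using P by (intro exI[of _ P]) (auto simp: P1_def)
  qed
qed

subsection \<open>Convolution hemigroups\<close>

lemma real_distribution_convolution:
  assumes "real_distribution \<alpha>" "real_distribution \<beta>"
  shows "real_distribution (\<alpha> \<star> \<beta>)"
proof -
  interpret a: real_distribution \<alpha> by fact
  interpret b: real_distribution \<beta> by fact
  interpret pair_prob_space \<alpha> \<beta> ..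
  show ?thesis unfolding convolution_def by (intro real_distribution_distr) auto
qed

lemma (in real_distribution) integrable_linear_growth:
  fixes g :: "real \<Rightarrow> real"
  assumes "integrable M (\<lambda>x. x)" "g \<in> borel_measurable borel" "\<And>x. \<bar>g x\<bar> \<le> A + B * \<bar>x\<bar>"
  shows "integrable M g"
proof (rule Bochner_Integration.integrable_bound)
  show "integrable M (\<lambda>x. A + B * \<bar>x\<bar>)" using assms(1) by auto
  show "AE x in M. norm (g x) \<le> norm (A + B * \<bar>x\<bar>)"
    using order_trans[OF assms(3) abs_ge_self] by simp
qed (use assms(2) in simp)

lemma convolution_integral:
  fixes g :: "real \<Rightarrow> 'b::{banach, second_countable_topology}"
  assumes a: "real_distribution \<alpha>" and b: "real_distribution \<beta>"
    and g: "integrable (\<alpha> \<star> \<beta>) g"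
  shows "integrable \<alpha> (\<lambda>x. \<integral>y. g (x + y) \<partial>\<beta>)"
    and "(\<integral>x. g x \<partial>(\<alpha> \<star> \<beta>)) = (\<integral>x. \<integral>y. g (x + y) \<partial>\<beta> \<partial>\<alpha>)"
    and "AE x in \<alpha>. integrable \<beta> (\<lambda>y. g (x + y))"
proof -
  interpret a: real_distribution \<alpha> by fact
  interpret b: real_distribution \<beta> by fact
  interpret pair_prob_space \<alpha> \<beta> ..
  have gm[measurable]: "g \<in> borel_measurable borel"
    using borel_measurable_integrable[OF g] by simp
  have i: "integrable (\<alpha> \<Otimes>\<^sub>M \<beta>) (case_prod (\<lambda>x y. g (x + y)))"
    using g unfolding convolution_def by (subst (asm) integrable_distr_eq) (auto simp: case_prod_unfold)
  show "integrable \<alpha> (\<lambda>x. \<integral>y. g (x + y) \<partial>\<beta>)" using integrable_fst[OF i] by simp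
  show "AE x in \<alpha>. integrable \<beta> (\<lambda>y. g (x + y))" using AE_integrable_fst[OF i] by simp
  show "(\<integral>x. g x \<partial>(\<alpha> \<star> \<beta>)) = (\<integral>x. \<integral>y. g (x + y) \<partial>\<beta> \<partial>\<alpha>)"
    unfolding integral_fst[OF i] unfolding convolution_def
    by (subst integral_distr) (auto simp: case_prod_unfold)
qed

lemma convolution_nn_integral:
  assumes a: "real_distribution \<alpha>" and b: "real_distribution \<beta>"
    and g: "g \<in> borel_measurable borel"
  shows "(\<integral>\<^sup>+x. g x \<partial>(\<alpha> \<star> \<beta>)) = (\<integral>\<^sup>+x. \<integral>\<^sup>+y. g (x + y) \<partial>\<beta> \<partial>\<alpha>)"
  using real_distribution.events_eq_borel[OF a] real_distribution.events_eq_borel[OF b] assms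
  by (intro nn_integral_convolution) (auto simp: real_distribution_def prob_space_def)

lemma convolution_commute:
  assumes a: "real_distribution \<alpha>" and b: "real_distribution \<beta>"
  shows "(\<alpha> \<star> \<beta>) = (\<beta> \<star> \<alpha>)"
  using real_distribution.events_eq_borel[OF a] real_distribution.events_eq_borel[OF b] assms
  by (intro convolution_commutative) (auto simp: real_distribution_def prob_space_def)

lemma char_convolution:
  assumes a: "real_distribution \<alpha>" and b: "real_distribution \<beta>"
  shows "char (\<alpha> \<star> \<beta>) t = char \<alpha> t * char \<beta> t"
proof -
  interpret c: real_distribution "\<alpha> \<star> \<beta>" using real_distribution_convolution[OF a b] .
  show ?thesis
    unfolding char_def
    by (subst convolution_integral(2)[OF a b]) (auto simp: ring_distribs exp_add intro: c.integrable_iexp)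
qed

lemma convex_abs: "convex_on UNIV (\<lambda>x::real. \<bar>x - k\<bar>)"
proof (intro convex_onI)
  fix t x y :: real assume t: "0 < t" "t < 1"
  have "(1 - t) *\<^sub>R x + t *\<^sub>R y - k = (1 - t) * (x - k) + t * (y - k)" by (simp add: algebra_simps)
  also have "\<bar>\<dots>\<bar> \<le> \<bar>(1 - t) * (x - k)\<bar> + \<bar>t * (y - k)\<bar>" by (rule abs_triangle_ineq)
  finally show "\<bar>(1 - t) *\<^sub>R x + t *\<^sub>R y - k\<bar> \<le> (1 - t) * \<bar>x - k\<bar> + t * \<bar>y - k\<bar>"
    using t by (simp add: abs_mult)
qed auto

lemma convex_subgradient:
  fixes g :: "real \<Rightarrow> real"
  assumes "convex_on UNIV g"
  obtains d where "\<And>y. g x + d * (y - x) \<le> g y"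
  using convex_le_Inf_differential[OF assms, of x] by auto

lemma (in real_distribution) prob_UNIV [simp]: "measure M UNIV = 1"
  using prob_space by simp

lemma (in real_distribution) jensen_shift:
  fixes g :: "real \<Rightarrow> real"
  assumes "convex_on UNIV g" "integrable M (\<lambda>x. x)" "(\<integral>x. x \<partial>M) = 0" "integrable M (\<lambda>y. g (x + y))"
  shows "g x \<le> (\<integral>y. g (x + y) \<partial>M)"
proof -
  obtain d where d: "\<And>y. g x + d * (y - x) \<le> g y" using convex_subgradient[OF assms(1)] by blast
  have "g x = (\<integral>y. g x + d * y \<partial>M)" using assms by simp
  also have "\<dots> \<le> (\<integral>y. g (x + y) \<partial>M)"
    using assms d[of "x + _"] by (intro integral_mono) auto
  finally show ?thesis .
qed

text \<open>Stated for nonnegative integrals so that integrability over the factor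
  \<open>\<alpha>\<close> can be deduced instead of being presupposed. If \<open>g (x + y)\<close>
  is not integrable in \<open>y\<close>, the inner integral is infinite and nothing is to be
  shown.\<close>

lemma convolution_convex_nn_integral_mono:
  fixes g :: "real \<Rightarrow> real"
  assumes a: "real_distribution \<alpha>" and b: "real_distribution \<beta>"
    and m: "integrable \<beta> (\<lambda>x. x)" "(\<integral>x. x \<partial>\<beta>) = 0"
    and g: "convex_on UNIV g" "\<And>x. 0 \<le> g x" "g \<in> borel_measurable borel"
  shows "(\<integral>\<^sup>+x. g x \<partial>\<alpha>) \<le> (\<integral>\<^sup>+x. g x \<partial>(\<alpha> \<star> \<beta>))"
proof -
  interpret b: real_distribution \<beta> by fact
  have "ennreal (g x) \<le> (\<integral>\<^sup>+y. g (x + y) \<partial>\<beta>)" for x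
  proof (cases "integrable \<beta> (\<lambda>y. g (x + y))")
    case True
    then show ?thesis using b.jensen_shift[OF g(1) m True] g by (simp add: nn_integral_eq_integral ennreal_leI)
  next
    case False
    then have "(\<integral>\<^sup>+y. g (x + y) \<partial>\<beta>) = \<infinity>" using g
      by (simp add: integrable_iff_bounded top.not_eq_extremum[symmetric])
    then show ?thesis by simp
  qed
  then show ?thesis using g by (subst convolution_nn_integral[OF a b]) (auto intro!: nn_integral_mono)
qed

lemma convolution_convex_integrable_left:
  fixes g :: "real \<Rightarrow> real"
  assumes a: "real_distribution \<alpha>" and b: "real_distribution \<beta>"
    and m: "integrable \<beta> (\<lambda>x. x)" "(\<integral>x. x \<partial>\<beta>) = 0"
    and g: "convex_on UNIV g" "\<And>x. 0 \<le> g x" "integrable (\<alpha> \<star> \<beta>) g"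
  shows "integrable \<alpha> g"
proof -
  interpret a: real_distribution \<alpha> by fact
  have gm: "g \<in> borel_measurable borel"
    using borel_measurable_integrable[OF g(3)] by simp
  have "(\<integral>\<^sup>+x. g x \<partial>\<alpha>) \<le> (\<integral>\<^sup>+x. g x \<partial>(\<alpha> \<star> \<beta>))"
    by (rule convolution_convex_nn_integral_mono[OF a b m g(1,2) gm])
  also have "\<dots> < \<infinity>" using g by (simp add: nn_integral_eq_integral)
  finally show ?thesis using gm g(2) by (auto simp: integrable_iff_bounded)
qed

section \<open>Hemigroups of centred laws and the gain in a strictly convex moment\<close>

locale centred_hemigroup =
  fixes \<mu> :: "real \<Rightarrow> real \<Rightarrow> real measure"
  assumes law: "0 \<le> s \<Longrightarrow> s \<le> t \<Longrightarrow> t \<le> 1 \<Longrightarrow> real_distribution (\<mu> s t)"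
    and conv: "0 \<le> s \<Longrightarrow> s \<le> t \<Longrightarrow> t \<le> u \<Longrightarrow> u \<le> 1 \<Longrightarrow> \<mu> s u = (\<mu> s t \<star> \<mu> t u)"
    and diag: "\<mu> s s = return borel 0"
    and mom: "0 \<le> s \<Longrightarrow> s \<le> t \<Longrightarrow> t \<le> 1 \<Longrightarrow> integrable (\<mu> s t) (\<lambda>x. x)"
    and mean: "0 \<le> s \<Longrightarrow> s \<le> t \<Longrightarrow> t \<le> 1 \<Longrightarrow> (\<integral>x. x \<partial>\<mu> s t) = 0"
begin

lemma integrable_lin:
  fixes g :: "real \<Rightarrow> real"
  assumes "0 \<le> s" "s \<le> t" "t \<le> 1" "g \<in> borel_measurable borel" "\<And>x. \<bar>g x\<bar> \<le> A + B * \<bar>x\<bar>"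
  shows "integrable (\<mu> s t) g"
  using real_distribution.integrable_linear_growth[OF law mom] assms by blast

lemma integral_conv:
  fixes g :: "real \<Rightarrow> real"
  assumes "0 \<le> s" "s \<le> t" "t \<le> u" "u \<le> 1" "integrable (\<mu> s u) g"
  shows "integrable (\<mu> s t) (\<lambda>x. \<integral>y. g (x + y) \<partial>\<mu> t u)"
    and "(\<integral>x. g x \<partial>\<mu> s u) = (\<integral>x. \<integral>y. g (x + y) \<partial>\<mu> t u \<partial>\<mu> s t)"
    and "AE x in \<mu> s t. integrable (\<mu> t u) (\<lambda>y. g (x + y))"
  using convolution_integral[OF law law, of s t t u g] assms conv[of s t u] by auto

text \<open>Jensen's inequality for the strictly convex function \<open>smooth_abs\<close> quantifies the size of an
  increment by the increment of the monotone function \<open>smooth_moment\<close>.\<close>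

definition smooth_abs :: "real \<Rightarrow> real" where "smooth_abs x = sqrt (1 + x\<^sup>2)"
definition soft_sq :: "real \<Rightarrow> real" where "soft_sq y = y\<^sup>2 / (1 + \<bar>y\<bar>)"
definition smooth_moment :: "real \<Rightarrow> real" where "smooth_moment t = (\<integral>x. smooth_abs x \<partial>\<mu> 0 t)"
definition gain_const :: real where "gain_const = 1 / (2 * (1 + (\<integral>x. \<bar>x\<bar> \<partial>\<mu> 0 1)) ^ 3)"

lemma smooth_abs_pos: "0 < smooth_abs x" and smooth_abs_le: "smooth_abs x \<le> 1 + \<bar>x\<bar>" and smooth_abs_sq: "smooth_abs x * smooth_abs x = 1 + x\<^sup>2" and smooth_abs_ge1: "1 \<le> smooth_abs x"
proof -
  show "0 < smooth_abs x" by (simp add: smooth_abs_def add_pos_nonneg)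
  show "smooth_abs x \<le> 1 + \<bar>x\<bar>" unfolding smooth_abs_def
    by (rule real_le_lsqrt) (auto simp: power2_eq_square algebra_simps abs_mult_self_eq)
  show "smooth_abs x * smooth_abs x = 1 + x\<^sup>2" by (simp add: smooth_abs_def)
  show "1 \<le> smooth_abs x" by (simp add: smooth_abs_def)
qed

lemma soft_sq_nonneg: "0 \<le> soft_sq y" and soft_sq_le: "soft_sq y \<le> \<bar>y\<bar>"
  by (auto simp: soft_sq_def field_simps power2_eq_square abs_mult_self_eq)

lemma measurable_smooth_abs[measurable]: "smooth_abs \<in> borel_measurable borel"
  and measurable_soft_sq[measurable]: "soft_sq \<in> borel_measurable borel"
  unfolding smooth_abs_def[abs_def] soft_sq_def[abs_def] by measurable

text \<open>With \<open>a = smooth_abs x\<close>, \<open>b = smooth_abs (x + y)\<close> and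
  \<open>p = 1 + x * (x + y)\<close>, Lagrange's identity for the vectors \<open>(1, x)\<close> and
  \<open>(1, x + y)\<close> reads \<open>(a * b)\<^sup>2 = p\<^sup>2 + y\<^sup>2\<close>. So
  \<open>a * b - p\<close>, which is \<open>a\<close> times the gain over the tangent, is at least
  \<open>y\<^sup>2 / (2 * a * b)\<close>. It remains to bound \<open>a\<close> and \<open>b\<close>
  from above.\<close>

lemma smooth_abs_gain: "soft_sq y / (2 * (1 + \<bar>x\<bar>) ^ 3) \<le> smooth_abs (x + y) - smooth_abs x - x / smooth_abs x * y"
proof -
  define a where "a = smooth_abs x"
  define b where "b = smooth_abs (x + y)"
  have a: "0 < a" "1 \<le> a" "a * a = 1 + x\<^sup>2" and b: "0 < b" "b * b = 1 + (x + y)\<^sup>2"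
    by (auto simp: a_def b_def smooth_abs_pos smooth_abs_sq smooth_abs_ge1)
  define p where "p = 1 + x * (x + y)"
  have "(a * b)\<^sup>2 = (a * a) * (b * b)" by (simp add: power2_eq_square)
  then have id: "(a * b)\<^sup>2 = p\<^sup>2 + y\<^sup>2"
    unfolding a(3) b(2) p_def by (simp add: power2_eq_square algebra_simps)
  then have "p\<^sup>2 \<le> (a * b)\<^sup>2" by simp
  then have "p \<le> a * b" by (rule power2_le_imp_le) (use a(1) b(1) in simp)
  have "0 \<le> (a * b - p)\<^sup>2" by simp
  also have "(a * b - p)\<^sup>2 = 2 * (a * b)\<^sup>2 - y\<^sup>2 - 2 * (a * b) * p"
    unfolding power2_diff using id by simp
  finally have "y\<^sup>2 \<le> (a * b - p) * (2 * (a * b))"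
    by (simp add: power2_eq_square algebra_simps)
  then have *: "y\<^sup>2 / (2 * a * b) \<le> a * b - p" using a(1) b(1) by (simp add: field_simps)
  have "smooth_abs (x + y) - smooth_abs x - x / smooth_abs x * y = (a * b - p) / a"
  proof -
    have "a * b - p = (b - a) * a - x * y" unfolding p_def using a(3) by (simp add: power2_eq_square algebra_simps)
    then show ?thesis using a(1) unfolding a_def[symmetric] b_def[symmetric] by (simp add: diff_divide_distrib)
  qed
  also have "\<dots> \<ge> y\<^sup>2 / (2 * a * b) / a" using * a(1) by (intro divide_right_mono) auto
  finally have 1: "y\<^sup>2 / (2 * a * b) / a \<le> smooth_abs (x + y) - smooth_abs x - x / smooth_abs x * y" .
  have ab: "a \<le> 1 + \<bar>x\<bar>" "b \<le> (1 + \<bar>x\<bar>) * (1 + \<bar>y\<bar>)"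
  proof -
    have "(1 + \<bar>x\<bar>) * (1 + \<bar>y\<bar>) = 1 + \<bar>x\<bar> + \<bar>y\<bar> + \<bar>x * y\<bar>" by (simp add: algebra_simps abs_mult)
    then show "b \<le> (1 + \<bar>x\<bar>) * (1 + \<bar>y\<bar>)"
      using smooth_abs_le[of "x + y"] abs_triangle_ineq[of x y] unfolding b_def by linarith
  qed (simp add: a_def smooth_abs_le)
  have "2 * a * b * a \<le> 2 * (1 + \<bar>x\<bar>) * ((1 + \<bar>x\<bar>) * (1 + \<bar>y\<bar>)) * (1 + \<bar>x\<bar>)"
    using ab a(1) b(1) by (intro mult_mono) auto
  then have "y\<^sup>2 / (2 * (1 + \<bar>x\<bar>) * ((1 + \<bar>x\<bar>) * (1 + \<bar>y\<bar>)) * (1 + \<bar>x\<bar>)) \<le> y\<^sup>2 / (2 * a * b * a)"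
    using a(1) b(1) by (intro divide_left_mono mult_pos_pos) auto
  moreover have "soft_sq y / (2 * (1 + \<bar>x\<bar>) ^ 3) = y\<^sup>2 / (2 * (1 + \<bar>x\<bar>) * ((1 + \<bar>x\<bar>) * (1 + \<bar>y\<bar>)) * (1 + \<bar>x\<bar>))"
    by (simp add: soft_sq_def power3_eq_cube mult_ac)
  ultimately show ?thesis using 1 by simp
qed

lemma abs_moment_le: "0 \<le> s \<Longrightarrow> s \<le> 1 \<Longrightarrow> (\<integral>x. \<bar>x\<bar> \<partial>\<mu> 0 s) \<le> (\<integral>x. \<bar>x\<bar> \<partial>\<mu> 0 1)"
proof -
  assume s: "0 \<le> s" "s \<le> 1"
  interpret p: real_distribution "\<mu> s 1" using s law by simp
  have c: "convex_on UNIV (\<lambda>x::real. \<bar>x\<bar>)" using convex_abs[of 0] by simp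
  have i: "integrable (\<mu> 0 1) (\<lambda>x. \<bar>x\<bar>)" by (rule integrable_lin[where A=0 and B=1]) auto
  have "(\<integral>x. \<bar>x\<bar> \<partial>\<mu> 0 1) = (\<integral>x. \<integral>y. \<bar>x + y\<bar> \<partial>\<mu> s 1 \<partial>\<mu> 0 s)"
    using integral_conv(2)[OF _ _ _ _ i, of s] s by simp
  also have "\<dots> \<ge> (\<integral>x. \<bar>x\<bar> \<partial>\<mu> 0 s)"
  proof (rule integral_mono)
    show "integrable (\<mu> 0 s) (\<lambda>x. \<bar>x\<bar>)" by (rule integrable_lin[where A=0 and B=1]) (use s in auto)
    show "integrable (\<mu> 0 s) (\<lambda>x. \<integral>y. \<bar>x + y\<bar> \<partial>\<mu> s 1)" using integral_conv(1)[OF _ _ _ _ i, of s] s by simp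
  next
    fix x
    have "integrable (\<mu> s 1) (\<lambda>y. \<bar>x + y\<bar>)" by (rule integrable_lin[where A="\<bar>x\<bar>" and B=1]) (use s in auto)
    then show "\<bar>x\<bar> \<le> (\<integral>y. \<bar>x + y\<bar> \<partial>\<mu> s 1)" using p.jensen_shift[OF c] mom mean s by auto
  qed
  finally show ?thesis .
qed

lemma gain_const_pos: "0 < gain_const"
  unfolding gain_const_def by (intro divide_pos_pos mult_pos_pos zero_less_power add_pos_nonneg Bochner_Integration.integral_nonneg) auto

text \<open>Averages \<open>smooth_abs_gain\<close> over the increment \<open>y\<close> with law
  \<open>\<mu> s t\<close> and then over the starting value \<open>x\<close> with law
  \<open>\<mu> 0 s\<close>; the tangent terms disappear because the increments are centred. The
  constant is the value of \<open>1 / (2 * (1 + \<bar>x\<bar>) ^ 3)\<close> with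
  \<open>\<bar>x\<bar>\<close> replaced by the first absolute moment at time 1.\<close>

lemma soft_sq_increment:
  assumes st: "0 \<le> s" "s \<le> t" "t \<le> 1"
  shows "gain_const * (\<integral>y. soft_sq y \<partial>\<mu> s t) \<le> smooth_moment t - smooth_moment s"
proof -
  interpret p: real_distribution "\<mu> 0 s" using st law by simp
  interpret r: real_distribution "\<mu> s t" using st law by simp
  have it: "integrable (\<mu> 0 t) smooth_abs" "integrable (\<mu> 0 s) smooth_abs"
    by (rule integrable_lin[where A=1 and B=1]; use st smooth_abs_le smooth_abs_pos in \<open>auto simp: less_imp_le abs_of_pos\<close>)+
  have soft_sq: "integrable (\<mu> s t) soft_sq" by (rule integrable_lin[where A=0 and B=1]) (use st soft_sq_le soft_sq_nonneg in auto)
  have sh: "integrable (\<mu> s t) (\<lambda>y. smooth_abs (x + y))" for x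
  proof (rule integrable_lin[where A="1+\<bar>x\<bar>" and B=1])
    fix y show "\<bar>smooth_abs (x + y)\<bar> \<le> 1 + \<bar>x\<bar> + 1 * \<bar>y\<bar>" using smooth_abs_le[of "x+y"] smooth_abs_pos[of "x+y"] by auto
  qed (use st in auto)
  define I where "I = (\<integral>y. soft_sq y \<partial>\<mu> s t)"
  have I0: "0 \<le> I" unfolding I_def using soft_sq_nonneg by (intro Bochner_Integration.integral_nonneg) auto
  define A where "A = 1 + (\<integral>x. \<bar>x\<bar> \<partial>\<mu> 0 1)"
  have A: "1 \<le> A" by (simp add: A_def)
  have pt: "I * (1 / (2 * A ^ 3) * (4 - 3 * ((1 + \<bar>x\<bar>) / A))) + smooth_abs x \<le> (\<integral>y. smooth_abs (x + y) \<partial>\<mu> s t)" for x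
  proof -
    define u where "u = (1 + \<bar>x\<bar>) / A"
    have u: "0 < u" using A by (simp add: u_def add_pos_nonneg)
    \<comment> \<open>\<open>4 - 3 * u\<close> is the tangent of the convex function
      \<open>1 / u ^ 3\<close> at \<open>u = 1\<close>. Being linear in
      \<open>\<bar>x\<bar>\<close>, it leaves only a first absolute moment when \<open>x\<close> is
      integrated out.\<close>
    have "0 \<le> (u - 1)\<^sup>2 * (3 * u\<^sup>2 + 2 * u + 1)" using u by simp
    also have "\<dots> = 1 - (4 - 3 * u) * u ^ 3" by (simp add: power2_eq_square power3_eq_cube algebra_simps)
    finally have "4 - 3 * u \<le> 1 / u ^ 3" using u by (simp add: field_simps)
    then have "1 / (2 * A ^ 3) * (4 - 3 * u) \<le> 1 / (2 * A ^ 3) * (1 / u ^ 3)"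
      using A by (intro mult_left_mono) auto
    also have "\<dots> = 1 / (2 * (1 + \<bar>x\<bar>) ^ 3)" using A by (simp add: u_def power_divide)
    finally have "I * (1 / (2 * A ^ 3) * (4 - 3 * u)) \<le> I * (1 / (2 * (1 + \<bar>x\<bar>) ^ 3))"
      using I0 by (intro mult_left_mono)
    also have "\<dots> = (\<integral>y. soft_sq y / (2 * (1 + \<bar>x\<bar>) ^ 3) \<partial>\<mu> s t)" by (simp add: I_def)
    also have "\<dots> \<le> (\<integral>y. smooth_abs (x + y) - smooth_abs x - x / smooth_abs x * y \<partial>\<mu> s t)"
      using soft_sq sh mom st by (intro integral_mono smooth_abs_gain) auto
    also have "\<dots> = (\<integral>y. smooth_abs (x + y) \<partial>\<mu> s t) - smooth_abs x"
      using sh mom[of s t] mean[of s t] st by simp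
    finally show ?thesis by (simp add: u_def)
  qed
  have "smooth_moment t = (\<integral>x. \<integral>y. smooth_abs (x + y) \<partial>\<mu> s t \<partial>\<mu> 0 s)"
    unfolding smooth_moment_def using integral_conv(2)[OF _ _ _ _ it(1), of s] st by simp
  also have "\<dots> \<ge> (\<integral>x. I * (1 / (2 * A ^ 3) * (4 - 3 * ((1 + \<bar>x\<bar>) / A))) + smooth_abs x \<partial>\<mu> 0 s)"
    using it st integral_conv(1)[OF _ _ _ _ it(1), of s] mom[of 0 s]
    by (intro integral_mono pt) auto
  also have "(\<integral>x. I * (1 / (2 * A ^ 3) * (4 - 3 * ((1 + \<bar>x\<bar>) / A))) + smooth_abs x \<partial>\<mu> 0 s)
      = I * (1 / (2 * A ^ 3) * (4 - 3 * ((1 + (\<integral>x. \<bar>x\<bar> \<partial>\<mu> 0 s)) / A))) + smooth_moment s"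
    using it mom[of 0 s] st by (simp add: smooth_moment_def)
  also have "\<dots> \<ge> I * (1 / (2 * A ^ 3) * 1) + smooth_moment s"
  proof -
    have "(1 + (\<integral>x. \<bar>x\<bar> \<partial>\<mu> 0 s)) / A \<le> 1"
    proof -
      have "1 + (\<integral>x. \<bar>x\<bar> \<partial>\<mu> 0 s) \<le> A" using abs_moment_le[of s] st by (simp add: A_def)
      then show ?thesis using A by (simp add: divide_le_eq)
    qed
    then have "1 \<le> 4 - 3 * ((1 + (\<integral>x. \<bar>x\<bar> \<partial>\<mu> 0 s)) / A)" by linarith
    then show ?thesis by (intro add_right_mono mult_left_mono I0) (use A in auto)
  qed
  finally show ?thesis by (simp add: gain_const_def A_def I_def field_simps)
qed

lemma smooth_moment_mono: "0 \<le> s \<Longrightarrow> s \<le> t \<Longrightarrow> t \<le> 1 \<Longrightarrow> smooth_moment s \<le> smooth_moment t"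
proof -
  assume st: "0 \<le> s" "s \<le> t" "t \<le> 1"
  have "0 \<le> (\<integral>y. soft_sq y \<partial>\<mu> s t)" using soft_sq_nonneg by (intro Bochner_Integration.integral_nonneg) auto
  then have "0 \<le> gain_const * (\<integral>y. soft_sq y \<partial>\<mu> s t)" using gain_const_pos by simp
  then show ?thesis using soft_sq_increment[OF st] by simp
qed

end

subsection \<open>The variance of the Gaussian part\<close>

text \<open>A second order expansion in which the square is truncated at the small level
  \<open>\<kappa>\<close>, so that no second moment is needed. Up to \<open>\<kappa>\<close> the
  cubic remainder is a small multiple of the truncated square. Between \<open>\<kappa>\<close> and
  \<open>e\<close> the error is charged to the difference of the two truncations, at the price of a
  factor \<open>1 / (\<bar>w\<bar> * \<kappa>)\<close>; that difference will be small. Beyond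
  \<open>e\<close> the crude linear bound suffices.\<close>

lemma iexp_truncated_second_order:
  fixes w y \<kappa> e :: real
  assumes k: "0 < \<bar>w\<bar> * \<kappa>" "\<bar>w\<bar> * \<kappa> \<le> 1" and e: "0 < \<kappa>" "\<kappa> \<le> e"
  shows "cmod (iexp (w * y) - 1 - \<i> * (w * y) + (1/2) * w\<^sup>2 * min (y\<^sup>2) (\<kappa>\<^sup>2))
    \<le> 2 * (\<bar>w\<bar> * \<kappa>) * (w\<^sup>2 * min (y\<^sup>2) (\<kappa>\<^sup>2))
      + 2 / (\<bar>w\<bar> * \<kappa>) * (w\<^sup>2 * (min (y\<^sup>2) (e\<^sup>2) - min (y\<^sup>2) (\<kappa>\<^sup>2)))
      + 3 * \<bar>w\<bar> * (if e < \<bar>y\<bar> then \<bar>y\<bar> else 0)"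
proof -
  define z where "z = \<bar>w\<bar> * \<bar>y\<bar>"
  define k where "k = \<bar>w\<bar> * \<kappa>"
  have w: "0 < \<bar>w\<bar>" using k e by (simp add: zero_less_mult_iff)
  have k0: "0 < k" "k \<le> 1" using k by (auto simp: k_def)
  have z0: "0 \<le> z" by (simp add: z_def)
  have z2: "(w * y)\<^sup>2 = z\<^sup>2" "\<bar>w * y\<bar> = z" by (simp_all add: z_def power_mult_distrib abs_mult)
  have k2: "w\<^sup>2 * \<kappa>\<^sup>2 = k\<^sup>2" by (simp add: k_def power_mult_distrib)
  have wy2: "w\<^sup>2 * y\<^sup>2 = z\<^sup>2" by (simp add: z_def power_mult_distrib)
  define x where "x = w * y"
  define E where "E c = cmod (iexp x - 1 - \<i> * complex_of_real x + complex_of_real c)" for c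
  have S2: "(\<Sum>j\<le>2. (\<i> * complex_of_real x) ^ j / fact j) = 1 + \<i> * complex_of_real x - complex_of_real (x\<^sup>2 / 2)"
    by (simp add: eval_nat_numeral algebra_simps)
  have S1: "(\<Sum>j\<le>1. (\<i> * complex_of_real x) ^ j / fact j) = 1 + \<i> * complex_of_real x"
    by (simp add: eval_nat_numeral)
  have xz: "x\<^sup>2 = z\<^sup>2" "\<bar>x\<bar> = z" using z2 by (simp_all add: x_def)
  have "cmod (iexp x - (1 + \<i> * complex_of_real x - complex_of_real (x\<^sup>2 / 2))) \<le> \<bar>x\<bar> ^ Suc 2 / fact (Suc 2)"
    using iexp_approx1[of x 2] unfolding S2 .
  then have Ez: "E (z\<^sup>2 / 2) \<le> z ^ 3 / 6" unfolding E_def xz by (simp add: eval_nat_numeral algebra_simps)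
  have "cmod (iexp x - (1 + \<i> * complex_of_real x)) \<le> \<bar>x\<bar> ^ Suc 1 / fact (Suc 1)"
    using iexp_approx1[of x 1] unfolding S1 .
  then have ex1: "E 0 \<le> z\<^sup>2 / 2" unfolding E_def xz by (simp add: eval_nat_numeral algebra_simps)
  have "cmod (iexp x - (1 + \<i> * complex_of_real x)) \<le> 2 * \<bar>x\<bar> ^ 1 / fact 1"
    using iexp_approx2[of x 1] unfolding S1 .
  then have ex0: "E 0 \<le> 2 * z" unfolding E_def xz by (simp add: algebra_simps)
  have Etri: "E c \<le> E c' + \<bar>c - c'\<bar>" for c c'
  proof -
    have "E c = cmod ((iexp x - 1 - \<i> * complex_of_real x + complex_of_real c') + complex_of_real (c - c'))"
      unfolding E_def by (rule arg_cong[where f=cmod]) (simp add: algebra_simps)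
    also have "\<dots> \<le> E c' + cmod (complex_of_real (c - c'))"
      unfolding E_def by (rule norm_triangle_ineq)
    finally show ?thesis by (simp only: norm_of_real)
  qed
  have lhs: "cmod (iexp (w * y) - 1 - \<i> * (w * y) + (1/2) * w\<^sup>2 * min (y\<^sup>2) (\<kappa>\<^sup>2)) = E ((1/2) * w\<^sup>2 * min (y\<^sup>2) (\<kappa>\<^sup>2))"
    by (simp add: E_def x_def)
  have cmp: "y\<^sup>2 \<le> c\<^sup>2 \<longleftrightarrow> \<bar>y\<bar> \<le> c" if "0 < c" for c
    using that by (metis abs_le_square_iff abs_of_pos)
  have zk: "z \<le> k \<longleftrightarrow> \<bar>y\<bar> \<le> \<kappa>" using w by (simp add: z_def k_def)
  consider "\<bar>y\<bar> \<le> \<kappa>" | "\<kappa> < \<bar>y\<bar>" "\<bar>y\<bar> \<le> e" | "e < \<bar>y\<bar>" by linarith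
  then show ?thesis
  proof cases
    case 1
    then have m: "min (y\<^sup>2) (\<kappa>\<^sup>2) = y\<^sup>2" "min (y\<^sup>2) (e\<^sup>2) = y\<^sup>2" using cmp e by (auto simp: min_def)
    have "z ^ 3 \<le> k * z\<^sup>2"
      using 1 zk mult_right_mono[of z k "z\<^sup>2"] by (simp add: power3_eq_cube power2_eq_square mult_ac)
    moreover have "0 \<le> k * z\<^sup>2" using k0 by simp
    ultimately have "E (z\<^sup>2 / 2) \<le> 2 * (k * z\<^sup>2)" using Ez by linarith
    then have "E (z\<^sup>2 / 2) \<le> 2 * k * z\<^sup>2" by simp
    then show ?thesis unfolding lhs unfolding m using 1 e by (simp add: wy2 k_def)
  next
    case 2
    then have m: "min (y\<^sup>2) (\<kappa>\<^sup>2) = \<kappa>\<^sup>2" "min (y\<^sup>2) (e\<^sup>2) = y\<^sup>2" using cmp[of \<kappa>] cmp[of e] e by (auto simp: min_def)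
    have "k < z" using 2 zk by auto
    then have kz2: "k\<^sup>2 < z\<^sup>2" using k0 by (simp add: power_strict_mono)
    define D where "D = (z\<^sup>2 - k\<^sup>2) / k"
    have d: "z\<^sup>2 - k\<^sup>2 \<le> D" unfolding D_def 
      unfolding pos_le_divide_eq[OF k0(1)] using kz2 k0 by (intro mult_left_le) auto
    have D0: "0 < D" using kz2 k0 by (simp add: D_def)
    have D2: "(z\<^sup>2 - k\<^sup>2) / 2 \<le> 2 * D"
    proof -
      have "X / 2 \<le> 2 * D" if "X \<le> D" for X using that D0 by simp
      from this[OF d] show ?thesis .
    qed
    have "E (k\<^sup>2 / 2) \<le> 2 * k * k\<^sup>2 + 2 / k * (z\<^sup>2 - k\<^sup>2)"
    \<comment> \<open>Up to \<open>2 * k\<close> the cubic remainder is still of order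
      \<open>k ^ 3\<close>. Beyond it \<open>z\<^sup>2 - k\<^sup>2\<close> dominates both
      \<open>z\<^sup>2\<close> and \<open>k\<^sup>2\<close> up to constants, so the quadratic
      remainder is enough.\<close>
    proof (cases "z \<le> 2 * k")
      case True
      then have "z ^ 3 \<le> (2 * k) ^ 3" using z0 by (intro power_mono)
      moreover have "(2 * k) ^ 3 = 8 * (k * k\<^sup>2)" by (simp add: power3_eq_cube power2_eq_square)
      moreover have "0 \<le> k * k\<^sup>2" using k0 by simp
      ultimately have z3: "z ^ 3 / 6 \<le> 2 * k * k\<^sup>2" by linarith
      have "E (k\<^sup>2 / 2) \<le> z ^ 3 / 6 + \<bar>k\<^sup>2 / 2 - z\<^sup>2 / 2\<bar>"
        using Etri[of "k\<^sup>2 / 2" "z\<^sup>2 / 2"] Ez by linarith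
      also have "\<bar>k\<^sup>2 / 2 - z\<^sup>2 / 2\<bar> = (z\<^sup>2 - k\<^sup>2) / 2"
        using kz2 by (simp add: diff_divide_distrib)
      finally have E1: "E (k\<^sup>2 / 2) \<le> z ^ 3 / 6 + (z\<^sup>2 - k\<^sup>2) / 2" .
      from order_trans[OF E1 add_mono[OF z3 D2]] have "E (k\<^sup>2 / 2) \<le> 2 * k * k\<^sup>2 + 2 * D" .
      then show ?thesis by (simp add: D_def)
    next
      case False
      then have "(2 * k)\<^sup>2 \<le> z\<^sup>2" using k0 by (intro power_mono) auto
      then have k4: "4 * k\<^sup>2 \<le> z\<^sup>2" by (simp add: power_mult_distrib)
      have "0 \<le> 2 * k * k\<^sup>2" using k0 by simp
      moreover have "E (k\<^sup>2 / 2) \<le> z\<^sup>2 / 2 + k\<^sup>2 / 2" using Etri[of "k\<^sup>2 / 2" 0] ex1 by simp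
      ultimately have "E (k\<^sup>2 / 2) \<le> 2 * k * k\<^sup>2 + 2 * D" using k4 d kz2 by linarith
      then show ?thesis by (simp add: D_def)
    qed
    then show ?thesis unfolding lhs unfolding m using 2 e
      by (simp add: k_def[symmetric] wy2 k2 right_diff_distrib mult.assoc)
  next
    case 3
    then have m: "min (y\<^sup>2) (\<kappa>\<^sup>2) = \<kappa>\<^sup>2" "min (y\<^sup>2) (e\<^sup>2) = e\<^sup>2" using cmp[of \<kappa>] cmp[of e] e by (auto simp: min_def)
    have "k < z" using 3 zk e by auto
    have "k\<^sup>2 \<le> k" using k0 by (simp add: power2_eq_square mult_left_le)
    then have "E (k\<^sup>2 / 2) \<le> 3 * z" using Etri[of "k\<^sup>2 / 2" 0] ex0 \<open>k < z\<close> z0 by simp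
    moreover have "0 \<le> 2 * k * k\<^sup>2" "0 \<le> 2 / k * (w\<^sup>2 * (e\<^sup>2 - \<kappa>\<^sup>2))" using k0 e by auto
    ultimately have "E (k\<^sup>2 / 2) \<le> 2 * k * k\<^sup>2 + 2 / k * (w\<^sup>2 * (e\<^sup>2 - \<kappa>\<^sup>2)) + 3 * z" by linarith
    then show ?thesis unfolding lhs unfolding m using 3 by (simp add: k_def[symmetric] k2 z_def mult.assoc)
  qed
qed

lemma integral_lincomb:
  fixes f g h :: "real \<Rightarrow> real"
  assumes "integrable M f" "integrable M g" "integrable M h"
  shows "integrable M (\<lambda>y. a * (b * f y) + c * (b * (g y - f y)) + d * h y)"
    and "(\<integral>y. a * (b * f y) + c * (b * (g y - f y)) + d * h y \<partial>M)
      = a * (b * integral\<^sup>L M f) + c * (b * (integral\<^sup>L M g - integral\<^sup>L M f)) + d * integral\<^sup>L M h"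
  using assms by auto

section \<open>Truncated variances and characteristic functions over a partition\<close>

context centred_hemigroup
begin

definition trunc_var :: "real \<Rightarrow> real \<Rightarrow> real \<Rightarrow> real" where
  "trunc_var e s t = (\<integral>y. min (y\<^sup>2) (e\<^sup>2) \<partial>\<mu> s t)"

definition tail_moment :: "real \<Rightarrow> real \<Rightarrow> real \<Rightarrow> real" where
  "tail_moment e s t = (\<integral>y. (if e < \<bar>y\<bar> then \<bar>y\<bar> else 0) \<partial>\<mu> s t)"

lemma soft_sq_integrable: "0 \<le> s \<Longrightarrow> s \<le> t \<Longrightarrow> t \<le> 1 \<Longrightarrow> integrable (\<mu> s t) soft_sq"
  by (rule integrable_lin[where A=0 and B=1]) (use soft_sq_le soft_sq_nonneg in auto)

text \<open>\<open>soft_sq\<close> is quadratic near 0 and linear at infinity. It therefore controls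
  both the truncated variance and the tail moment, and both become dominated by increments of
  \<open>smooth_moment\<close>.\<close>

lemma soft_sq_bounds:
  assumes "0 \<le> e" "e \<le> 1" shows "min (y\<^sup>2) (e\<^sup>2) \<le> 2 * soft_sq y"
proof (cases "\<bar>y\<bar> \<le> 1")
  case True
  have "y\<^sup>2 * (1 + \<bar>y\<bar>) \<le> y\<^sup>2 * 2" using True by (intro mult_left_mono) auto
  then have "y\<^sup>2 \<le> 2 * soft_sq y" by (simp add: soft_sq_def field_simps)
  then show ?thesis by simp
next
  case False
  then have "1 * \<bar>y\<bar> \<le> \<bar>y\<bar> * \<bar>y\<bar>" by (intro mult_right_mono) auto
  then have "1 + \<bar>y\<bar> \<le> 2 * y\<^sup>2" using False by (simp add: power2_eq_square)
  then have "1 \<le> 2 * soft_sq y" by (simp add: soft_sq_def field_simps)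
  moreover have "e\<^sup>2 \<le> 1" using assms by (simp add: power_le_one)
  ultimately show ?thesis by simp
qed

lemma soft_sq_big:
  assumes "0 < e" shows "(if e < \<bar>y\<bar> then \<bar>y\<bar> else 0) \<le> (1 + 1 / e) * soft_sq y"
proof (cases "e < \<bar>y\<bar>")
  case True
  then have y: "0 < \<bar>y\<bar>" using assms by linarith
  have "1 / \<bar>y\<bar> \<le> 1 / e" using True assms by (simp add: frac_le)
  then have "(1 + 1 / \<bar>y\<bar>) * soft_sq y \<le> (1 + 1 / e) * soft_sq y" using soft_sq_nonneg by (intro mult_right_mono) auto
  moreover have "(1 + 1 / \<bar>y\<bar>) * soft_sq y = \<bar>y\<bar>"
  proof -
    define r where "r = \<bar>y\<bar>"
    have "soft_sq y = r\<^sup>2 / (1 + r)" by (simp add: soft_sq_def r_def)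
    moreover have "0 < r" using y by (simp add: r_def)
    moreover have "1 + 1 / r = (1 + r) / r" using \<open>0 < r\<close> by (simp add: field_simps)
    ultimately show ?thesis unfolding r_def[symmetric] by (simp add: power2_eq_square)
  qed
  ultimately show ?thesis using True by simp
next
  case False
  then show ?thesis using assms soft_sq_nonneg[of y] by simp
qed

lemma trunc_var_integrable: "0 \<le> s \<Longrightarrow> s \<le> t \<Longrightarrow> t \<le> 1 \<Longrightarrow> integrable (\<mu> s t) (\<lambda>y. min (y\<^sup>2) (e\<^sup>2))"
  by (rule integrable_lin[where A="e\<^sup>2" and B=0]) auto

lemma trunc_var_nonneg: "0 \<le> trunc_var e s t"
  unfolding trunc_var_def by (intro Bochner_Integration.integral_nonneg) auto

lemma trunc_var_mono: "0 \<le> s \<Longrightarrow> s \<le> t \<Longrightarrow> t \<le> 1 \<Longrightarrow> 0 \<le> e \<Longrightarrow> e \<le> e' \<Longrightarrow> trunc_var e s t \<le> trunc_var e' s t"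
  unfolding trunc_var_def by (intro integral_mono trunc_var_integrable min.mono[OF order_refl] power_mono) auto

lemma trunc_var_le: "0 \<le> s \<Longrightarrow> s \<le> t \<Longrightarrow> t \<le> 1 \<Longrightarrow> trunc_var e s t \<le> e\<^sup>2"
proof -
  assume st: "0 \<le> s" "s \<le> t" "t \<le> 1"
  interpret r: real_distribution "\<mu> s t" using st law by simp
  have "trunc_var e s t \<le> (\<integral>y. e\<^sup>2 \<partial>\<mu> s t)" unfolding trunc_var_def by (intro integral_mono trunc_var_integrable st) auto
  then show ?thesis by simp
qed

lemma soft_sq_incr: "0 \<le> s \<Longrightarrow> s \<le> t \<Longrightarrow> t \<le> 1 \<Longrightarrow> (\<integral>y. soft_sq y \<partial>\<mu> s t) \<le> (smooth_moment t - smooth_moment s) / gain_const"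
  using soft_sq_increment[of s t] gain_const_pos by (simp add: field_simps)

lemma trunc_var_incr:
  assumes "0 \<le> s" "s \<le> t" "t \<le> 1" "0 \<le> e" "e \<le> 1"
  shows "trunc_var e s t \<le> 2 / gain_const * (smooth_moment t - smooth_moment s)"
proof -
  have "trunc_var e s t \<le> (\<integral>y. 2 * soft_sq y \<partial>\<mu> s t)"
    unfolding trunc_var_def using soft_sq_integrable assms by (intro integral_mono trunc_var_integrable soft_sq_bounds) auto
  also have "\<dots> = 2 * (\<integral>y. soft_sq y \<partial>\<mu> s t)" by simp
  also have "\<dots> \<le> 2 * ((smooth_moment t - smooth_moment s) / gain_const)" by (intro mult_left_mono soft_sq_incr) (use assms in auto)
  finally show ?thesis by simp
qed

lemma tail_moment_incr:
  assumes "0 \<le> s" "s \<le> t" "t \<le> 1" "0 < e"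
  shows "tail_moment e s t \<le> (1 + 1 / e) / gain_const * (smooth_moment t - smooth_moment s)"
proof -
  have "tail_moment e s t \<le> (\<integral>y. (1 + 1 / e) * soft_sq y \<partial>\<mu> s t)"
    unfolding tail_moment_def
  proof (rule integral_mono)
    show "integrable (\<mu> s t) (\<lambda>y. if e < \<bar>y\<bar> then \<bar>y\<bar> else 0)"
      by (rule integrable_lin[where A=0 and B=1]) (use assms in auto)
    show "integrable (\<mu> s t) (\<lambda>y. (1 + 1 / e) * soft_sq y)" using soft_sq_integrable[of s t] assms by (intro integrable_mult_right) auto
  qed (rule soft_sq_big[OF assms(4)])
  also have "\<dots> = (1 + 1 / e) * (\<integral>y. soft_sq y \<partial>\<mu> s t)" by simp
  also have "\<dots> \<le> (1 + 1 / e) * ((smooth_moment t - smooth_moment s) / gain_const)" by (intro mult_left_mono soft_sq_incr) (use assms in auto)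
  finally show ?thesis by simp
qed

lemma psum_incr:
  assumes P: "finite P" "P \<subseteq> {0..1}" "a \<in> P" "b \<in> P" "a \<le> b"
    and q: "\<And>s t. 0 \<le> s \<Longrightarrow> s \<le> t \<Longrightarrow> t \<le> 1 \<Longrightarrow> q s t \<le> K * (smooth_moment t - smooth_moment s)"
  shows "psum q P a b \<le> K * (smooth_moment b - smooth_moment a)"
proof -
  have "psum q P a b \<le> psum (\<lambda>s t. K * smooth_moment t - K * smooth_moment s) P a b"
    using P q by (intro psum_mono) (auto simp: subset_iff right_diff_distrib)
  also have "\<dots> = K * smooth_moment b - K * smooth_moment a" by (rule psum_telescope) (use P in auto)
  finally show ?thesis by (simp add: right_diff_distrib)
qed

text \<open>The integral of the bound in \<open>iexp_truncated_second_order\<close>, with 3 instead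
  of 2 in the first term: the additional unit pays for replacing \<open>1 - a\<close> by
  \<open>exp (- a)\<close>.\<close>

definition clt_error :: "real \<Rightarrow> real \<Rightarrow> real \<Rightarrow> real \<Rightarrow> real \<Rightarrow> real" where
  "clt_error w \<kappa> e s t = 3 * (\<bar>w\<bar> * \<kappa>) * (w\<^sup>2 * trunc_var \<kappa> s t) + 2 / (\<bar>w\<bar> * \<kappa>) * (w\<^sup>2 * (trunc_var e s t - trunc_var \<kappa> s t)) + 3 * \<bar>w\<bar> * tail_moment e s t"

lemma char_step:
  assumes st: "0 \<le> s" "s \<le> t" "t \<le> 1"
    and k: "0 < \<bar>w\<bar> * \<kappa>" "\<bar>w\<bar> * \<kappa> \<le> 1" and e: "0 < \<kappa>" "\<kappa> \<le> e"
  shows "cmod (char (\<mu> s t) w - exp (- (w\<^sup>2 * trunc_var \<kappa> s t / 2))) \<le> clt_error w \<kappa> e s t"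
proof -
  interpret r: real_distribution "\<mu> s t" using st law by simp
  define a where "a = w\<^sup>2 * trunc_var \<kappa> s t / 2"
  have a0: "0 \<le> a" using trunc_var_nonneg by (simp add: a_def)
  have i1: "integrable (\<mu> s t) (\<lambda>y. min (y\<^sup>2) (\<kappa>\<^sup>2))" "integrable (\<mu> s t) (\<lambda>y. min (y\<^sup>2) (e\<^sup>2))"
    using trunc_var_integrable st by auto
  have i2: "integrable (\<mu> s t) (\<lambda>y. if e < \<bar>y\<bar> then \<bar>y\<bar> else 0)"
    by (rule integrable_lin[where A=0 and B=1]) (use st in auto)
  have i3: "integrable (\<mu> s t) (\<lambda>y. iexp (w * y))" by (rule r.integrable_iexp) auto
  have i4: "integrable (\<mu> s t) (\<lambda>y. \<i> * complex_of_real (w * y))"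
    using mom[OF st] by (intro integrable_mult_right integrable_of_real) auto
  have m0: "(\<integral>y. \<i> * complex_of_real (w * y) \<partial>\<mu> s t) = 0"
    using mean[OF st] mom[OF st] by (simp del: of_real_mult)
  have i5: "integrable (\<mu> s t) (\<lambda>y. complex_of_real ((1/2) * w\<^sup>2 * min (y\<^sup>2) (\<kappa>\<^sup>2)))"
    using i1 by (intro integrable_of_real) auto
  have m5: "(\<integral>y. complex_of_real ((1/2) * w\<^sup>2 * min (y\<^sup>2) (\<kappa>\<^sup>2)) \<partial>\<mu> s t) = complex_of_real a"
    unfolding integral_of_real by (simp add: a_def trunc_var_def)
  define g where "g y = iexp (w * y) - 1 - \<i> * complex_of_real (w * y) + complex_of_real ((1/2) * w\<^sup>2 * min (y\<^sup>2) (\<kappa>\<^sup>2))" for y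
  define u where "u y = 2 * (\<bar>w\<bar> * \<kappa>) * (w\<^sup>2 * min (y\<^sup>2) (\<kappa>\<^sup>2))
      + 2 / (\<bar>w\<bar> * \<kappa>) * (w\<^sup>2 * (min (y\<^sup>2) (e\<^sup>2) - min (y\<^sup>2) (\<kappa>\<^sup>2)))
      + 3 * \<bar>w\<bar> * (if e < \<bar>y\<bar> then \<bar>y\<bar> else 0)" for y
  have gi: "integrable (\<mu> s t) g"
    unfolding g_def[abs_def] using i3 i4 i5
    by (intro Bochner_Integration.integrable_add Bochner_Integration.integrable_diff) auto
  have g_eq: "char (\<mu> s t) w - 1 + a = integral\<^sup>L (\<mu> s t) g"
    unfolding g_def[abs_def] using i3 i4 i5 m0 m5 by (simp add: char_def del: of_real_mult)
  have ui: "integrable (\<mu> s t) u" unfolding u_def[abs_def] by (rule integral_lincomb(1)[OF i1 i2])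
  have u_eq: "integral\<^sup>L (\<mu> s t) u = 2 * (\<bar>w\<bar> * \<kappa>) * (w\<^sup>2 * trunc_var \<kappa> s t)
      + 2 / (\<bar>w\<bar> * \<kappa>) * (w\<^sup>2 * (trunc_var e s t - trunc_var \<kappa> s t))
      + 3 * \<bar>w\<bar> * tail_moment e s t"
    unfolding trunc_var_def tail_moment_def u_def[abs_def] by (rule integral_lincomb(2)[OF i1 i2])
  have gu: "cmod (g y) \<le> u y" for y
    using iexp_truncated_second_order[OF k e, of y] unfolding g_def u_def by simp
  have "cmod (integral\<^sup>L (\<mu> s t) g) \<le> (\<integral>y. cmod (g y) \<partial>\<mu> s t)" by (rule integral_norm_bound)
  also have "\<dots> \<le> integral\<^sup>L (\<mu> s t) u" by (intro integral_mono integrable_norm gi ui gu)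
  finally have 1: "cmod (char (\<mu> s t) w - 1 + a) \<le> 2 * (\<bar>w\<bar> * \<kappa>) * (w\<^sup>2 * trunc_var \<kappa> s t)
      + 2 / (\<bar>w\<bar> * \<kappa>) * (w\<^sup>2 * (trunc_var e s t - trunc_var \<kappa> s t))
      + 3 * \<bar>w\<bar> * tail_moment e s t"
    unfolding g_eq u_eq .
  \<comment> \<open>A variance truncated at \<open>\<kappa>\<close> is at most
    \<open>\<kappa>\<^sup>2\<close>. Hence \<open>a\<close> is at most
    \<open>\<bar>w\<bar> * \<kappa>\<close>, and the error \<open>a\<^sup>2\<close> has the order of
    the first term of \<open>clt_error\<close>.\<close>
  have "w\<^sup>2 * trunc_var \<kappa> s t \<le> (\<bar>w\<bar> * \<kappa>)\<^sup>2"
    using trunc_var_le[OF st, of \<kappa>] by (simp add: power_mult_distrib mult_left_mono)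
  also have "\<dots> \<le> \<bar>w\<bar> * \<kappa>" using k by (simp add: power2_eq_square mult_left_le)
  finally have ak: "a \<le> \<bar>w\<bar> * \<kappa>" using a0 by (simp add: a_def)
  have "\<bar>exp (- a) - (1 - a)\<bar> \<le> a\<^sup>2"
  proof -
    have "1 - a \<le> exp (- a)" using exp_ge_add_one_self[of "-a"] by simp
    moreover have "(1 + a) * exp (- a) \<le> exp a * exp (- a)" using exp_ge_add_one_self[of a] by (intro mult_right_mono) auto
    then have "exp (- a) * (1 + a) \<le> 1" by (simp add: mult.commute exp_minus)
    then have "exp (- a) \<le> 1 / (1 + a)" using a0 by (simp add: field_simps)
    moreover have "1 / (1 + a) \<le> 1 - a + a\<^sup>2"
    proof -
      have "(1 - a + a\<^sup>2) * (1 + a) = 1 + a ^ 3" by (simp add: power2_eq_square power3_eq_cube algebra_simps)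
      then have "1 \<le> (1 - a + a\<^sup>2) * (1 + a)" using a0 by simp
      then show ?thesis using a0 by (simp add: divide_le_eq)
    qed
    ultimately show ?thesis by linarith
  qed
  also have "a\<^sup>2 \<le> (\<bar>w\<bar> * \<kappa>) * (w\<^sup>2 * trunc_var \<kappa> s t)"
    unfolding power2_eq_square[of a] using ak a0 k trunc_var_nonneg[of \<kappa> s t] by (intro mult_mono) (auto simp: a_def)
  finally have 2: "\<bar>exp (- a) - (1 - a)\<bar> \<le> (\<bar>w\<bar> * \<kappa>) * (w\<^sup>2 * trunc_var \<kappa> s t)" .
  have "cmod ((char (\<mu> s t) w - 1 + a) + complex_of_real ((1 - a) - exp (- a)))
      \<le> cmod (char (\<mu> s t) w - 1 + a) + cmod (complex_of_real ((1 - a) - exp (- a)))"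
    by (rule norm_triangle_ineq)
  moreover have "cmod (complex_of_real ((1 - a) - exp (- a))) \<le> (\<bar>w\<bar> * \<kappa>) * (w\<^sup>2 * trunc_var \<kappa> s t)"
    using 2 by (simp only: norm_of_real abs_minus_commute)
  moreover have "(char (\<mu> s t) w - 1 + a) + complex_of_real ((1 - a) - exp (- a)) = char (\<mu> s t) w - exp (- a)"
    by (simp add: exp_of_real[symmetric])
  ultimately have "cmod (char (\<mu> s t) w - exp (- a)) \<le> clt_error w \<kappa> e s t"
    using 1 unfolding clt_error_def by simp
  then show ?thesis by (simp add: a_def)
qed

text \<open>In products of factors of modulus at most 1 the errors add up. The truncated variances
  are nonnegative, so the exponentials are such factors as well.\<close>

lemma char_partition:
  assumes P: "finite P" "P \<subseteq> {0..1}" "s \<in> P" "t \<in> P" "s \<le> t"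
    and k: "0 < \<bar>w\<bar> * \<kappa>" "\<bar>w\<bar> * \<kappa> \<le> 1" and e: "0 < \<kappa>" "\<kappa> \<le> e"
  shows "cmod (char (\<mu> s t) w - exp (- (w\<^sup>2 * psum (trunc_var \<kappa>) P s t / 2))) \<le> psum (clt_error w \<kappa> e) P s t"
  using P(1,3,4,5)
proof (induction rule: partition_induct)
  case base
  have "char (return borel 0) w = 1" unfolding char_def by (subst integral_return) auto
  then show ?case by (simp add: diag)
next
  case (step c)
  define d where "d = nxt P c"
  have cd: "0 \<le> s" "s \<le> c" "c \<le> d" "d \<le> 1" "d \<le> t" using step P by (auto simp: d_def subset_iff)
  note l1 = law[of s c] and l2 = law[of c d]
  interpret r: real_distribution "\<mu> c d" using law cd by simp
  define A where "A = char (\<mu> s c) w"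
  define B where "B = char (\<mu> c d) w"
  define A' where "A' = complex_of_real (exp (- (w\<^sup>2 * psum (trunc_var \<kappa>) P s c / 2)))"
  define B' where "B' = complex_of_real (exp (- (w\<^sup>2 * trunc_var \<kappa> c d / 2)))"
  have ps: "psum q P s d = psum q P s c + q c d" for q
    unfolding d_def by (rule psum_nxt) (use P step in auto)
  have AB: "char (\<mu> s d) w = A * B"
    unfolding A_def B_def using conv[of s c d] char_convolution[OF l1 l2] cd by simp
  have AB': "complex_of_real (exp (- (w\<^sup>2 * psum (trunc_var \<kappa>) P s d / 2))) = A' * B'"
    unfolding A'_def B'_def of_real_mult[symmetric] exp_add[symmetric] ps
    by (simp add: algebra_simps add_divide_distrib)
  have n: "cmod B \<le> 1" "cmod A' \<le> 1"
  proof -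
    show "cmod B \<le> 1" unfolding B_def by (rule r.cmod_char_le_1)
    have "0 \<le> psum (trunc_var \<kappa>) P s c" by (rule psum_nonneg) (use P step trunc_var_nonneg in auto)
    then show "cmod A' \<le> 1" unfolding A'_def norm_of_real by simp
  qed
  have eq: "char (\<mu> s d) w - complex_of_real (exp (- (w\<^sup>2 * psum (trunc_var \<kappa>) P s d / 2))) = (A - A') * B + A' * (B - B')"
    unfolding AB AB' by (simp add: algebra_simps)
  have "cmod ((A - A') * B + A' * (B - B')) \<le> cmod (A - A') * cmod B + cmod A' * cmod (B - B')"
    by (rule order_trans[OF norm_triangle_ineq]) (simp add: norm_mult)
  also have "\<dots> \<le> cmod (A - A') * 1 + 1 * cmod (B - B')"
    using n by (intro add_mono mult_mono) auto
  also have "\<dots> \<le> psum (clt_error w \<kappa> e) P s c + clt_error w \<kappa> e c d"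
    using step(7) char_step[OF _ _ _ k e, of c d] cd unfolding A_def A'_def B_def B'_def by simp
  finally show ?case unfolding ps[symmetric] d_def[symmetric] eq[symmetric] by simp
qed

lemma psum_clt_error:
  "psum (clt_error w \<kappa> e) P s t = 3 * (\<bar>w\<bar> * \<kappa>) * (w\<^sup>2 * psum (trunc_var \<kappa>) P s t)
     + 2 / (\<bar>w\<bar> * \<kappa>) * (w\<^sup>2 * (psum (trunc_var e) P s t - psum (trunc_var \<kappa>) P s t)) + 3 * \<bar>w\<bar> * psum (tail_moment e) P s t"
  unfolding psum_def clt_error_def sum_subtractf[symmetric] sum_distrib_left sum.distrib[symmetric] ..

end

lemma abs_exp_minus_diff_le:
  fixes x y :: real
  assumes "0 \<le> x" "0 \<le> y"
  shows "\<bar>exp (- x) - exp (- y)\<bar> \<le> \<bar>x - y\<bar>"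
proof -
  have *: "\<bar>exp (- x) - exp (- y)\<bar> \<le> \<bar>x - y\<bar>" if "0 \<le> x" "x \<le> y" for x y :: real
  proof -
    have e: "exp (- y) = exp (- x) * exp (x - y)" by (simp flip: exp_add)
    have "exp (- x) - exp (- y) = exp (- x) * (1 - exp (x - y))" unfolding e by (simp add: algebra_simps)
    also have "\<dots> \<le> 1 * (1 - exp (x - y))" using that by (intro mult_right_mono) auto
    also have "\<dots> \<le> y - x" using exp_ge_add_one_self[of "x - y"] by argo
    finally show ?thesis using that by simp
  qed
  show ?thesis using *[of x y] *[of y x] assms by (cases "x \<le> y") (auto simp: abs_minus_commute)
qed

section \<open>The cluster point of the variance sums and its limit at level 0\<close>

context centred_hemigroup
begin

text \<open>The compactness argument needs a bound for every index, and
  \<open>trunc_var_incr\<close> provides one for levels in \<open>[0,1]\<close>; clipping turns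
  every real number into an admissible index.\<close>

definition clip :: "real \<Rightarrow> real" where "clip e = max 0 (min 1 e)"

definition lim_trunc_var :: "real \<Rightarrow> real \<Rightarrow> real \<Rightarrow> real" where
  "lim_trunc_var = (SOME L. \<forall>J \<eta>. finite J \<and> (\<forall>(e, a, b)\<in>J. 0 \<le> a \<and> a \<le> b \<and> b \<le> 1) \<and> 0 < \<eta> \<longrightarrow>
     (\<exists>P. finite P \<and> P \<subseteq> {0..1} \<and> (\<forall>(e, a, b)\<in>J. a \<in> P \<and> b \<in> P \<and> \<bar>psum (trunc_var (clip e)) P a b - L e a b\<bar> < \<eta>)))"

lemma lim_trunc_var_prop:
  "\<forall>J \<eta>. finite J \<and> (\<forall>(e, a, b)\<in>J. 0 \<le> a \<and> a \<le> b \<and> b \<le> 1) \<and> 0 < \<eta> \<longrightarrow>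
     (\<exists>P. finite P \<and> P \<subseteq> {0..1} \<and> (\<forall>(e, a, b)\<in>J. a \<in> P \<and> b \<in> P \<and> \<bar>psum (trunc_var (clip e)) P a b - lim_trunc_var e a b\<bar> < \<eta>))"
proof -
  have bnd: "0 \<le> psum (trunc_var (clip e)) P a b \<and> psum (trunc_var (clip e)) P a b \<le> 2 / gain_const * (smooth_moment 1 - smooth_moment 0)"
    if P: "finite P" "P \<subseteq> {0..1}" "a \<in> P" "b \<in> P" "a \<le> b" for e P a b
  proof
    show "0 \<le> psum (trunc_var (clip e)) P a b" by (intro psum_nonneg that trunc_var_nonneg)
    have "psum (trunc_var (clip e)) P a b \<le> 2 / gain_const * (smooth_moment b - smooth_moment a)"
      by (intro psum_incr that trunc_var_incr) (auto simp: clip_def)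
    also have "\<dots> \<le> 2 / gain_const * (smooth_moment 1 - smooth_moment 0)"
    proof -
      have "0 \<le> a" "b \<le> 1" using that by auto
      then have "smooth_moment b - smooth_moment a \<le> smooth_moment 1 - smooth_moment 0" using that smooth_moment_mono[of b 1] smooth_moment_mono[of 0 a] by auto
      then show ?thesis using gain_const_pos by (intro mult_left_mono) auto
    qed
    finally show "psum (trunc_var (clip e)) P a b \<le> 2 / gain_const * (smooth_moment 1 - smooth_moment 0)" .
  qed
  show ?thesis
  proof (rule partition_cluster_point[of "\<lambda>e. trunc_var (clip e)" "\<lambda>_. 2 / gain_const * (smooth_moment 1 - smooth_moment 0)"], (rule bnd; assumption))
    fix L :: "real \<Rightarrow> real \<Rightarrow> real \<Rightarrow> real"
    assume L: "\<And>J P0 \<eta>. finite J \<Longrightarrow> (\<And>k a b. (k, a, b) \<in> J \<Longrightarrow> 0 \<le> a \<and> a \<le> b \<and> b \<le> 1) \<Longrightarrow>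
        finite P0 \<Longrightarrow> P0 \<subseteq> {0..1} \<Longrightarrow> 0 < \<eta> \<Longrightarrow>
      \<exists>P. finite P \<and> P0 \<subseteq> P \<and> P \<subseteq> {0..1} \<and> (\<forall>(k, a, b)\<in>J. a \<in> P \<and> b \<in> P \<and> \<bar>psum (trunc_var (clip k)) P a b - L k a b\<bar> < \<eta>)"
    show ?thesis
      unfolding lim_trunc_var_def
    proof (rule someI[of _ L], intro allI impI)
      fix J :: "(real \<times> real \<times> real) set" and \<eta> :: real
      assume J: "finite J \<and> (\<forall>(e, a, b)\<in>J. 0 \<le> a \<and> a \<le> b \<and> b \<le> 1) \<and> 0 < \<eta>"
      have "\<exists>P. finite P \<and> {} \<subseteq> P \<and> P \<subseteq> {0..1} \<and> (\<forall>(k, a, b)\<in>J. a \<in> P \<and> b \<in> P \<and> \<bar>psum (trunc_var (clip k)) P a b - L k a b\<bar> < \<eta>)"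
        by (rule L) (use J in auto)
      then show "\<exists>P. finite P \<and> P \<subseteq> {0..1} \<and> (\<forall>(e, a, b)\<in>J. a \<in> P \<and> b \<in> P \<and> \<bar>psum (trunc_var (clip e)) P a b - L e a b\<bar> < \<eta>)"
        by simp
    qed
  qed
qed

lemma lim_trunc_var_approx:
  assumes "finite J" "\<And>e a b. (e, a, b) \<in> J \<Longrightarrow> 0 < e \<and> e \<le> 1 \<and> 0 \<le> a \<and> a \<le> b \<and> b \<le> 1" "0 < \<eta>"
  shows "\<exists>P. finite P \<and> P \<subseteq> {0..1} \<and> (\<forall>(e, a, b)\<in>J. a \<in> P \<and> b \<in> P \<and> \<bar>psum (trunc_var e) P a b - lim_trunc_var e a b\<bar> < \<eta>)"
proof -
  have "\<exists>P. finite P \<and> P \<subseteq> {0..1} \<and> (\<forall>(e, a, b)\<in>J. a \<in> P \<and> b \<in> P \<and> \<bar>psum (trunc_var (clip e)) P a b - lim_trunc_var e a b\<bar> < \<eta>)"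
    by (rule lim_trunc_var_prop[rule_format]) (use assms in force)
  then obtain P where P: "finite P" "P \<subseteq> {0..1}"
    "\<forall>(e, a, b)\<in>J. a \<in> P \<and> b \<in> P \<and> \<bar>psum (trunc_var (clip e)) P a b - lim_trunc_var e a b\<bar> < \<eta>" by blast
  have "case j of (e, a, b) \<Rightarrow> a \<in> P \<and> b \<in> P \<and> \<bar>psum (trunc_var e) P a b - lim_trunc_var e a b\<bar> < \<eta>" if "j \<in> J" for j
  proof -
    obtain e a b where j: "j = (e, a, b)" by (cases j)
    have "clip e = e" using assms(2) that unfolding j by (simp add: clip_def)
    then show ?thesis using bspec[OF P(3) that] unfolding j by simp
  qed
  then show ?thesis using P(1,2) by blast
qed

lemma lim_trunc_var_add:
  assumes "0 < e" "e \<le> 1" "0 \<le> a" "a \<le> b" "b \<le> c" "c \<le> 1"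
  shows "lim_trunc_var e a c = lim_trunc_var e a b + lim_trunc_var e b c"
proof -
  have "\<bar>lim_trunc_var e a c - (lim_trunc_var e a b + lim_trunc_var e b c)\<bar> \<le> \<eta>" if "0 < \<eta>" for \<eta>
  proof -
    have "\<exists>P. finite P \<and> P \<subseteq> {0..1} \<and> (\<forall>(e, a, b)\<in>{(e, a, b), (e, b, c), (e, a, c)}. a \<in> P \<and> b \<in> P \<and> \<bar>psum (trunc_var e) P a b - lim_trunc_var e a b\<bar> < \<eta> / 3)"
      by (rule lim_trunc_var_approx) (use that assms in auto)
    then obtain P where P: "finite P" "P \<subseteq> {0..1}" "\<bar>psum (trunc_var e) P a b - lim_trunc_var e a b\<bar> < \<eta> / 3"
      "\<bar>psum (trunc_var e) P b c - lim_trunc_var e b c\<bar> < \<eta> / 3" "\<bar>psum (trunc_var e) P a c - lim_trunc_var e a c\<bar> < \<eta> / 3" by auto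
    moreover have "psum (trunc_var e) P a c = psum (trunc_var e) P a b + psum (trunc_var e) P b c"
      using P assms by (intro psum_split) auto
    ultimately show ?thesis using P by linarith
  qed
  then have "lim_trunc_var e a c - (lim_trunc_var e a b + lim_trunc_var e b c) = 0" by (rule dense_eq0_I)
  then show ?thesis by simp
qed

lemma lim_trunc_var_single:
  assumes "0 < e" "e \<le> 1" "0 \<le> a" "a \<le> b" "b \<le> 1" "0 < \<eta>"
  obtains P where "finite P" "P \<subseteq> {0..1}" "a \<in> P" "b \<in> P" "\<bar>psum (trunc_var e) P a b - lim_trunc_var e a b\<bar> < \<eta>"
proof -
  have "\<exists>P. finite P \<and> P \<subseteq> {0..1} \<and> (\<forall>(e, a, b)\<in>{(e, a, b)}. a \<in> P \<and> b \<in> P \<and> \<bar>psum (trunc_var e) P a b - lim_trunc_var e a b\<bar> < \<eta>)"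
    by (rule lim_trunc_var_approx) (use assms in auto)
  then show ?thesis using that by auto
qed

lemma lim_trunc_var_nonneg:
  assumes "0 < e" "e \<le> 1" "0 \<le> a" "a \<le> b" "b \<le> 1"
  shows "0 \<le> lim_trunc_var e a b"
proof (rule field_le_epsilon)
  fix \<eta> :: real assume "0 < \<eta>"
  then obtain P where P: "finite P" "P \<subseteq> {0..1}" "a \<in> P" "b \<in> P" "\<bar>psum (trunc_var e) P a b - lim_trunc_var e a b\<bar> < \<eta>"
    using lim_trunc_var_single[OF assms] by blast
  moreover have "0 \<le> psum (trunc_var e) P a b" by (intro psum_nonneg P trunc_var_nonneg)
  ultimately show "0 \<le> lim_trunc_var e a b + \<eta>" by linarith
qed

lemma lim_trunc_var_mono:
  assumes "0 < e" "e \<le> e'" "e' \<le> 1" "0 \<le> a" "a \<le> b" "b \<le> 1"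
  shows "lim_trunc_var e a b \<le> lim_trunc_var e' a b"
proof (rule field_le_epsilon)
  fix \<eta> :: real assume "0 < \<eta>"
  have "\<exists>P. finite P \<and> P \<subseteq> {0..1} \<and> (\<forall>(e, a, b)\<in>{(e, a, b), (e', a, b)}. a \<in> P \<and> b \<in> P \<and> \<bar>psum (trunc_var e) P a b - lim_trunc_var e a b\<bar> < \<eta> / 2)"
    by (rule lim_trunc_var_approx) (use \<open>0 < \<eta>\<close> assms in auto)
  then obtain P where P: "finite P" "P \<subseteq> {0..1}" "\<bar>psum (trunc_var e) P a b - lim_trunc_var e a b\<bar> < \<eta> / 2"
      "\<bar>psum (trunc_var e') P a b - lim_trunc_var e' a b\<bar> < \<eta> / 2" "a \<in> P" "b \<in> P" by auto
  have "psum (trunc_var e) P a b \<le> psum (trunc_var e') P a b"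
    using P assms by (intro psum_mono trunc_var_mono) auto
  then show "lim_trunc_var e a b \<le> lim_trunc_var e' a b + \<eta>" using P by linarith
qed

definition gauss_var :: "real \<Rightarrow> real \<Rightarrow> real" where
  "gauss_var a b = (INF n. lim_trunc_var (1 / real (Suc n)) a b)"

lemma gauss_var_LIMSEQ:
  assumes "0 \<le> a" "a \<le> b" "b \<le> 1"
  shows "(\<lambda>n. lim_trunc_var (1 / real (Suc n)) a b) \<longlonglongrightarrow> gauss_var a b"
  unfolding gauss_var_def
proof (rule LIMSEQ_decseq_INF)
  show "bdd_below (range (\<lambda>n. lim_trunc_var (1 / real (Suc n)) a b))"
    using lim_trunc_var_nonneg assms by (intro bdd_belowI[of _ 0]) auto
  show "decseq (\<lambda>n. lim_trunc_var (1 / real (Suc n)) a b)"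
    using assms by (intro decseq_SucI lim_trunc_var_mono) (auto simp: frac_le)
qed

lemma gauss_var_add:
  assumes "0 \<le> a" "a \<le> b" "b \<le> c" "c \<le> 1"
  shows "gauss_var a c = gauss_var a b + gauss_var b c"
proof (rule LIMSEQ_unique[OF gauss_var_LIMSEQ])
  have "(\<lambda>n. lim_trunc_var (1 / real (Suc n)) a b + lim_trunc_var (1 / real (Suc n)) b c) \<longlonglongrightarrow> gauss_var a b + gauss_var b c"
    using assms by (intro tendsto_add gauss_var_LIMSEQ) auto
  then show "(\<lambda>n. lim_trunc_var (1 / real (Suc n)) a c) \<longlonglongrightarrow> gauss_var a b + gauss_var b c"
    using lim_trunc_var_add[of "1 / real (Suc _)" a b c] assms by simp
qed (use assms in auto)

lemma gauss_var_nonneg: "0 \<le> a \<Longrightarrow> a \<le> b \<Longrightarrow> b \<le> 1 \<Longrightarrow> 0 \<le> gauss_var a b"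
  by (rule LIMSEQ_le_const[OF gauss_var_LIMSEQ]) (auto intro!: lim_trunc_var_nonneg)

lemma gauss_var_le_lim_trunc_var:
  assumes "0 < e" "e \<le> 1" "0 \<le> a" "a \<le> b" "b \<le> 1"
  shows "gauss_var a b \<le> lim_trunc_var e a b"
proof -
  obtain N where N: "1 / real (Suc N) < e" using assms nat_approx_posE by blast
  have "lim_trunc_var (1 / real (Suc n)) a b \<le> lim_trunc_var e a b" if "N \<le> n" for n
  proof (rule lim_trunc_var_mono)
    have "1 / real (Suc n) \<le> 1 / real (Suc N)" using that by (simp add: frac_le)
    then show "1 / real (Suc n) \<le> e" using N by linarith
  qed (use assms in auto)
  then show ?thesis using assms by (intro LIMSEQ_le_const2[OF gauss_var_LIMSEQ]) auto
qed

section \<open>Asymptotic normality of scaled increments at almost every point\<close>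

definition clt_at :: "real \<Rightarrow> bool" where
  "clt_at s \<longleftrightarrow> (\<forall>v. \<forall>d>0. \<exists>\<delta>>0. \<forall>h. 0 < h \<and> h < \<delta> \<and> s + h \<le> 1 \<longrightarrow>
     cmod (char (\<mu> s (s + h)) (v / sqrt h) - exp (- (v\<^sup>2 * (gauss_var s (s + h) / h) / 2))) \<le> d)"

text \<open>The quotient \<open>gauss_var s (s + h) / h\<close> is not known to converge, so
  \<open>clt_at\<close> compares with a normal law that moves with \<open>h\<close>. The first
  hypothesis makes truncated variances and tail moments \<open>O(h)\<close>; the second says that
  lowering the truncation level from a fixed \<open>e\<close> to 0 changes the variance by at most
  \<open>\<eta> * h\<close>.\<close>

lemma clt_atI:
  assumes s: "0 \<le> s"
    and C: "0 \<le> C" "0 < \<delta>1" "\<And>h. 0 < h \<Longrightarrow> h < \<delta>1 \<Longrightarrow> s + h \<le> 1 \<Longrightarrow> smooth_moment (s + h) - smooth_moment s \<le> C * h"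
    and D: "\<And>\<eta>. 0 < \<eta> \<Longrightarrow> \<exists>e \<delta>. 0 < e \<and> e \<le> 1 \<and> 0 < \<delta> \<and> (\<forall>h. 0 < h \<and> h < \<delta> \<and> s + h \<le> 1 \<longrightarrow> lim_trunc_var e s (s + h) - gauss_var s (s + h) \<le> \<eta> * h)"
  shows "clt_at s"
  unfolding clt_at_def
proof (intro allI impI)
  fix v d :: real assume d: "0 < d"
  show "\<exists>\<delta>>0. \<forall>h. 0 < h \<and> h < \<delta> \<and> s + h \<le> 1 \<longrightarrow>
     cmod (char (\<mu> s (s + h)) (v / sqrt h) - exp (- (v\<^sup>2 * (gauss_var s (s + h) / h) / 2))) \<le> d"
  proof (cases "v = 0")
    case True
    have "char (\<mu> s (s + h)) 0 = 1" if "0 < h" "s + h \<le> 1" for h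
    proof -
      interpret r: real_distribution "\<mu> s (s + h)" using law that s by simp
      show ?thesis by (rule r.char_zero)
    qed
    then show ?thesis using True d by (intro exI[of _ 1]) auto
  next
    case False
    then have v2: "0 < v\<^sup>2" "0 < \<bar>v\<bar>" by auto
    define B where "B = 2 / gain_const * C"
    have B: "0 \<le> B" using C gain_const_pos by (simp add: B_def)
    \<comment> \<open>The four errors get \<open>d / 4\<close> each. The order of choice matters:
      \<open>k\<close> makes the cubic error small, \<open>\<eta>\<close> may depend on
      \<open>k\<close> because of the factor \<open>2 / k\<close>, \<open>e\<close> depends on
      \<open>\<eta>\<close>, and the bounds on \<open>h\<close> depend on all of them.\<close>
    define k where "k = min 1 (d / (12 * v\<^sup>2 * (B + 1)))"
    have k: "0 < k" "k \<le> 1" using d v2 B by (auto simp: k_def)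
    define G where "G = 12 * v\<^sup>2 * (B + 1)"
    have "0 < G" using v2 B by (simp add: G_def)
    then have "k * G \<le> d" unfolding k_def G_def[symmetric] by (simp add: min_def field_simps)
    then have "k * (12 * v\<^sup>2 * (B + 1)) \<le> d" by (simp add: G_def)
    moreover have "12 * (k * v\<^sup>2 * B) \<le> k * (12 * v\<^sup>2 * (B + 1))" using k v2 by (simp add: algebra_simps)
    ultimately have t1: "3 * k * (v\<^sup>2 * B) \<le> d / 4" by (simp add: algebra_simps)
    define \<eta> where "\<eta> = d * k / (24 * v\<^sup>2)"
    have \<eta>: "0 < \<eta>" using d k v2 by (simp add: \<eta>_def)
    have t2: "2 / k * (v\<^sup>2 * (3 * \<eta>)) = d / 4" using k v2 by (simp add: \<eta>_def field_simps)
    have "v\<^sup>2 * \<eta> = d * k / 24" using v2 by (simp add: \<eta>_def)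
    also have "d * k \<le> d" using d k by (simp add: mult_left_le)
    finally have t4: "v\<^sup>2 * \<eta> \<le> d / 4" using d by simp
    obtain e \<delta>2 where e: "0 < e" "e \<le> 1" "0 < \<delta>2" "\<And>h. 0 < h \<Longrightarrow> h < \<delta>2 \<Longrightarrow> s + h \<le> 1 \<Longrightarrow> lim_trunc_var e s (s + h) - gauss_var s (s + h) \<le> \<eta> * h"
      using D[OF \<eta>] by blast
    define A where "A = 3 * \<bar>v\<bar> * ((1 + 1 / e) / gain_const * C)"
    have A: "0 \<le> A" using e C gain_const_pos by (simp add: A_def)
    define \<delta>3 where "\<delta>3 = (d / (4 * (A + 1)))\<^sup>2"
    define \<delta>4 where "\<delta>4 = (e * \<bar>v\<bar> / k)\<^sup>2"
    have d34: "0 < \<delta>3" "0 < \<delta>4" using d A e v2 k by (auto simp: \<delta>3_def \<delta>4_def)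
    define \<delta> where "\<delta> = min (min \<delta>1 \<delta>2) (min \<delta>3 \<delta>4)"
    have "0 < \<delta>" using C e d34 by (simp add: \<delta>_def)
    moreover have "cmod (char (\<mu> s (s + h)) (v / sqrt h) - exp (- (v\<^sup>2 * (gauss_var s (s + h) / h) / 2))) \<le> d"
      if h: "0 < h" "h < \<delta>" "s + h \<le> 1" for h
    proof -
      define w where "w = v / sqrt h"
      \<comment> \<open>The level shrinks with the natural scale \<open>sqrt h\<close>, so that
        \<open>\<bar>w\<bar> * \<kappa>\<close> keeps the value \<open>k\<close> for every
        \<open>h\<close>.\<close>
      define \<kappa> where "\<kappa> = k * sqrt h / \<bar>v\<bar>"
      define t where "t = s + h"
      have st: "0 \<le> s" "s \<le> t" "t \<le> 1" using s h by (auto simp: t_def)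
      have sh: "0 < sqrt h" using h by simp
      have \<kappa>0: "0 < \<kappa>" using k sh v2 by (simp add: \<kappa>_def)
      have w\<kappa>: "\<bar>w\<bar> * \<kappa> = k" using sh v2 h by (simp add: w_def \<kappa>_def abs_divide)
      have w2: "w\<^sup>2 = v\<^sup>2 / h" using h by (simp add: w_def power_divide)
      have "sqrt h < e * \<bar>v\<bar> / k" using h e v2 k by (intro real_less_lsqrt) (auto simp: \<delta>_def \<delta>4_def)
      then have \<kappa>e: "\<kappa> \<le> e" using k v2 by (simp add: \<kappa>_def field_simps)
      have "sqrt h < d / (4 * (A + 1))" using h d A by (intro real_less_lsqrt) (auto simp: \<delta>_def \<delta>3_def)
      then have "(A + 1) * sqrt h < d / 4" using A by (simp add: field_simps)
      moreover have "(A + 1) * sqrt h = A * sqrt h + sqrt h" by (simp add: distrib_right)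
      ultimately have Ah: "A * sqrt h \<le> d / 4" using sh by linarith
      have bC: "smooth_moment t - smooth_moment s \<le> C * h" using C(3) h by (simp add: t_def \<delta>_def)
      have De: "lim_trunc_var e s t \<le> gauss_var s t + \<eta> * h" using e(4)[of h] h by (simp add: t_def \<delta>_def)
      \<comment> \<open>One partition serves both levels. It is chosen after \<open>h\<close>, so
        its accuracy may be \<open>\<eta> * h\<close>.\<close>
      have "\<exists>P. finite P \<and> P \<subseteq> {0..1} \<and> (\<forall>(e, a, b)\<in>{(e, s, t), (\<kappa>, s, t)}. a \<in> P \<and> b \<in> P \<and> \<bar>psum (trunc_var e) P a b - lim_trunc_var e a b\<bar> < \<eta> * h)"
        by (rule lim_trunc_var_approx) (use st e \<kappa>0 \<kappa>e \<eta> h in auto)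
      then obtain P where P: "finite P" "P \<subseteq> {0..1}" and PQ: "\<bar>psum (trunc_var e) P s t - lim_trunc_var e s t\<bar> < \<eta> * h"
        "\<bar>psum (trunc_var \<kappa>) P s t - lim_trunc_var \<kappa> s t\<bar> < \<eta> * h" and stP: "s \<in> P" "t \<in> P" by auto
      have QLs: "gauss_var s t \<le> lim_trunc_var \<kappa> s t" "lim_trunc_var \<kappa> s t \<le> lim_trunc_var e s t"
        using st e \<kappa>0 \<kappa>e by (auto intro: gauss_var_le_lim_trunc_var lim_trunc_var_mono)
      have S1: "psum (trunc_var e) P s t - psum (trunc_var \<kappa>) P s t \<le> 3 * \<eta> * h" using PQ QLs De by linarith
      have S2: "\<bar>psum (trunc_var \<kappa>) P s t - gauss_var s t\<bar> \<le> 2 * \<eta> * h" using PQ QLs De by linarith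
      have "psum (trunc_var \<kappa>) P s t \<le> 2 / gain_const * (smooth_moment t - smooth_moment s)"
        by (intro psum_incr P stP st trunc_var_incr) (use \<kappa>0 \<kappa>e e in auto)
      also have "\<dots> \<le> 2 / gain_const * (C * h)" using bC gain_const_pos by (intro mult_left_mono) auto
      finally have S3: "psum (trunc_var \<kappa>) P s t \<le> B * h" by (simp add: B_def)
      have "psum (tail_moment e) P s t \<le> (1 + 1 / e) / gain_const * (smooth_moment t - smooth_moment s)"
        by (intro psum_incr P stP st tail_moment_incr) (use e in auto)
      also have "\<dots> \<le> (1 + 1 / e) / gain_const * (C * h)" using bC gain_const_pos e by (intro mult_left_mono) auto
      finally have S4: "psum (tail_moment e) P s t \<le> (1 + 1 / e) / gain_const * C * h" by simp
      have W: "w\<^sup>2 * x \<le> v\<^sup>2 * c" if "x \<le> c * h" for x c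
      proof -
        have "w\<^sup>2 * x \<le> w\<^sup>2 * (c * h)" using that by (intro mult_left_mono) auto
        also have "\<dots> = v\<^sup>2 * c" using h by (simp add: w2)
        finally show ?thesis .
      qed
      have "3 * k * (w\<^sup>2 * psum (trunc_var \<kappa>) P s t) \<le> 3 * k * (v\<^sup>2 * B)"
        using k by (intro mult_left_mono W S3) auto
      moreover have "2 / k * (w\<^sup>2 * (psum (trunc_var e) P s t - psum (trunc_var \<kappa>) P s t)) \<le> 2 / k * (v\<^sup>2 * (3 * \<eta>))"
        using k by (intro mult_left_mono W S1) auto
      moreover have "3 * \<bar>w\<bar> * psum (tail_moment e) P s t \<le> 3 * \<bar>w\<bar> * ((1 + 1 / e) / gain_const * C * h)"
        by (intro mult_left_mono S4) auto
      moreover have "3 * \<bar>w\<bar> * ((1 + 1 / e) / gain_const * C * h) = A * sqrt h"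
      proof -
        have "\<bar>w\<bar> * h = \<bar>v\<bar> * sqrt h" using h sh by (simp add: w_def abs_divide real_div_sqrt divide_simps)
        then show ?thesis unfolding A_def by (metis (no_types, opaque_lifting) mult.assoc mult.commute)
      qed
      ultimately have "psum (clt_error w \<kappa> e) P s t \<le> 3 * (d / 4)"
        unfolding psum_clt_error w\<kappa> using t1 t2 Ah by argo
      moreover have "cmod (char (\<mu> s t) w - exp (- (w\<^sup>2 * psum (trunc_var \<kappa>) P s t / 2))) \<le> psum (clt_error w \<kappa> e) P s t"
        by (rule char_partition) (use P stP st k \<kappa>0 \<kappa>e w\<kappa> in auto)
      ultimately have X1: "cmod (char (\<mu> s t) w - exp (- (w\<^sup>2 * psum (trunc_var \<kappa>) P s t / 2))) \<le> 3 * (d / 4)"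
        by (rule order_trans[rotated])
      have X2: "cmod (exp (- (w\<^sup>2 * psum (trunc_var \<kappa>) P s t / 2)) - exp (- (v\<^sup>2 * (gauss_var s t / h) / 2))) \<le> d / 4"
      proof -
        have "\<bar>exp (- (w\<^sup>2 * psum (trunc_var \<kappa>) P s t / 2)) - exp (- (w\<^sup>2 * gauss_var s t / 2))\<bar> \<le> \<bar>w\<^sup>2 * psum (trunc_var \<kappa>) P s t / 2 - w\<^sup>2 * gauss_var s t / 2\<bar>"
          using gauss_var_nonneg st psum_nonneg[OF P(1) stP(2) trunc_var_nonneg]
          by (intro abs_exp_minus_diff_le divide_nonneg_nonneg mult_nonneg_nonneg) auto
        also have "\<dots> = w\<^sup>2 * \<bar>psum (trunc_var \<kappa>) P s t - gauss_var s t\<bar> / 2"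
          by (simp add: abs_mult right_diff_distrib[symmetric] diff_divide_distrib[symmetric])
        also have "\<dots> \<le> v\<^sup>2 * (2 * \<eta>) / 2" by (intro divide_right_mono W S2) auto
        also have "\<dots> \<le> d / 4" using t4 by simp
        finally have "\<bar>exp (- (w\<^sup>2 * psum (trunc_var \<kappa>) P s t / 2)) - exp (- (w\<^sup>2 * gauss_var s t / 2))\<bar> \<le> d / 4" .
        moreover have "w\<^sup>2 * gauss_var s t / 2 = v\<^sup>2 * (gauss_var s t / h) / 2" by (simp add: w2)
        ultimately have r: "\<bar>exp (- (w\<^sup>2 * psum (trunc_var \<kappa>) P s t / 2)) - exp (- (v\<^sup>2 * (gauss_var s t / h) / 2))\<bar> \<le> d / 4" by simp
        show ?thesis using r unfolding norm_of_real[where 'a=complex, symmetric] by (simp add: exp_of_real[symmetric])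
      qed
      have "cmod (char (\<mu> s t) w - exp (- (v\<^sup>2 * (gauss_var s t / h) / 2))) \<le> 3 * (d / 4) + d / 4"
        by (rule norm_diff_triangle_le[OF X1 X2[unfolded of_real_diff]])
      then have "cmod (char (\<mu> s t) w - exp (- (v\<^sup>2 * (gauss_var s t / h) / 2))) \<le> d" by simp
      then show ?thesis by (simp add: t_def w_def)
    qed
    ultimately show ?thesis by blast
  qed
qed

text \<open>The two hypotheses of \<open>clt_atI\<close> fail only where a monotone function has a
  large upper derivative: \<open>smooth_moment\<close> for the first, the truncation errors
  \<open>\<Phi> n\<close> for the second. The \<open>\<Phi> n\<close> increase because both interval
  functions are additive and \<open>gauss_var\<close> is the smaller one, and their total increments
  tend to 0.\<close>

lemma clt_at_ae: "negligible {s\<in>{0..<1}. \<not> clt_at s}"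
proof -
  define \<Phi> where "\<Phi> n t = lim_trunc_var (1 / real (Suc n)) 0 t - gauss_var 0 t" for n t
  define E1 where "E1 = {s\<in>{0..<1::real}. \<forall>c. \<forall>\<delta>>0. \<exists>h. 0 < h \<and> h < \<delta> \<and> s + h \<le> 1 \<and> c * h < smooth_moment (s + h) - smooth_moment s}"
  define E2 where "E2 k = {s\<in>{0..<1::real}. \<forall>n. \<forall>\<delta>>0. \<exists>h. 0 < h \<and> h < \<delta> \<and> s + h \<le> 1 \<and> 1 / real (Suc k) * h < \<Phi> n (s + h) - \<Phi> n s}" for k
  have d\<Phi>: "\<Phi> n t - \<Phi> n s = lim_trunc_var (1 / real (Suc n)) s t - gauss_var s t" if "0 \<le> s" "s \<le> t" "t \<le> 1" for n s t
    unfolding \<Phi>_def using lim_trunc_var_add[of "1 / real (Suc n)" 0 s t] gauss_var_add[of 0 s t] that by simp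
  have "negligible E1"
    unfolding E1_def by (rule mono_finite_upper_dini) (auto intro!: mono_onI smooth_moment_mono)
  moreover have "negligible (E2 k)" for k
    unfolding E2_def
  proof (rule vanishing_upper_dini[where \<Phi> = \<Phi> and a = 0 and b = 1 and c = "1 / real (Suc k)"])
    fix n show "mono_on {0..1} (\<Phi> n)"
    proof (rule mono_onI)
      fix s t :: real assume st: "s \<in> {0..1}" "t \<in> {0..1}" "s \<le> t"
      then have "0 \<le> \<Phi> n t - \<Phi> n s" using d\<Phi>[of s t n] gauss_var_le_lim_trunc_var[of "1 / real (Suc n)" s t] by simp
      then show "\<Phi> n s \<le> \<Phi> n t" by simp
    qed
  next
    have "(\<lambda>n. lim_trunc_var (1 / real (Suc n)) 0 1 - gauss_var 0 1) \<longlonglongrightarrow> gauss_var 0 1 - gauss_var 0 1"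
      by (intro tendsto_diff gauss_var_LIMSEQ tendsto_const) auto
    then show "(\<lambda>n. \<Phi> n 1 - \<Phi> n 0) \<longlonglongrightarrow> 0" using d\<Phi>[of 0 1] by simp
  qed auto
  ultimately have "negligible (E1 \<union> (\<Union>k. E2 k))"
    by (intro negligible_Un negligible_Union_nat) auto
  moreover have "{s\<in>{0..<1}. \<not> clt_at s} \<subseteq> E1 \<union> (\<Union>k. E2 k)"
  proof (rule ccontr)
    assume "\<not> ?thesis"
    then obtain s where s: "s \<in> {0..<1}" "\<not> clt_at s" "s \<notin> E1" "\<And>k. s \<notin> E2 k" by blast
    have "\<not> (\<forall>c. \<forall>\<delta>>0. \<exists>h. 0 < h \<and> h < \<delta> \<and> s + h \<le> 1 \<and> c * h < smooth_moment (s + h) - smooth_moment s)"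
      using s(1,3) unfolding E1_def by blast
    then have "\<exists>c \<delta>. 0 < \<delta> \<and> (\<forall>h. 0 < h \<longrightarrow> h < \<delta> \<longrightarrow> s + h \<le> 1 \<longrightarrow> smooth_moment (s + h) - smooth_moment s \<le> c * h)"
      by (meson linorder_not_less)
    then obtain c \<delta> where c: "0 < \<delta>" "\<And>h. 0 < h \<Longrightarrow> h < \<delta> \<Longrightarrow> s + h \<le> 1 \<Longrightarrow> smooth_moment (s + h) - smooth_moment s \<le> c * h"
      by blast
    have "clt_at s"
    proof (rule clt_atI[of s "max 0 c" \<delta>])
      fix h assume h: "0 < h" "h < \<delta>" "s + h \<le> 1"
      have "smooth_moment (s + h) - smooth_moment s \<le> c * h" by (rule c) (use h in auto)
      also have "\<dots> \<le> max 0 c * h" using h by (intro mult_right_mono) auto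
      finally show "smooth_moment (s + h) - smooth_moment s \<le> max 0 c * h" .
    next
      fix \<eta> :: real assume "0 < \<eta>"
      then obtain k where k: "1 / real (Suc k) < \<eta>" using nat_approx_posE by blast
      have "\<not> (\<forall>n. \<forall>\<delta>>0. \<exists>h. 0 < h \<and> h < \<delta> \<and> s + h \<le> 1 \<and> 1 / real (Suc k) * h < \<Phi> n (s + h) - \<Phi> n s)"
        using s(1) s(4)[of k] unfolding E2_def by blast
      then have "\<exists>n \<delta>. 0 < \<delta> \<and> (\<forall>h. 0 < h \<longrightarrow> h < \<delta> \<longrightarrow> s + h \<le> 1 \<longrightarrow> \<Phi> n (s + h) - \<Phi> n s \<le> 1 / real (Suc k) * h)"
        by (meson linorder_not_less)
      then obtain n \<delta>' where n: "0 < \<delta>'" "\<And>h. 0 < h \<Longrightarrow> h < \<delta>' \<Longrightarrow> s + h \<le> 1 \<Longrightarrow> \<Phi> n (s + h) - \<Phi> n s \<le> 1 / real (Suc k) * h"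
        by blast
      show "\<exists>e \<delta>. 0 < e \<and> e \<le> 1 \<and> 0 < \<delta> \<and> (\<forall>h. 0 < h \<and> h < \<delta> \<and> s + h \<le> 1 \<longrightarrow> lim_trunc_var e s (s + h) - gauss_var s (s + h) \<le> \<eta> * h)"
      proof (rule exI[of _ "1 / real (Suc n)"], rule exI[of _ \<delta>'], intro conjI allI impI)
        fix h assume h: "0 < h \<and> h < \<delta>' \<and> s + h \<le> 1"
        have "lim_trunc_var (1 / real (Suc n)) s (s + h) - gauss_var s (s + h) = \<Phi> n (s + h) - \<Phi> n s"
          using d\<Phi>[of s "s + h" n] s h by simp
        also have "\<dots> \<le> 1 / real (Suc k) * h" using n(2) h by blast
        also have "\<dots> \<le> \<eta> * h" using k h by (intro mult_right_mono) auto
        finally show "lim_trunc_var (1 / real (Suc n)) s (s + h) - gauss_var s (s + h) \<le> \<eta> * h" .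
      qed (use n in auto)
    qed (use s c in auto)
    then show False using s by simp
  qed
  ultimately show ?thesis by (rule negligible_subset)
qed

end

subsection \<open>Centred normal laws and the convex order\<close>

text \<open>Defined as an image of the standard normal law, not by a density, so that variance 0
  gives the point mass at 0.\<close>

definition gau :: "real \<Rightarrow> real measure" where
  "gau v = distr std_normal_distribution borel (\<lambda>z. sqrt v * z)"

lemma real_distribution_gau: "real_distribution (gau v)"
proof -
  interpret s: real_distribution std_normal_distribution by (rule real_dist_normal_dist)
  show ?thesis unfolding gau_def by (rule s.real_distribution_distr) auto
qed

lemma char_gau: "0 \<le> v \<Longrightarrow> char (gau v) t = exp (- (v * t\<^sup>2 / 2))"
proof -
  assume v: "0 \<le> v"
  have "char (gau v) t = char std_normal_distribution (sqrt v * t)"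
    unfolding char_def gau_def by (subst integral_distr) (auto simp: mult_ac)
  also have "\<dots> = complex_of_real (exp (- (v * t\<^sup>2 / 2)))"
    using v by (simp add: char_std_normal_distribution power_mult_distrib)
  finally show ?thesis by (simp add: exp_of_real)
qed

lemma integral_gau:
  fixes g :: "real \<Rightarrow> real"
  assumes "g \<in> borel_measurable borel"
  shows "(\<integral>x. g x \<partial>gau v) = (\<integral>z. g (sqrt v * z) \<partial>std_normal_distribution)"
  unfolding gau_def using assms by (subst integral_distr) auto

lemma integrable_gau_iff:
  fixes g :: "real \<Rightarrow> real"
  assumes "g \<in> borel_measurable borel"
  shows "integrable (gau v) g \<longleftrightarrow> integrable std_normal_distribution (\<lambda>z. g (sqrt v * z))"
  unfolding gau_def using assms by (subst integrable_distr_eq) auto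

lemma std_normal_abs_moment: "integrable std_normal_distribution (\<lambda>x. \<bar>x\<bar> ^ k)"
  using integrable_std_normal_distribution_moment[of k] by (simp add: power_abs[symmetric])

lemma std_normal_mean: "(\<integral>x. x \<partial>std_normal_distribution) = 0"
  using integral_std_normal_distribution_moment_odd[of 1] by simp

lemma std_normal_second: "(\<integral>x. x\<^sup>2 \<partial>std_normal_distribution) = 1"
  using std_normal_distribution_even_moments(1)[of 1] by simp

lemma gau_mom: "integrable (gau v) (\<lambda>x. x)" "(\<integral>x. x \<partial>gau v) = 0"
proof -
  have "integrable std_normal_distribution (\<lambda>x. x)"
    using integrable_std_normal_distribution_moment[of 1] by (simp only: power_one_right)
  then have "integrable std_normal_distribution (\<lambda>x. sqrt v * x)" by (rule integrable_mult_right)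
  then show "integrable (gau v) (\<lambda>x. x)" by (subst integrable_gau_iff) auto
  have "(\<integral>x. x \<partial>gau v) = (\<integral>z. sqrt v * z \<partial>std_normal_distribution)" by (rule integral_gau) simp
  then show "(\<integral>x. x \<partial>gau v) = 0" unfolding integral_mult_right_zero std_normal_mean by simp
qed

lemma gau_second: "0 \<le> v \<Longrightarrow> (\<integral>x. x\<^sup>2 \<partial>gau v) = v"
  "integrable (gau v) (\<lambda>x. x\<^sup>2)"
proof -
  have "integrable std_normal_distribution (\<lambda>x. (sqrt v)\<^sup>2 * x\<^sup>2)"
    by (rule integrable_mult_right) (rule integrable_std_normal_distribution_moment)
  then show "integrable (gau v) (\<lambda>x. x\<^sup>2)" by (subst integrable_gau_iff) (auto simp: power_mult_distrib)
  assume v: "0 \<le> v"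
  have "(\<integral>x. x\<^sup>2 \<partial>gau v) = (\<integral>z. (sqrt v)\<^sup>2 * z\<^sup>2 \<partial>std_normal_distribution)"
    by (subst integral_gau) (auto simp: power_mult_distrib)
  then show "(\<integral>x. x\<^sup>2 \<partial>gau v) = v" unfolding integral_mult_right_zero std_normal_second using v by simp
qed

lemma gau_convolution:
  assumes "0 \<le> v" "0 \<le> w"
  shows "(gau v \<star> gau w) = gau (v + w)"
proof (rule Levy_uniqueness)
  show "char (gau v \<star> gau w) = char (gau (v + w))"
  proof
    fix t
    have "exp (- (v * t\<^sup>2 / 2)) * exp (- (w * t\<^sup>2 / 2)) = exp (- ((v + w) * t\<^sup>2 / 2))"
      by (simp add: exp_add[symmetric] algebra_simps add_divide_distrib)
    then show "char (gau v \<star> gau w) t = char (gau (v + w)) t"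
      using assms by (simp add: char_convolution real_distribution_gau char_gau of_real_mult[symmetric] del: of_real_mult)
  qed
qed (auto intro: real_distribution_convolution real_distribution_gau)

lemma gau_0: "gau 0 = return borel 0"
proof (rule Levy_uniqueness)
  show "char (gau 0) = char (return borel 0)"
  proof
    fix t
    have "char (return borel 0) t = 1" unfolding char_def by (subst integral_return) auto
    then show "char (gau 0) t = char (return borel 0) t" by (simp add: char_gau)
  qed
  show "real_distribution (return borel 0)"
    by (simp add: real_distribution_def real_distribution_axioms_def prob_space_return)
qed (rule real_distribution_gau)

lemma gau_abs_third: "integrable (gau v) (\<lambda>x. \<bar>x\<bar> ^ 3)" 
  "0 \<le> v \<Longrightarrow> (\<integral>x. \<bar>x\<bar> ^ 3 \<partial>gau v) = v * sqrt v * (\<integral>z. \<bar>z\<bar> ^ 3 \<partial>std_normal_distribution)"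
proof -
  have "integrable std_normal_distribution (\<lambda>x. \<bar>sqrt v\<bar> ^ 3 * \<bar>x\<bar> ^ 3)"
    by (rule integrable_mult_right) (rule std_normal_abs_moment)
  then show "integrable (gau v) (\<lambda>x. \<bar>x\<bar> ^ 3)" by (subst integrable_gau_iff) (auto simp: abs_mult power_mult_distrib)
  assume v: "0 \<le> v"
  then have v3: "\<bar>sqrt v\<bar> ^ 3 = v * sqrt v" by (simp add: power3_eq_cube)
  have "(\<integral>x. \<bar>x\<bar> ^ 3 \<partial>gau v) = (\<integral>z. \<bar>sqrt v\<bar> ^ 3 * \<bar>z\<bar> ^ 3 \<partial>std_normal_distribution)"
    by (subst integral_gau) (auto simp: abs_mult power_mult_distrib)
  then show "(\<integral>x. \<bar>x\<bar> ^ 3 \<partial>gau v) = v * sqrt v * (\<integral>z. \<bar>z\<bar> ^ 3 \<partial>std_normal_distribution)"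
    unfolding integral_mult_right_zero v3 .
qed

text \<open>The wider law is the narrower one convolved with a centred law, so Jensen's inequality
  applies.\<close>

lemma gau_convex_mono:
  fixes g :: "real \<Rightarrow> real"
  assumes "0 \<le> v" "v \<le> w" and g: "convex_on UNIV g" "integrable (gau v) g" "integrable (gau w) g"
  shows "(\<integral>x. g x \<partial>gau v) \<le> (\<integral>x. g x \<partial>gau w)"
proof -
  have w: "gau w = (gau v \<star> gau (w - v))" using gau_convolution[of v "w - v"] assms by simp
  note R = real_distribution_gau
  interpret r: real_distribution "gau (w - v)" by (rule R)
  note C = convolution_integral[OF R R g(3)[unfolded w]]
  have "(\<integral>x. g x \<partial>gau v) \<le> (\<integral>x. \<integral>y. g (x + y) \<partial>gau (w - v) \<partial>gau v)"
  proof (rule integral_mono_AE)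
    show "AE x in gau v. g x \<le> (\<integral>y. g (x + y) \<partial>gau (w - v))"
      using C(3) by eventually_elim (rule r.jensen_shift[OF g(1) gau_mom])
  qed (use g C in auto)
  also have "\<dots> = (\<integral>x. g x \<partial>gau w)" unfolding w C(2) ..
  finally show ?thesis .
qed

text \<open>Two-sided second order Taylor bounds, in a form that is stable under averaging over shifts.\<close>

definition taylor_convex :: "real \<Rightarrow> (real \<Rightarrow> real) \<Rightarrow> (real \<Rightarrow> real) \<Rightarrow> (real \<Rightarrow> real) \<Rightarrow> bool" where
  "taylor_convex C F F1 F2 \<longleftrightarrow> F \<in> borel_measurable borel \<and> F1 \<in> borel_measurable borel \<and> F2 \<in> borel_measurable borel \<and>
     (\<forall>x. 0 \<le> F2 x \<and> F2 x \<le> C \<and> \<bar>F1 x\<bar> \<le> C) \<and> (\<forall>x y. \<bar>F (x + y) - F x\<bar> \<le> C * \<bar>y\<bar>) \<and>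
     (\<forall>x y e. 0 < e \<longrightarrow> F x + F1 x * y + (1/2) * (F2 x - C * e) * min (y\<^sup>2) (e\<^sup>2) \<le> F (x + y)) \<and>
     (\<forall>x y. F (x + y) \<le> F x + F1 x * y + (1/2) * F2 x * y\<^sup>2 + (C/2) * \<bar>y\<bar> ^ 3)"

lemma taylor_convex_shift_integrable:
  assumes "taylor_convex C F F1 F2" "real_distribution \<beta>" "integrable \<beta> (\<lambda>x. x)"
  shows "integrable \<beta> (\<lambda>y. F (x + y))" "integrable \<beta> (\<lambda>y. F1 (x + y))" "integrable \<beta> (\<lambda>y. F2 (x + y))"
proof -
  interpret b: real_distribution \<beta> by fact
  have [measurable]: "F \<in> borel_measurable borel" "F1 \<in> borel_measurable borel" "F2 \<in> borel_measurable borel"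
    and B: "\<And>x. 0 \<le> F2 x" "\<And>x. F2 x \<le> C" "\<And>x. \<bar>F1 x\<bar> \<le> C" "\<And>x y. \<bar>F (x + y) - F x\<bar> \<le> C * \<bar>y\<bar>"
    using assms(1) by (auto simp: taylor_convex_def)
  show "integrable \<beta> (\<lambda>y. F (x + y))"
  proof (rule b.integrable_linear_growth[OF assms(3)])
    fix y show "\<bar>F (x + y)\<bar> \<le> \<bar>F x\<bar> + C * \<bar>y\<bar>" using B(4)[of x y] by linarith
  qed simp
  show "integrable \<beta> (\<lambda>y. F1 (x + y))"
    by (rule b.integrable_linear_growth[OF assms(3), where A=C and B=0]) (use B in auto)
  show "integrable \<beta> (\<lambda>y. F2 (x + y))"
    by (rule b.integrable_linear_growth[OF assms(3), where A=C and B=0]) (use B in auto)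
qed

text \<open>All conditions are convex in the triple \<open>(F, F1, F2)\<close> for fixed
  \<open>C\<close>. The constant does not deteriorate, which lets the replacement argument run
  through arbitrarily many cells.\<close>

lemma taylor_convex_average:
  assumes T: "taylor_convex C F F1 F2" and \<beta>: "real_distribution \<beta>" "integrable \<beta> (\<lambda>x. x)"
  shows "taylor_convex C (\<lambda>x. \<integral>y. F (x + y) \<partial>\<beta>) (\<lambda>x. \<integral>y. F1 (x + y) \<partial>\<beta>) (\<lambda>x. \<integral>y. F2 (x + y) \<partial>\<beta>)"
proof -
  interpret b: real_distribution \<beta> by fact
  have [measurable]: "F \<in> borel_measurable borel" "F1 \<in> borel_measurable borel" "F2 \<in> borel_measurable borel"
    and B: "\<And>x. 0 \<le> F2 x" "\<And>x. F2 x \<le> C" "\<And>x. \<bar>F1 x\<bar> \<le> C" "\<And>x y. \<bar>F (x + y) - F x\<bar> \<le> C * \<bar>y\<bar>"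
    and L: "\<And>x y e. 0 < e \<Longrightarrow> F x + F1 x * y + (1/2) * (F2 x - C * e) * min (y\<^sup>2) (e\<^sup>2) \<le> F (x + y)"
    and U: "\<And>x y. F (x + y) \<le> F x + F1 x * y + (1/2) * F2 x * y\<^sup>2 + (C/2) * \<bar>y\<bar> ^ 3"
    using T by (auto simp: taylor_convex_def)
  note I = taylor_convex_shift_integrable[OF T \<beta>]
  have I': "integrable \<beta> (\<lambda>z. F (x + y + z))" for x y using I(1)[of "x + y"] by (simp add: add.assoc)
  show ?thesis
    unfolding taylor_convex_def
  proof (intro conjI allI impI)
    fix x y e :: real
    show "0 \<le> (\<integral>y. F2 (x + y) \<partial>\<beta>)" using B by (intro Bochner_Integration.integral_nonneg) auto
    have "(\<integral>y. F2 (x + y) \<partial>\<beta>) \<le> (\<integral>y. C \<partial>\<beta>)" using I B by (intro integral_mono) auto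
    then show "(\<integral>y. F2 (x + y) \<partial>\<beta>) \<le> C" by simp
    have "\<bar>\<integral>y. F1 (x + y) \<partial>\<beta>\<bar> \<le> (\<integral>y. \<bar>F1 (x + y)\<bar> \<partial>\<beta>)" by (rule integral_abs_bound)
    also have "\<dots> \<le> (\<integral>y. C \<partial>\<beta>)" using I B by (intro integral_mono integrable_abs) auto
    finally show "\<bar>\<integral>y. F1 (x + y) \<partial>\<beta>\<bar> \<le> C" by simp
    have "\<bar>(\<integral>z. F (x + y + z) \<partial>\<beta>) - (\<integral>z. F (x + z) \<partial>\<beta>)\<bar> = \<bar>\<integral>z. F (x + y + z) - F (x + z) \<partial>\<beta>\<bar>"
      using I I' by simp
    also have "\<dots> \<le> (\<integral>z. \<bar>F (x + y + z) - F (x + z)\<bar> \<partial>\<beta>)" by (rule integral_abs_bound)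
    also have "\<dots> \<le> (\<integral>z. C * \<bar>y\<bar> \<partial>\<beta>)"
    proof (intro integral_mono)
      fix z show "\<bar>F (x + y + z) - F (x + z)\<bar> \<le> C * \<bar>y\<bar>" using B(4)[of "x + z" y] by (simp add: algebra_simps)
    qed (use I I' in auto)
    finally show "\<bar>(\<integral>z. F (x + y + z) \<partial>\<beta>) - (\<integral>z. F (x + z) \<partial>\<beta>)\<bar> \<le> C * \<bar>y\<bar>" by simp
    show "(\<integral>z. F (x + y + z) \<partial>\<beta>) \<le> (\<integral>z. F (x + z) \<partial>\<beta>) + (\<integral>z. F1 (x + z) \<partial>\<beta>) * y + (1/2) * (\<integral>z. F2 (x + z) \<partial>\<beta>) * y\<^sup>2 + (C/2) * \<bar>y\<bar> ^ 3"
    proof -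
      have "(\<integral>z. F (x + y + z) \<partial>\<beta>) \<le> (\<integral>z. F (x + z) + F1 (x + z) * y + (1/2) * F2 (x + z) * y\<^sup>2 + (C/2) * \<bar>y\<bar> ^ 3 \<partial>\<beta>)"
      proof (intro integral_mono)
        fix z show "F (x + y + z) \<le> F (x + z) + F1 (x + z) * y + (1/2) * F2 (x + z) * y\<^sup>2 + (C/2) * \<bar>y\<bar> ^ 3"
          using U[of "x + z" y] by (simp add: algebra_simps)
      qed (use I I' in auto)
      then show ?thesis using I by simp
    qed
    assume e: "0 < e"
    show "(\<integral>z. F (x + z) \<partial>\<beta>) + (\<integral>z. F1 (x + z) \<partial>\<beta>) * y + (1/2) * ((\<integral>z. F2 (x + z) \<partial>\<beta>) - C * e) * min (y\<^sup>2) (e\<^sup>2) \<le> (\<integral>z. F (x + y + z) \<partial>\<beta>)"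
    proof -
      define m where "m = min (y\<^sup>2) (e\<^sup>2)"
      have "(\<integral>z. F (x + z) + F1 (x + z) * y + (1/2) * (F2 (x + z) - C * e) * m \<partial>\<beta>) \<le> (\<integral>z. F (x + y + z) \<partial>\<beta>)"
      proof (intro integral_mono)
        fix z show "F (x + z) + F1 (x + z) * y + (1/2) * (F2 (x + z) - C * e) * m \<le> F (x + y + z)"
          using L[OF e, of "x + z" y] by (simp add: m_def add_ac)
      qed (use I I' in auto)
      then show ?thesis using I by (simp add: m_def)
    qed
  qed measurable
qed

text \<open>The lower bound needs only a truncated square: beyond distance \<open>e\<close> the
  function lies above its tangent at \<open>x + e\<close> or \<open>x - e\<close>, which is at least
  as steep outwards as the one at \<open>x\<close>. The increments therefore need no second moment.
  The cubic upper bound will be integrated against normal laws only.\<close>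

lemma taylor_convexI:
  assumes D1: "\<And>x. (F has_real_derivative F1 x) (at x)" and D2: "\<And>x. (F1 has_real_derivative F2 x) (at x)"
    and B: "\<And>x. 0 \<le> F2 x" "\<And>x. F2 x \<le> C" "\<And>x. \<bar>F1 x\<bar> \<le> C" and Lip: "\<And>x y. \<bar>F2 (x + y) - F2 x\<bar> \<le> C * \<bar>y\<bar>"
  shows "taylor_convex C F F1 F2"
proof -
  have C0: "0 \<le> C" using B(1)[of 0] B(2)[of 0] by linarith
  have cont: "continuous_on UNIV F" "continuous_on UNIV F1"
    using D1 D2 by (auto intro!: continuous_at_imp_continuous_on DERIV_isCont)
  have cont2: "continuous_on UNIV F2"
  proof (rule uniformly_continuous_imp_continuous, rule lipschitz_on_uniformly_continuous)
    show "C-lipschitz_on UNIV F2"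
    proof (rule lipschitz_onI)
      fix x y :: real show "dist (F2 x) (F2 y) \<le> C * dist x y" using Lip[of y "x - y"] by (simp add: dist_real_def)
    qed (use C0 in auto)
  qed
  have tay: "\<exists>\<xi>. \<bar>\<xi> - x\<bar> \<le> \<bar>y\<bar> \<and> F (x + y) = F x + F1 x * y + (1/2) * F2 \<xi> * y\<^sup>2" for x y
  proof (cases "y = 0")
    case False
    define diff where "diff = (\<lambda>m::nat. if m = 0 then F else if m = 1 then F1 else F2)"
    have "\<exists>t. (if x + y < x then x + y < t \<and> t < x else x < t \<and> t < x + y) \<and>
        F (x + y) = (\<Sum>m<2. (diff m x / fact m) * ((x + y) - x)^m) + (diff 2 t / fact 2) * ((x + y) - x)^2"
    proof (rule Taylor[where a = "x - \<bar>y\<bar>" and b = "x + \<bar>y\<bar>"])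
      show "\<forall>m t. m < 2 \<and> x - \<bar>y\<bar> \<le> t \<and> t \<le> x + \<bar>y\<bar> \<longrightarrow> (diff m has_real_derivative diff (Suc m) t) (at t)"
        using D1 D2 by (auto simp: diff_def less_2_cases_iff)
    qed (use False in \<open>auto simp: diff_def\<close>)
    then obtain t where t: "if x + y < x then x + y < t \<and> t < x else x < t \<and> t < x + y"
      "F (x + y) = (\<Sum>m<2. (diff m x / fact m) * ((x + y) - x)^m) + (diff 2 t / fact 2) * ((x + y) - x)^2" by blast
    have "\<bar>t - x\<bar> \<le> \<bar>y\<bar>" using t(1) by (auto split: if_splits)
    moreover have "F (x + y) = F x + F1 x * y + (1/2) * F2 t * y\<^sup>2"
      using t(2) by (simp add: diff_def numeral_2_eq_2)
    ultimately show ?thesis by blast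
  qed auto
  have Lip': "\<bar>F2 \<xi> - F2 x\<bar> \<le> C * \<bar>y\<bar>" if "\<bar>\<xi> - x\<bar> \<le> \<bar>y\<bar>" for \<xi> x y
    using Lip[of x "\<xi> - x"] mult_left_mono[OF that C0] by simp
  have F1mono: "F1 x \<le> F1 y" if "x \<le> y" for x y
    by (rule DERIV_nonneg_imp_nondecreasing[OF that]) (use D2 B in blast)
  have supp: "F x + F1 x * y \<le> F (x + y)" for x y
  proof -
    obtain \<xi> where "F (x + y) = F x + F1 x * y + (1/2) * F2 \<xi> * y\<^sup>2" using tay by blast
    moreover have "0 \<le> (1/2) * F2 \<xi> * y\<^sup>2" using B by simp
    ultimately show ?thesis by linarith
  qed
  have low: "F x + F1 x * y + (1/2) * (F2 x - C * e) * y\<^sup>2 \<le> F (x + y)" if "\<bar>y\<bar> \<le> e" for x y e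
  proof -
    obtain \<xi> where \<xi>: "\<bar>\<xi> - x\<bar> \<le> \<bar>y\<bar>" "F (x + y) = F x + F1 x * y + (1/2) * F2 \<xi> * y\<^sup>2" using tay by blast
    have "F2 x - C * e \<le> F2 \<xi>" using Lip'[OF \<xi>(1)] mult_left_mono[OF that C0] by linarith
    then have "(F2 x - C * e) * y\<^sup>2 \<le> F2 \<xi> * y\<^sup>2" by (intro mult_right_mono) auto
    then show ?thesis unfolding \<xi>(2) by simp
  qed
  show ?thesis
    unfolding taylor_convex_def
  proof (intro conjI allI impI)
    fix x y e :: real
    show "\<bar>F (x + y) - F x\<bar> \<le> C * \<bar>y\<bar>"
    proof -
      have a: "\<bar>F1 z * y\<bar> \<le> C * \<bar>y\<bar>" for z using B(3)[of z] by (simp add: abs_mult mult_right_mono)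
      show ?thesis using supp[of x y] supp[of "x + y" "- y"] a[of x] a[of "x + y"] by (simp add: abs_le_iff)
    qed
    obtain \<xi> where \<xi>: "\<bar>\<xi> - x\<bar> \<le> \<bar>y\<bar>" "F (x + y) = F x + F1 x * y + (1/2) * F2 \<xi> * y\<^sup>2" using tay by blast
    have "F2 \<xi> \<le> F2 x + C * \<bar>y\<bar>" using Lip'[OF \<xi>(1)] by linarith
    then have "F2 \<xi> * y\<^sup>2 \<le> (F2 x + C * \<bar>y\<bar>) * y\<^sup>2" by (intro mult_right_mono) auto
    also have "\<dots> = F2 x * y\<^sup>2 + C * \<bar>y\<bar> ^ 3" by (simp add: power3_eq_cube power2_eq_square algebra_simps abs_mult_self_eq)
    finally show "F (x + y) \<le> F x + F1 x * y + (1/2) * F2 x * y\<^sup>2 + (C/2) * \<bar>y\<bar> ^ 3" unfolding \<xi>(2) by simp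
    assume e: "0 < e"
    consider "\<bar>y\<bar> \<le> e" | "e < y" | "y < - e" by linarith
    then show "F x + F1 x * y + (1/2) * (F2 x - C * e) * min (y\<^sup>2) (e\<^sup>2) \<le> F (x + y)"
    proof cases
      case 1
      then have "y\<^sup>2 \<le> e\<^sup>2" by (metis abs_le_square_iff abs_of_pos e)
      then show ?thesis using low[OF 1] by (simp add: min_absorb1)
    next
      case 2
      then have "e\<^sup>2 \<le> y\<^sup>2" using e by (intro power_mono) auto
      then have m: "min (y\<^sup>2) (e\<^sup>2) = e\<^sup>2" by simp
      have "F1 x * (y - e) \<le> F1 (x + e) * (y - e)" using F1mono[of x "x + e"] e 2 by (intro mult_right_mono) auto
      moreover have "F (x + e) + F1 (x + e) * (y - e) \<le> F (x + y)" using supp[of "x + e" "y - e"] by simp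
      moreover have "F x + F1 x * e + (1/2) * (F2 x - C * e) * e\<^sup>2 \<le> F (x + e)" using low[of e e x] e by simp
      moreover have "F1 x * (y - e) = F1 x * y - F1 x * e" by (simp add: right_diff_distrib)
      ultimately show ?thesis unfolding m by linarith
    next
      case 3
      then have "e\<^sup>2 \<le> (- y)\<^sup>2" using e by (intro power_mono) auto
      then have m: "min (y\<^sup>2) (e\<^sup>2) = e\<^sup>2" by simp
      have "F1 x * (y + e) \<le> F1 (x - e) * (y + e)" using F1mono[of "x - e" x] e 3 by (intro mult_right_mono_neg) auto
      moreover have "F (x - e) + F1 (x - e) * (y + e) \<le> F (x + y)" using supp[of "x - e" "y + e"] by simp
      moreover have "F x - F1 x * e + (1/2) * (F2 x - C * e) * e\<^sup>2 \<le> F (x - e)" using low[of "- e" e x] e by simp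
      moreover have "F1 x * (y + e) = F1 x * y + F1 x * e" by (simp add: distrib_left)
      ultimately show ?thesis unfolding m by linarith
    qed
  qed (use B cont cont2 in \<open>auto intro: borel_measurable_continuous_onI\<close>)
qed

lemma antiderivative_real:
  fixes g :: "real \<Rightarrow> real"
  assumes "continuous_on UNIV g"
  obtains G where "\<And>x. (G has_real_derivative g x) (at x)"
proof -
  have "\<exists>F. \<forall>x :: real. -\<infinity> < ereal x \<longrightarrow> ereal x < \<infinity> \<longrightarrow> (F has_vector_derivative g x) (at x)"
    by (rule einterval_antiderivative) (use assms in \<open>auto simp: continuous_on_eq_continuous_at\<close>)
  then show ?thesis using that by (auto simp: has_real_derivative_iff_has_vector_derivative)
qed

lemma convex_midpoint:
  fixes g :: "real \<Rightarrow> real"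
  assumes "convex_on UNIV g" shows "2 * g x \<le> g (x + h) + g (x - h)"
  using convex_onD[OF assms, of "1/2" "x + h" "x - h"] by (simp add: field_simps)

text \<open>The smoothing is the second difference quotient of a second antiderivative.\<close>

lemma taylor_convex_approximation:
  fixes g :: "real \<Rightarrow> real"
  assumes cv: "convex_on UNIV g" and Lip: "\<And>x y. \<bar>g x - g y\<bar> \<le> L * \<bar>x - y\<bar>" and L: "0 \<le> L" and h: "0 < h"
  shows "\<exists>C F F1 F2. taylor_convex C F F1 F2 \<and> convex_on UNIV F \<and> (\<forall>x. g x \<le> F x \<and> F x \<le> g x + L * h)"
proof -
  have "continuous_on UNIV g"
  proof (rule uniformly_continuous_imp_continuous, rule lipschitz_on_uniformly_continuous)
    show "L-lipschitz_on UNIV g" using Lip L by (intro lipschitz_onI) (auto simp: dist_real_def)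
  qed
  then obtain G where G: "\<And>x. (G has_real_derivative g x) (at x)" using antiderivative_real by blast
  have "continuous_on UNIV G" using G by (auto intro!: continuous_at_imp_continuous_on DERIV_isCont)
  then obtain K where K: "\<And>x. (K has_real_derivative G x) (at x)" using antiderivative_real by blast
  have sK: "((\<lambda>x. K (x + c)) has_real_derivative G (x + c)) (at x)" for x c using K[of "x + c"] by (simp add: DERIV_shift)
  have sG: "((\<lambda>x. G (x + c)) has_real_derivative g (x + c)) (at x)" for x c using G[of "x + c"] by (simp add: DERIV_shift)
  have r: "((\<lambda>t. x - t) has_real_derivative -1) (at t)" for x t :: real by (auto intro!: derivative_eq_intros)
  have rK: "((\<lambda>t. K (x - t)) has_real_derivative - G (x - t)) (at t)" for x t
    using DERIV_chain2[where f = K and g = "\<lambda>t. x - t", OF K r] by simp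
  have rG: "((\<lambda>t. G (x - t)) has_real_derivative - g (x - t)) (at t)" for x t
    using DERIV_chain2[where f = G and g = "\<lambda>t. x - t", OF G r] by simp
  have aK: "((\<lambda>t. K (x + t)) has_real_derivative G (x + t)) (at t)" for x t using sK[of x t] by (simp add: add.commute)
  have aG: "((\<lambda>t. G (x + t)) has_real_derivative g (x + t)) (at t)" for x t using sG[of x t] by (simp add: add.commute)
  define F where "F x = (K (x + h) - 2 * K x + K (x + (- h))) / h\<^sup>2" for x
  define F1 where "F1 x = (G (x + h) - 2 * G x + G (x + (- h))) / h\<^sup>2" for x
  define F2 where "F2 x = (g (x + h) - 2 * g x + g (x + (- h))) / h\<^sup>2" for x
  have D1: "(F has_real_derivative F1 x) (at x)" for x
    unfolding F_def[abs_def] F1_def by (intro DERIV_cdivide DERIV_add DERIV_diff DERIV_cmult sK K)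
  have D2: "(F1 has_real_derivative F2 x) (at x)" for x
    unfolding F1_def[abs_def] F2_def by (intro DERIV_cdivide DERIV_add DERIV_diff DERIV_cmult sG G)
  have F2_0: "0 \<le> F2 x" for x unfolding F2_def using convex_midpoint[OF cv, of x h] by simp
  have F2_le: "F2 x \<le> 2 * L / h" for x
  proof -
    have "g (x + h) - 2 * g x + g (x + (- h)) \<le> 2 * L * h" using Lip[of "x + h" x] Lip[of "x + (- h)" x] h by simp
    then have "F2 x \<le> 2 * L * h / h\<^sup>2" unfolding F2_def by (intro divide_right_mono) auto
    also have "\<dots> = 2 * L / h" using h by (simp add: power2_eq_square)
    finally show ?thesis .
  qed
  have F1_le: "\<bar>F1 x\<bar> \<le> 2 * L" for x
  proof -
    define \<psi> where "\<psi> t = G (x + t) + G (x - t)" for t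
    have "\<exists>z. 0 < z \<and> z < h \<and> \<psi> h - \<psi> 0 = (h - 0) * (g (x + z) + - g (x - z))"
      unfolding \<psi>_def[abs_def] by (rule MVT2[OF h]) (intro DERIV_add aG rG)
    then obtain z where z: "0 < z" "z < h" "\<psi> h - \<psi> 0 = h * (g (x + z) - g (x - z))" by auto
    have "\<bar>g (x + z) - g (x - z)\<bar> \<le> L * (2 * z)" using Lip[of "x + z" "x - z"] z by simp
    also have "\<dots> \<le> L * (2 * h)" using z L by (intro mult_left_mono) auto
    finally have "h * \<bar>g (x + z) - g (x - z)\<bar> \<le> h * (L * (2 * h))" using h by (intro mult_left_mono) auto
    then have \<psi>le: "\<bar>\<psi> h - \<psi> 0\<bar> \<le> 2 * L * h\<^sup>2" unfolding z(3) using h by (simp add: abs_mult power2_eq_square mult_ac)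
    have "F1 x = (\<psi> h - \<psi> 0) / h\<^sup>2" by (simp add: F1_def \<psi>_def)
    then have "\<bar>F1 x\<bar> = \<bar>\<psi> h - \<psi> 0\<bar> / h\<^sup>2" by (simp add: abs_divide)
    also have "\<dots> \<le> 2 * L * h\<^sup>2 / h\<^sup>2" using \<psi>le by (intro divide_right_mono) auto
    also have "\<dots> = 2 * L" using h by simp
    finally show ?thesis .
  qed
  have F2_Lip: "\<bar>F2 (x + y) - F2 x\<bar> \<le> 4 * L / h\<^sup>2 * \<bar>y\<bar>" for x y
  proof -
    have "\<bar>(g (x + y + h) - 2 * g (x + y) + g (x + y + (- h))) - (g (x + h) - 2 * g x + g (x + (- h)))\<bar> \<le> 4 * (L * \<bar>y\<bar>)"
      using Lip[of "x + y + h" "x + h"] Lip[of "x + y" x] Lip[of "x + y + (- h)" "x + (- h)"] by simp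
    then have "\<bar>(g (x + y + h) - 2 * g (x + y) + g (x + y + (- h))) - (g (x + h) - 2 * g x + g (x + (- h)))\<bar> / h\<^sup>2 \<le> 4 * (L * \<bar>y\<bar>) / h\<^sup>2"
      by (intro divide_right_mono) auto
    then show ?thesis unfolding F2_def diff_divide_distrib[symmetric] by (simp add: abs_divide)
  qed
  define C where "C = 2 * L + 2 * L / h + 4 * L / h\<^sup>2"
  have pos: "0 \<le> 2 * L / h" "0 \<le> 4 * L / h\<^sup>2" using L h by auto
  have tc: "taylor_convex C F F1 F2"
  proof (rule taylor_convexI[OF D1 D2 F2_0])
    show "F2 x \<le> C" for x using F2_le[of x] pos L unfolding C_def by linarith
    show "\<bar>F1 x\<bar> \<le> C" for x using F1_le[of x] pos L unfolding C_def by linarith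
    fix x y
    have "4 * L / h\<^sup>2 * \<bar>y\<bar> \<le> C * \<bar>y\<bar>" using pos L unfolding C_def by (intro mult_right_mono) auto
    then show "\<bar>F2 (x + y) - F2 x\<bar> \<le> C * \<bar>y\<bar>" using F2_Lip[of x y] by linarith
  qed
  have "convex_on UNIV F" by (rule f''_ge0_imp_convex[OF _ D1 D2 F2_0]) auto
  moreover have "g x \<le> F x \<and> F x \<le> g x + L * h" for x
  proof -
    \<comment> \<open>Taylor's formula for the symmetric sum shows that \<open>F x\<close> is the
      mean of \<open>g (x + t)\<close> and \<open>g (x - t)\<close> for some \<open>t\<close>
      between 0 and \<open>h\<close>. Midpoint convexity bounds this mean below by
      \<open>g x\<close>, the Lipschitz condition bounds it above.\<close>
    define \<theta> where "\<theta> t = K (x + t) + K (x - t)" for t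
    define diff where "diff = (\<lambda>m::nat. if m = 0 then \<theta> else if m = 1 then (\<lambda>t. G (x + t) + - G (x - t)) else (\<lambda>t. g (x + t) + g (x - t)))"
    have "\<exists>t. (if h < 0 then h < t \<and> t < 0 else 0 < t \<and> t < h) \<and>
        \<theta> h = (\<Sum>m<2. (diff m 0 / fact m) * (h - 0)^m) + (diff 2 t / fact 2) * (h - 0)^2"
    proof (rule Taylor[where a = 0 and b = h])
      have "(\<theta> has_real_derivative G (x + t) + - G (x - t)) (at t)" for t
        unfolding \<theta>_def[abs_def] by (intro DERIV_add aK rK)
      moreover have "((\<lambda>t. G (x + t) + - G (x - t)) has_real_derivative g (x + t) + - (- g (x - t))) (at t)" for t
        by (intro DERIV_add DERIV_minus aG rG)
      ultimately show "\<forall>m t. m < 2 \<and> 0 \<le> t \<and> t \<le> h \<longrightarrow> (diff m has_real_derivative diff (Suc m) t) (at t)"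
        by (auto simp: diff_def less_2_cases_iff)
    qed (use h in \<open>auto simp: diff_def\<close>)
    then obtain t where t: "0 < t" "t < h" "\<theta> h = 2 * K x + (g (x + t) + g (x - t)) / 2 * h\<^sup>2"
      using h by (auto simp: diff_def numeral_2_eq_2 \<theta>_def)
    have "F x = (\<theta> h - 2 * K x) / h\<^sup>2" by (simp add: F_def \<theta>_def)
    then have Fx: "F x = (g (x + t) + g (x - t)) / 2" using t(3) h by simp
    have "L * t \<le> L * h" using t L by (intro mult_left_mono) auto
    then have "g (x + t) + g (x - t) \<le> 2 * (g x + L * h)" using Lip[of "x + t" x] Lip[of "x - t" x] t by simp
    then show ?thesis using convex_midpoint[OF cv, of x t] unfolding Fx by simp
  qed
  ultimately show ?thesis using tc by blast
qed

text \<open>\<open>g n\<close> is the supremum of the supporting lines of \<open>G\<close> at points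
  of \<open>[-n, n]\<close>. It is convex and Lipschitz, agrees with \<open>G\<close> on that
  interval, and lies between the line at 0 and \<open>G\<close>, so dominated convergence
  applies.\<close>

lemma convex_order_from_lipschitz:
  fixes G :: "real \<Rightarrow> real"
  assumes a: "real_distribution \<alpha>" "integrable \<alpha> (\<lambda>x. x)" and b: "real_distribution \<beta>" "integrable \<beta> (\<lambda>x. x)"
    and Lip: "\<And>g L. convex_on UNIV g \<Longrightarrow> 0 \<le> L \<Longrightarrow> (\<And>x y. \<bar>g x - g y\<bar> \<le> L * \<bar>x - y\<bar>) \<Longrightarrow>
        (\<integral>x. g x \<partial>\<alpha>) \<le> (\<integral>x. g x \<partial>\<beta>)"
    and G: "convex_on UNIV G" "integrable \<alpha> G" "integrable \<beta> G"
  shows "(\<integral>x. G x \<partial>\<alpha>) \<le> (\<integral>x. G x \<partial>\<beta>)"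
proof -
  interpret a: real_distribution \<alpha> by fact
  interpret b: real_distribution \<beta> by fact
  have "\<forall>x. \<exists>d. \<forall>y. G x + d * (y - x) \<le> G y"
    by (meson convex_subgradient[OF G(1)])
  then have "\<exists>d. \<forall>x y. G x + d x * (y - x) \<le> G y" by (rule choice)
  then obtain d where d: "\<And>x y. G x + d x * (y - x) \<le> G y" by blast
  have dmono: "d x \<le> d y" if "x \<le> y" for x y
  proof (cases "x = y")
    case False
    then have "0 < y - x" using that by simp
    moreover have "d x * (y - x) \<le> d y * (y - x)" using d[of x y] d[of y x] by (simp add: algebra_simps)
    ultimately show ?thesis by simp
  qed simp
  define g where "g n x = (SUP y\<in>{- real n..real n}. G y + d y * (x - y))" for n x
  have bdd: "bdd_above ((\<lambda>y. G y + d y * (x - y)) ` {- real n..real n})" for n x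
    using d by (intro bdd_aboveI[of _ "G x"]) auto
  have ne: "{- real n..real n} \<noteq> {}" for n by auto
  have g_le: "g n x \<le> G x" for n x
    unfolding g_def using d ne by (intro cSUP_least) auto
  have g_ge: "G y + d y * (x - y) \<le> g n x" if "y \<in> {- real n..real n}" for n x y
    unfolding g_def using that bdd by (rule cSUP_upper)
  have g_eq: "g n x = G x" if "\<bar>x\<bar> \<le> real n" for n x
    using g_le[of n x] g_ge[of x n x] that by (auto simp: abs_le_iff)
  have g_cv: "convex_on UNIV (g n)" for n
  proof (intro convex_onI)
    fix t x z :: real assume t: "0 < t" "t < 1"
    show "g n ((1 - t) *\<^sub>R x + t *\<^sub>R z) \<le> (1 - t) * g n x + t * g n z"
      unfolding g_def[of n "(1 - t) *\<^sub>R x + t *\<^sub>R z"]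
    proof (rule cSUP_least[OF ne])
      fix y assume y: "y \<in> {- real n..real n}"
      have "G y + d y * ((1 - t) *\<^sub>R x + t *\<^sub>R z - y) = (1 - t) * (G y + d y * (x - y)) + t * (G y + d y * (z - y))"
        by (simp add: algebra_simps)
      also have "\<dots> \<le> (1 - t) * g n x + t * g n z"
        using t by (intro add_mono mult_left_mono g_ge y) auto
      finally show "G y + d y * ((1 - t) *\<^sub>R x + t *\<^sub>R z - y) \<le> (1 - t) * g n x + t * g n z" .
    qed
  qed auto
  define L where "L n = \<bar>d (- real n)\<bar> + \<bar>d (real n)\<bar>" for n
  have dL: "\<bar>d y\<bar> \<le> L n" if "y \<in> {- real n..real n}" for y n
    using dmono[of "- real n" y] dmono[of y "real n"] that by (auto simp: L_def)
  have g_Lip': "g n x - g n z \<le> L n * \<bar>x - z\<bar>" for n x z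
  proof -
    have "g n x \<le> g n z + L n * \<bar>x - z\<bar>"
      unfolding g_def[of n x]
    proof (rule cSUP_least[OF ne])
      fix y assume y: "y \<in> {- real n..real n}"
      have "d y * (x - z) \<le> \<bar>d y\<bar> * \<bar>x - z\<bar>" by (simp flip: abs_mult)
      also have "\<dots> \<le> L n * \<bar>x - z\<bar>" using dL[OF y] by (intro mult_right_mono) auto
      moreover have "d y * (x - y) = d y * (z - y) + d y * (x - z)" by (simp add: algebra_simps)
      ultimately show "G y + d y * (x - y) \<le> g n z + L n * \<bar>x - z\<bar>"
        using g_ge[OF y, of z] by linarith
    qed
    then show ?thesis by simp
  qed
  have g_Lip: "\<bar>g n x - g n z\<bar> \<le> L n * \<bar>x - z\<bar>" for n x z
    using g_Lip'[of n x z] g_Lip'[of n z x] by (simp add: abs_le_iff abs_minus_commute)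
  have g_meas: "g n \<in> borel_measurable borel" for n
  proof (rule borel_measurable_continuous_onI, rule uniformly_continuous_imp_continuous, rule lipschitz_on_uniformly_continuous)
    show "(L n)-lipschitz_on UNIV (g n)" using g_Lip by (intro lipschitz_onI) (auto simp: dist_real_def L_def)
  qed
  have g_int: "integrable \<gamma> (g n)" if "real_distribution \<gamma>" "integrable \<gamma> (\<lambda>x. x)" for \<gamma> n
  proof (rule real_distribution.integrable_linear_growth[OF that g_meas])
    fix x show "\<bar>g n x\<bar> \<le> \<bar>g n 0\<bar> + L n * \<bar>x\<bar>" using g_Lip[of n x 0] by simp
  qed
  have lim: "(\<lambda>n. \<integral>x. g n x \<partial>\<gamma>) \<longlonglongrightarrow> (\<integral>x. G x \<partial>\<gamma>)"
    if \<gamma>: "real_distribution \<gamma>" "integrable \<gamma> (\<lambda>x. x)" "integrable \<gamma> G" for \<gamma>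
  proof (rule integral_dominated_convergence[where w = "\<lambda>x. \<bar>G x\<bar> + (\<bar>G 0\<bar> + \<bar>d 0\<bar> * \<bar>x\<bar>)"])
    interpret c: real_distribution \<gamma> by fact
    show "integrable \<gamma> (\<lambda>x. \<bar>G x\<bar> + (\<bar>G 0\<bar> + \<bar>d 0\<bar> * \<bar>x\<bar>))" using \<gamma> by auto
    show "AE x in \<gamma>. (\<lambda>n. g n x) \<longlonglongrightarrow> G x"
    proof (rule AE_I2)
      fix x
      obtain N where "\<bar>x\<bar> \<le> real N" using real_arch_simple by blast
      then have "g n x = G x" if "N \<le> n" for n using that by (intro g_eq) (auto intro: order_trans)
      then show "(\<lambda>n. g n x) \<longlonglongrightarrow> G x" by (intro tendsto_eventually) (auto simp: eventually_sequentially)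
    qed
    show "AE x in \<gamma>. norm (g n x) \<le> \<bar>G x\<bar> + (\<bar>G 0\<bar> + \<bar>d 0\<bar> * \<bar>x\<bar>)" for n
    proof (rule AE_I2)
      fix x
      have "- (\<bar>d 0\<bar> * \<bar>x\<bar>) \<le> d 0 * x" by (metis abs_ge_minus_self abs_mult minus_le_iff)
      then show "norm (g n x) \<le> \<bar>G x\<bar> + (\<bar>G 0\<bar> + \<bar>d 0\<bar> * \<bar>x\<bar>)"
      proof -
        have "G 0 + d 0 * x \<le> g n x" using g_ge[of 0 n x] by simp
        moreover have "0 \<le> \<bar>d 0\<bar> * \<bar>x\<bar>" by simp
        ultimately show ?thesis unfolding real_norm_def using g_le[of n x] \<open>- (\<bar>d 0\<bar> * \<bar>x\<bar>) \<le> d 0 * x\<close> by linarith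
      qed
    qed
    show "G \<in> borel_measurable \<gamma>" using \<gamma>(3) by (rule borel_measurable_integrable)
    show "g n \<in> borel_measurable \<gamma>" for n using g_int[OF \<gamma>(1,2)] by (rule borel_measurable_integrable)
  qed
  show ?thesis
  proof (rule LIMSEQ_le[OF lim[OF a G(2)] lim[OF b G(3)]])
    show "\<exists>N. \<forall>n\<ge>N. (\<integral>x. g n x \<partial>\<alpha>) \<le> (\<integral>x. g n x \<partial>\<beta>)"
      using Lip[OF g_cv _ g_Lip] by (auto simp: L_def)
  qed
qed

text \<open>One half comes from the loss \<open>C * e\<close> in the lower Taylor bound; the other
  half, with the third absolute moment, from the cubic term of the upper bound.\<close>

definition third_const :: real where "third_const = (1 + (\<integral>z. \<bar>z\<bar> ^ 3 \<partial>std_normal_distribution)) / 2"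

lemma third_const_nonneg: "0 \<le> third_const"
proof -
  have "0 \<le> (\<integral>z. \<bar>z\<bar> ^ 3 \<partial>std_normal_distribution)" by (rule Bochner_Integration.integral_nonneg) auto
  then show ?thesis by (simp add: third_const_def)
qed

section \<open>Lindeberg replacement and the convex order\<close>

context centred_hemigroup
begin

text \<open>Both laws are centred, and the variance of the normal one equals the truncated second
  moment of \<open>\<mu> c d\<close>, so the Taylor terms agree up to order two. The cubic term is
  small because the truncated variance is at most \<open>e\<^sup>2\<close>.\<close>

lemma taylor_convex_step:
  assumes T: "taylor_convex C F F1 F2" and cd: "0 \<le> c" "c \<le> d" "d \<le> 1" and e: "0 < e"
  shows "(\<integral>z. F (x + z) \<partial>gau (trunc_var e c d)) \<le> (\<integral>y. F (x + y) \<partial>\<mu> c d) + C * e * third_const * trunc_var e c d"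
proof -
  interpret r: real_distribution "\<mu> c d" using cd law by simp
  define q where "q = trunc_var e c d"
  interpret n: real_distribution "gau q" by (rule real_distribution_gau)
  have q: "0 \<le> q" "q \<le> e\<^sup>2" using trunc_var_nonneg trunc_var_le cd by (auto simp: q_def)
  have L: "F x + F1 x * y + (1/2) * (F2 x - C * e) * min (y\<^sup>2) (e\<^sup>2) \<le> F (x + y)"
    and U: "F (x + y) \<le> F x + F1 x * y + (1/2) * F2 x * y\<^sup>2 + (C/2) * \<bar>y\<bar> ^ 3" for y
    using T e by (auto simp: taylor_convex_def)
  have C0: "0 \<le> C" using T by (auto simp: taylor_convex_def intro: order_trans)
  note mi = mom[OF cd] mean[OF cd]
  have "F x + (1/2) * (F2 x - C * e) * q = (\<integral>y. F x + F1 x * y + (1/2) * (F2 x - C * e) * min (y\<^sup>2) (e\<^sup>2) \<partial>\<mu> c d)"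
    using mi trunc_var_integrable[OF cd, of e] by (simp add: q_def trunc_var_def)
  also have "\<dots> \<le> (\<integral>y. F (x + y) \<partial>\<mu> c d)"
    using mi trunc_var_integrable[OF cd, of e] taylor_convex_shift_integrable(1)[OF T law[OF cd] mi(1)]
    by (intro integral_mono L) auto
  finally have 1: "F x + (1/2) * (F2 x - C * e) * q \<le> (\<integral>y. F (x + y) \<partial>\<mu> c d)" .
  have gi: "integrable (gau q) (\<lambda>y. F x + F1 x * y + (1/2) * F2 x * y\<^sup>2 + (C/2) * \<bar>y\<bar> ^ 3)"
    using gau_mom(1) gau_second(2) gau_abs_third(1) n.integrable_const
    by (intro Bochner_Integration.integrable_add integrable_mult_right) (auto simp: q_def)
  have "(\<integral>z. F (x + z) \<partial>gau q) \<le> (\<integral>y. F x + F1 x * y + (1/2) * F2 x * y\<^sup>2 + (C/2) * \<bar>y\<bar> ^ 3 \<partial>gau q)"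
    using taylor_convex_shift_integrable(1)[OF T real_distribution_gau gau_mom(1)] gi
    by (intro integral_mono U) auto
  also have "\<dots> = F x + (1/2) * F2 x * q + (C/2) * (q * sqrt q * (\<integral>z. \<bar>z\<bar> ^ 3 \<partial>std_normal_distribution))"
    using gau_mom[of q] gau_second[of q] gau_abs_third[of q] q n.prob_UNIV by (simp add: q_def[symmetric])
  also have "\<dots> \<le> F x + (1/2) * F2 x * q + (C/2) * (q * e * (\<integral>z. \<bar>z\<bar> ^ 3 \<partial>std_normal_distribution))"
  proof -
    have "sqrt q \<le> e" using q e by (simp add: real_le_lsqrt)
    moreover have "0 \<le> (\<integral>z. \<bar>z\<bar> ^ 3 \<partial>std_normal_distribution)" by (rule Bochner_Integration.integral_nonneg) auto
    ultimately show ?thesis using q C0 by (intro add_left_mono mult_left_mono mult_right_mono) auto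
  qed
  also have "\<dots> = F x + (1/2) * (F2 x - C * e) * q + C * e * third_const * q"
    by (simp add: third_const_def field_simps)
  finally show ?thesis using 1 by (simp add: q_def)
qed

lemma convex_order_partition:
  assumes P: "finite P" "P \<subseteq> {0..1}" "a \<in> P" "b \<in> P" "a \<le> b" and e: "0 < e" and T: "taylor_convex C F F1 F2"
  shows "(\<integral>x. F x \<partial>gau (psum (trunc_var e) P a b)) \<le> (\<integral>x. F x \<partial>\<mu> a b) + C * e * third_const * psum (trunc_var e) P a b"
proof -
  \<comment> \<open>Quantified over all triples, because the step uses the induction hypothesis for
    the average of \<open>F\<close> over the last increment.\<close>
  have "\<forall>F F1 F2. taylor_convex C F F1 F2 \<longrightarrow>
    (\<integral>x. F x \<partial>gau (psum (trunc_var e) P a b)) \<le> (\<integral>x. F x \<partial>\<mu> a b) + C * e * third_const * psum (trunc_var e) P a b"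
    using P(1,3,4,5)
  proof (induction rule: partition_induct)
    case base
    then show ?case by (simp add: diag gau_0)
  next
    case (step c)
    define d where "d = nxt P c"
    have cd: "0 \<le> a" "a \<le> c" "0 \<le> c" "c \<le> d" "d \<le> 1" "c \<le> 1" using step P by (auto simp: d_def subset_iff)
    define V where "V = psum (trunc_var e) P a c"
    define q where "q = trunc_var e c d"
    have ps: "psum (trunc_var e) P a d = V + q"
      unfolding d_def V_def q_def by (rule psum_nxt) (use P step in auto)
    have V0: "0 \<le> V" unfolding V_def by (rule psum_nonneg) (use P step trunc_var_nonneg in auto)
    have q0: "0 \<le> q" by (simp add: q_def trunc_var_nonneg)
    note R = real_distribution_gau
    interpret n: real_distribution "gau V" by (rule R)
    show ?case
      unfolding d_def[symmetric]
    proof (intro allI impI)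
      fix F F1 F2 assume T: "taylor_convex C F F1 F2"
      have i1: "integrable (\<mu> a d) F"
        using taylor_convex_shift_integrable(1)[OF T law mom, of a d 0] cd by simp
      have i2: "integrable (gau V \<star> gau q) F"
        using taylor_convex_shift_integrable(1)[OF T R gau_mom(1), where x = 0] gau_convolution[OF V0 q0] by simp
      note A = taylor_convex_average[OF T law[OF cd(3,4,5)] mom[OF cd(3,4,5)]]
      have "(\<integral>x. F x \<partial>gau (V + q)) = (\<integral>x. \<integral>y. F (x + y) \<partial>gau q \<partial>gau V)"
        unfolding gau_convolution[OF V0 q0, symmetric] by (rule convolution_integral(2)[OF R R i2])
      also have "\<dots> \<le> (\<integral>x. (\<integral>y. F (x + y) \<partial>\<mu> c d) + C * e * third_const * q \<partial>gau V)"
      proof (rule integral_mono)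
        show "integrable (gau V) (\<lambda>x. \<integral>y. F (x + y) \<partial>gau q)" by (rule convolution_integral(1)[OF R R i2])
        show "integrable (gau V) (\<lambda>x. (\<integral>y. F (x + y) \<partial>\<mu> c d) + C * e * third_const * q)"
          using taylor_convex_shift_integrable(1)[OF A R gau_mom(1), where x = 0] by simp
        show "(\<integral>y. F (x + y) \<partial>gau q) \<le> (\<integral>y. F (x + y) \<partial>\<mu> c d) + C * e * third_const * q" for x
          unfolding q_def by (rule taylor_convex_step[OF T cd(3,4,5) e])
      qed
      also have "\<dots> = (\<integral>x. \<integral>y. F (x + y) \<partial>\<mu> c d \<partial>gau V) + C * e * third_const * q"
        using taylor_convex_shift_integrable(1)[OF A R gau_mom(1), where x = 0] by simp
      also have "\<dots> \<le> (\<integral>x. \<integral>y. F (x + y) \<partial>\<mu> c d \<partial>\<mu> a c) + C * e * third_const * V + C * e * third_const * q"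
        using step(7) A unfolding V_def by (intro add_right_mono) blast
      also have "(\<integral>x. \<integral>y. F (x + y) \<partial>\<mu> c d \<partial>\<mu> a c) = (\<integral>x. F x \<partial>\<mu> a d)"
        using integral_conv(2)[of a c d F] cd i1 by simp
      finally show "(\<integral>x. F x \<partial>gau (psum (trunc_var e) P a d)) \<le> (\<integral>x. F x \<partial>\<mu> a d) + C * e * third_const * psum (trunc_var e) P a d"
        unfolding ps by (simp add: distrib_left)
    qed
  qed
  then show ?thesis using T by blast
qed

lemma gau_order_taylor:
  assumes T: "taylor_convex C F F1 F2" and cv: "convex_on UNIV F" and ab: "0 \<le> a" "a \<le> b" "b \<le> 1"
  shows "(\<integral>x. F x \<partial>gau (gauss_var a b)) \<le> (\<integral>x. F x \<partial>\<mu> a b)"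
proof -
  define M where "M = 2 / gain_const * (smooth_moment b - smooth_moment a)"
  define m1 where "m1 = (\<integral>z. \<bar>z\<bar> \<partial>std_normal_distribution)"
  have C0: "0 \<le> C" using T by (auto simp: taylor_convex_def intro: order_trans)
  have Fm[measurable]: "F \<in> borel_measurable borel" using T by (simp add: taylor_convex_def)
  have gi: "integrable (gau v) F" for v
    using taylor_convex_shift_integrable(1)[OF T real_distribution_gau gau_mom(1), where x = 0] by simp
  \<comment> \<open>Both laws are images of one standard normal variable and \<open>F\<close> is
    Lipschitz; \<open>sqrt w - sqrt v\<close> is at most \<open>sqrt (w - v)\<close>, so only the
    difference of the variances enters.\<close>
  have Lipg: "(\<integral>x. F x \<partial>gau w) \<le> (\<integral>x. F x \<partial>gau v) + C * sqrt e * m1" if vw: "0 \<le> v" "v \<le> w" "w - v \<le> e" for v w e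
  proof -
    have i1: "integrable std_normal_distribution (\<lambda>z. \<bar>z\<bar>)" using std_normal_abs_moment[of 1] by (simp only: power_one_right)
    have d: "sqrt w - sqrt v \<le> sqrt e"
    proof -
      have "sqrt w \<le> sqrt v + sqrt (w - v)"
        using sqrt_add_le_add_sqrt[of v "w - v"] vw by simp
      moreover have "sqrt (w - v) \<le> sqrt e" using vw by simp
      ultimately show ?thesis by linarith
    qed
    have "(\<integral>x. F x \<partial>gau w) = (\<integral>z. F (sqrt w * z) \<partial>std_normal_distribution)" by (rule integral_gau) simp
    also have "\<dots> \<le> (\<integral>z. F (sqrt v * z) + (C * sqrt e) * \<bar>z\<bar> \<partial>std_normal_distribution)"
    proof (rule integral_mono)
      show "integrable std_normal_distribution (\<lambda>z. F (sqrt w * z))" using gi by (simp add: integrable_gau_iff)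
      show "integrable std_normal_distribution (\<lambda>z. F (sqrt v * z) + (C * sqrt e) * \<bar>z\<bar>)"
        using gi i1 by (intro Bochner_Integration.integrable_add integrable_mult_right) (simp_all add: integrable_gau_iff)
      fix z
      have "F (sqrt v * z + (sqrt w - sqrt v) * z) - F (sqrt v * z) \<le> C * \<bar>(sqrt w - sqrt v) * z\<bar>"
        using T unfolding taylor_convex_def by (metis abs_le_D1)
      also have "\<bar>(sqrt w - sqrt v) * z\<bar> = (sqrt w - sqrt v) * \<bar>z\<bar>" using vw by (simp add: abs_mult)
      also have "C * ((sqrt w - sqrt v) * \<bar>z\<bar>) \<le> C * (sqrt e * \<bar>z\<bar>)"
        using d C0 by (intro mult_left_mono mult_right_mono) auto
      finally show "F (sqrt w * z) \<le> F (sqrt v * z) + (C * sqrt e) * \<bar>z\<bar>" by (simp add: algebra_simps)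
    qed
    also have "\<dots> = (\<integral>z. F (sqrt v * z) \<partial>std_normal_distribution) + C * sqrt e * m1"
      using gi[of v] i1 by (subst Bochner_Integration.integral_add) (auto simp: integrable_gau_iff m1_def)
    also have "(\<integral>z. F (sqrt v * z) \<partial>std_normal_distribution) = (\<integral>x. F x \<partial>gau v)" by (rule integral_gau[symmetric]) simp
    finally show ?thesis .
  qed
  have est: "(\<integral>x. F x \<partial>gau (gauss_var a b)) \<le> (\<integral>x. F x \<partial>\<mu> a b) + C * e * third_const * M + C * sqrt e * m1" if e: "0 < e" "e \<le> 1" for e
  proof -
    obtain P where P: "finite P" "P \<subseteq> {0..1}" "a \<in> P" "b \<in> P" "\<bar>psum (trunc_var e) P a b - lim_trunc_var e a b\<bar> < e"
      using lim_trunc_var_single[OF e ab e(1)] by blast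
    define V where "V = psum (trunc_var e) P a b"
    have V0: "0 \<le> V" unfolding V_def by (intro psum_nonneg P trunc_var_nonneg)
    have VM: "V \<le> M" unfolding V_def M_def by (intro psum_incr P trunc_var_incr ab) (use e in auto)
    have VQ: "gauss_var a b - e \<le> V" using P(5) gauss_var_le_lim_trunc_var[OF e ab] unfolding V_def by linarith
    \<comment> \<open>A variance below both \<open>V\<close> and \<open>gauss_var a b\<close>.
      Passing from \<open>v\<close> up to \<open>V\<close> is free by convexity; passing from
      \<open>v\<close> up to \<open>gauss_var a b\<close> costs a multiple of
      \<open>sqrt e\<close>.\<close>
    define v where "v = max 0 (gauss_var a b - e)"
    have v: "0 \<le> v" "v \<le> V" "v \<le> gauss_var a b" "gauss_var a b - v \<le> e" using V0 VQ gauss_var_nonneg[OF ab] e by (auto simp: v_def)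
    have "(\<integral>x. F x \<partial>gau (gauss_var a b)) \<le> (\<integral>x. F x \<partial>gau v) + C * sqrt e * m1" by (rule Lipg) (use v in auto)
    moreover have "(\<integral>x. F x \<partial>gau v) \<le> (\<integral>x. F x \<partial>gau V)" by (rule gau_convex_mono[OF v(1,2) cv gi gi])
    moreover have "(\<integral>x. F x \<partial>gau V) \<le> (\<integral>x. F x \<partial>\<mu> a b) + C * e * third_const * V"
      unfolding V_def by (rule convex_order_partition[OF P(1-4) ab(2) e(1) T])
    moreover have "C * e * third_const * V \<le> C * e * third_const * M" using VM C0 e third_const_nonneg by (intro mult_left_mono) auto
    ultimately show ?thesis by linarith
  qed
  have "(\<lambda>n. (\<integral>x. F x \<partial>\<mu> a b) + C * (1 / real (Suc n)) * third_const * M + C * sqrt (1 / real (Suc n)) * m1) \<longlonglongrightarrow> (\<integral>x. F x \<partial>\<mu> a b) + C * 0 * third_const * M + C * sqrt 0 * m1"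
    by (intro tendsto_intros LIMSEQ_Suc[OF lim_1_over_n])
  then have "(\<integral>x. F x \<partial>gau (gauss_var a b)) \<le> (\<integral>x. F x \<partial>\<mu> a b) + C * 0 * third_const * M + C * sqrt 0 * m1"
    by (rule LIMSEQ_le_const, intro exI allI impI est) auto
  then show ?thesis by simp
qed

text \<open>The variance \<open>v\<close> may be smaller than \<open>gauss_var a b\<close>, since it
  will be applied when only a lower bound for the latter is known. Lipschitz functions are reached
  from smooth ones by uniform approximation, general convex ones by
  \<open>convex_order_from_lipschitz\<close>.\<close>

theorem gau_le_increment:
  assumes ab: "0 \<le> a" "a \<le> b" "b \<le> 1" and v: "0 \<le> v" "v \<le> gauss_var a b"
    and G: "convex_on UNIV G" "integrable (gau v) G" "integrable (\<mu> a b) G"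
  shows "(\<integral>x. G x \<partial>gau v) \<le> (\<integral>x. G x \<partial>\<mu> a b)"
proof (rule convex_order_from_lipschitz[OF real_distribution_gau gau_mom(1) law[OF ab] mom[OF ab] _ G])
  fix g :: "real \<Rightarrow> real" and L assume g: "convex_on UNIV g" "0 \<le> L" "\<And>x y. \<bar>g x - g y\<bar> \<le> L * \<bar>x - y\<bar>"
  have gm: "g \<in> borel_measurable borel"
  proof (rule borel_measurable_continuous_onI, rule uniformly_continuous_imp_continuous, rule lipschitz_on_uniformly_continuous)
    show "L-lipschitz_on UNIV g" using g by (intro lipschitz_onI) (auto simp: dist_real_def)
  qed
  have gl: "\<bar>g x\<bar> \<le> \<bar>g 0\<bar> + L * \<bar>x\<bar>" for x using g(3)[of x 0] by simp
  have gi: "integrable (gau w) g" for w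
    by (rule real_distribution.integrable_linear_growth[OF real_distribution_gau gau_mom(1) gm gl])
  have mi: "integrable (\<mu> a b) g" by (rule integrable_lin[OF ab gm gl])
  interpret r: real_distribution "\<mu> a b" by (rule law[OF ab])
  have "(\<integral>x. g x \<partial>gau v) \<le> (\<integral>x. g x \<partial>gau (gauss_var a b))"
    by (rule gau_convex_mono[OF v g(1) gi gi])
  also have "\<dots> \<le> (\<integral>x. g x \<partial>\<mu> a b)"
  proof (rule field_le_epsilon)
    fix \<eta> :: real assume \<eta>: "0 < \<eta>"
    define h where "h = \<eta> / (L + 1)"
    have h: "0 < h" "L * h \<le> \<eta>" using \<eta> g(2) by (auto simp: h_def field_simps)
    obtain C F F1 F2 where F: "taylor_convex C F F1 F2" "convex_on UNIV F" "\<And>x. g x \<le> F x" "\<And>x. F x \<le> g x + L * h"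
      using taylor_convex_approximation[OF g(1,3,2) h(1)] by blast
    have Fi: "integrable \<beta> F" if "real_distribution \<beta>" "integrable \<beta> (\<lambda>x. x)" for \<beta>
      using taylor_convex_shift_integrable(1)[OF F(1) that, where x = 0] by simp
    have "(\<integral>x. g x \<partial>gau (gauss_var a b)) \<le> (\<integral>x. F x \<partial>gau (gauss_var a b))"
      by (intro integral_mono gi Fi F(3) real_distribution_gau gau_mom(1))
    also have "\<dots> \<le> (\<integral>x. F x \<partial>\<mu> a b)" by (rule gau_order_taylor[OF F(1,2) ab])
    also have "\<dots> \<le> (\<integral>x. g x + L * h \<partial>\<mu> a b)"
      using mi by (intro integral_mono F(4) Fi law mom ab) auto
    also have "\<dots> = (\<integral>x. g x \<partial>\<mu> a b) + L * h" using mi by simp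
    finally show "(\<integral>x. g x \<partial>gau (gauss_var a b)) \<le> (\<integral>x. g x \<partial>\<mu> a b) + \<eta>" using h by linarith
  qed
  finally show "(\<integral>x. g x \<partial>gau v) \<le> (\<integral>x. g x \<partial>\<mu> a b)" .
qed

end

subsection \<open>The growth condition\<close>

locale growth_function =
  fixes f :: "real \<Rightarrow> real"
  assumes F: "condition_F f"
begin

lemma f_sym: "f (- x) = f x" and f_cont: "continuous_on UNIV f" and f_convex: "convex_on UNIV f" and f_0 [simp]: "f 0 = 0"
  and f_strict: "0 < x \<Longrightarrow> x < y \<Longrightarrow> f x < f y"
  using F by (auto simp: condition_F_def strict_mono_on_def)

lemma f_measurable [measurable]: "f \<in> borel_measurable borel"
  using f_cont by (rule borel_measurable_continuous_onI)

lemma f_abs: "f \<bar>x\<bar> = f x"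
  using f_sym[of x] by (simp add: abs_if)

lemma f_nonneg: "0 \<le> f x"
  using convex_midpoint[OF f_convex, of 0 x] f_sym[of x] by simp

lemma f_mono: "\<bar>x\<bar> \<le> \<bar>y\<bar> \<Longrightarrow> f x \<le> f y"
proof -
  assume "\<bar>x\<bar> \<le> \<bar>y\<bar>"
  then have "f \<bar>x\<bar> \<le> f \<bar>y\<bar>"
  proof (cases "x = 0 \<or> \<bar>x\<bar> = \<bar>y\<bar>")
    case False
    then show ?thesis using f_strict[of "\<bar>x\<bar>" "\<bar>y\<bar>"] \<open>\<bar>x\<bar> \<le> \<bar>y\<bar>\<close> by simp
  qed (use f_nonneg in auto)
  then show ?thesis by (simp add: f_abs)
qed

lemma f_pos: "x \<noteq> 0 \<Longrightarrow> 0 < f x"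
  using f_strict[of "\<bar>x\<bar> / 2" "\<bar>x\<bar>"] f_nonneg[of "\<bar>x\<bar> / 2"] by (simp add: f_abs)

lemma f_strict': "\<bar>x\<bar> < \<bar>y\<bar> \<Longrightarrow> f x < f y"
  using f_strict[of "\<bar>x\<bar>" "\<bar>y\<bar>"] f_pos[of y] by (cases "x = 0") (auto simp: f_abs)

definition pK :: "real \<times> real" where
  "pK = (SOME q. 1 \<le> fst q \<and> fst q < 2 \<and> 0 \<le> snd q \<and> (\<forall>K\<ge>snd q. \<forall>x>0. f (K * x) \<le> K powr fst q * f x))"
definition p :: real where "p = fst pK"
text \<open>Raising the threshold to at least 2 makes the scaling inequality at \<open>K0\<close> a
  doubling inequality, with constant \<open>D\<close>.\<close>

definition K0 :: real where "K0 = max 2 (snd pK)"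

lemma p: "1 \<le> p" "p < 2" and K0: "2 \<le> K0" and f_scale: "K0 \<le> K \<Longrightarrow> f (K * x) \<le> K powr p * f x"
proof -
  have "\<exists>q. 1 \<le> fst q \<and> fst q < 2 \<and> 0 \<le> snd q \<and> (\<forall>K\<ge>snd q. \<forall>x>0. f (K * x) \<le> K powr fst q * f x)"
    using F by (auto simp: condition_F_def)
  then have *: "1 \<le> fst pK \<and> fst pK < 2 \<and> 0 \<le> snd pK \<and> (\<forall>K\<ge>snd pK. \<forall>x>0. f (K * x) \<le> K powr fst pK * f x)"
    unfolding pK_def by (rule someI_ex)
  then show "1 \<le> p" "p < 2" "2 \<le> K0" by (auto simp: p_def K0_def)
  assume K: "K0 \<le> K"
  then have K': "snd pK \<le> K" "0 < K" by (auto simp: K0_def)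
  have a: "f (K * x) \<le> K powr p * f x" if "0 < x" for x
    using * K' that by (auto simp: p_def)
  show "f (K * x) \<le> K powr p * f x"
  proof (cases "x = 0")
    case False
    then have "f (K * \<bar>x\<bar>) \<le> K powr p * f \<bar>x\<bar>" by (intro a) auto
    moreover have "f (K * \<bar>x\<bar>) = f (K * x)" using f_abs[of "K * x"] K' by (simp add: abs_mult)
    ultimately show ?thesis by (simp add: f_abs)
  qed simp
qed

definition D :: real where "D = K0 powr p"

lemma D: "1 \<le> D" using K0 p by (simp add: D_def ge_one_powr_ge_zero)

lemma f_double: "f (2 * x) \<le> D * f x"
proof -
  have "f (2 * x) \<le> f (K0 * x)" using K0 by (intro f_mono) (simp add: abs_mult mult_right_mono)
  also have "\<dots> \<le> D * f x" unfolding D_def by (rule f_scale) simp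
  finally show ?thesis .
qed

lemma f_add: "f (x + y) \<le> D / 2 * (f x + f y)"
proof -
  have "2 * f (x + y) \<le> f ((x + y) + (x - y)) + f ((x + y) - (x - y))" by (rule convex_midpoint[OF f_convex])
  also have "\<dots> = f (2 * x) + f (2 * y)" by simp
  also have "\<dots> \<le> D * f x + D * f y" by (intro add_mono f_double)
  finally show ?thesis by (simp add: field_simps)
qed

lemma f_growth: "K0 \<le> \<bar>x\<bar> \<Longrightarrow> f x \<le> f 1 * \<bar>x\<bar> powr p"
  using f_scale[of "\<bar>x\<bar>" 1] by (simp add: f_abs mult.commute)

text \<open>As \<open>p < 2\<close>, the function is dominated by a quadratic one, so its integrals
  against normal laws are finite.\<close>

lemma f_quadratic: "f x \<le> f K0 + f 1 * x\<^sup>2"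
proof (cases "K0 \<le> \<bar>x\<bar>")
  case True
  then have "1 \<le> \<bar>x\<bar>" using K0 by simp
  then have "\<bar>x\<bar> powr p \<le> \<bar>x\<bar> powr 2" using p by (intro powr_mono) auto
  also have "\<dots> = x\<^sup>2" using \<open>1 \<le> \<bar>x\<bar>\<close> by (simp add: powr_numeral)
  finally have "f 1 * \<bar>x\<bar> powr p \<le> f 1 * x\<^sup>2" using f_nonneg by (intro mult_left_mono)
  then show ?thesis using f_growth[OF True] f_nonneg[of K0] by linarith
next
  case False
  then have "f x \<le> f K0" using K0 by (intro f_mono) auto
  moreover have "0 \<le> f 1 * x\<^sup>2" using f_nonneg by simp
  ultimately show ?thesis by linarith
qed

text \<open>Convexity with \<open>f 0 = 0\<close> and \<open>f 1 > 0\<close> forces at least linear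
  growth. This is the source of the first moment of \<open>X 1\<close>.\<close>

lemma f_linear: "\<bar>x\<bar> \<le> 1 + f x / f 1"
proof (cases "\<bar>x\<bar> \<le> 1")
  case True
  moreover have "0 \<le> f x / f 1" using f_nonneg by simp
  ultimately show ?thesis by linarith
next
  case False
  have "f ((1 - 1 / \<bar>x\<bar>) *\<^sub>R 0 + (1 / \<bar>x\<bar>) *\<^sub>R \<bar>x\<bar>) \<le> (1 - 1 / \<bar>x\<bar>) * f 0 + (1 / \<bar>x\<bar>) * f \<bar>x\<bar>"
    using False by (intro convex_onD[OF f_convex]) auto
  moreover have x0: "x \<noteq> 0" using False by auto
  ultimately have "f 1 \<le> f x / \<bar>x\<bar>" by (simp add: f_abs)
  moreover have "0 < \<bar>x\<bar>" using False by linarith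
  ultimately have "f 1 * \<bar>x\<bar> \<le> f x" by (simp add: pos_le_divide_eq)
  then have "\<bar>x\<bar> \<le> f x / f 1" using f_pos[of 1] by (simp add: pos_le_divide_eq mult.commute)
  then show ?thesis by linarith
qed

lemma f_gau_shift: "integrable (gau v) (\<lambda>x. f (x + c))"
proof (rule Bochner_Integration.integrable_bound)
  interpret n: real_distribution "gau v" by (rule real_distribution_gau)
  show "integrable (gau v) (\<lambda>x. D / 2 * (f K0 + f 1 * x\<^sup>2 + f c))"
    using gau_second(2) by (intro integrable_mult_right Bochner_Integration.integrable_add) auto
  show "AE x in gau v. norm (f (x + c)) \<le> norm (D / 2 * (f K0 + f 1 * x\<^sup>2 + f c))"
  proof (rule AE_I2)
    fix x
    have "f (x + c) \<le> D / 2 * (f x + f c)" by (rule f_add)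
    also have "\<dots> \<le> D / 2 * (f K0 + f 1 * x\<^sup>2 + f c)" using f_quadratic[of x] D by (intro mult_left_mono) auto
    finally show "norm (f (x + c)) \<le> norm (D / 2 * (f K0 + f 1 * x\<^sup>2 + f c))" using f_nonneg[of "x + c"] by simp
  qed
  show "(\<lambda>x. f (x + c)) \<in> borel_measurable (gau v)" by (simp add: gau_def)
qed

lemma f_gau: "integrable (gau v) f"
  using f_gau_shift[of v 0] by simp

lemma f_shift_integrable:
  assumes "real_distribution \<alpha>" "integrable \<alpha> f"
  shows "integrable \<alpha> (\<lambda>y. f (y + c))"
proof (rule Bochner_Integration.integrable_bound)
  interpret a: real_distribution \<alpha> by fact
  show "integrable \<alpha> (\<lambda>x. D / 2 * (f x + f c))" using assms by auto
  show "AE x in \<alpha>. norm (f (x + c)) \<le> norm (D / 2 * (f x + f c))"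
    using f_add[of _ c] f_nonneg D by (intro AE_I2) auto
  show "(\<lambda>y. f (y + c)) \<in> borel_measurable \<alpha>"
    by (subst measurable_cong_sets[OF a.events_eq_borel refl]) measurable
qed

lemma gau_f_strict_mono:
  assumes "0 \<le> v" "v < w"
  shows "(\<integral>x. f x \<partial>gau v) < (\<integral>x. f x \<partial>gau w)"
proof -
  have i: "integrable std_normal_distribution (\<lambda>z. f (sqrt u * z))" for u
    using f_gau[of u] by (subst (asm) integrable_gau_iff) auto
  interpret s: real_distribution std_normal_distribution by (rule real_dist_normal_dist)
  have lt: "f (sqrt v * z) < f (sqrt w * z)" if "z \<noteq> 0" for z
    using that assms by (intro f_strict') (simp add: abs_mult)
  have le: "f (sqrt v * z) \<le> f (sqrt w * z)" for z
    using lt[of z] by (cases "z = 0") auto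
  have "(\<integral>z. f (sqrt v * z) \<partial>std_normal_distribution) < (\<integral>z. f (sqrt w * z) \<partial>std_normal_distribution)"
  proof (rule s.integral_less_AE[OF i i, where A = "- {0}"])
    have "AE z in lborel. z \<noteq> (0::real)" by (rule AE_lborel_singleton)
    then have z: "AE z in std_normal_distribution. z \<noteq> (0::real)"
      by (subst AE_density) (auto elim: eventually_mono)
    show "emeasure std_normal_distribution (- {0}) \<noteq> 0"
    proof -
      have "emeasure std_normal_distribution (- {0}) = emeasure std_normal_distribution (space std_normal_distribution)"
        by (rule emeasure_eq_AE) (use z in \<open>auto elim: eventually_mono\<close>)
      then show ?thesis using s.emeasure_space_1 by simp
    qed
    show "AE z in std_normal_distribution. z \<in> - {0} \<longrightarrow> f (sqrt v * z) \<noteq> f (sqrt w * z)"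
      using lt by (intro AE_I2) (auto simp: less_le)
    show "AE z in std_normal_distribution. f (sqrt v * z) \<le> f (sqrt w * z)" using le by (intro AE_I2) auto
  qed simp
  then show ?thesis by (simp add: integral_gau)
qed

lemma gau_f_mono: "0 \<le> v \<Longrightarrow> v \<le> w \<Longrightarrow> (\<integral>x. f x \<partial>gau v) \<le> (\<integral>x. f x \<partial>gau w)"
  using gau_f_strict_mono[of v w] by (cases "v = w") auto

end

section \<open>The \<open>f\<close>-moment of large increments\<close>

locale f_hemigroup = centred_hemigroup \<mu> + growth_function f
  for \<mu> :: "real \<Rightarrow> real \<Rightarrow> real measure" and f :: "real \<Rightarrow> real" +
  fixes m :: "real \<Rightarrow> real"
  assumes f_int: "integrable (\<mu> 0 1) (\<lambda>y. f (y + m 1))"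
begin

lemma f_integrable:
  assumes st: "0 \<le> s" "s \<le> t" "t \<le> 1"
  shows "integrable (\<mu> s t) f"
proof -
  interpret r: real_distribution "\<mu> 0 1" by (rule law) auto
  have 01: "integrable (\<mu> 0 1) f"
  proof (rule Bochner_Integration.integrable_bound)
    show "integrable (\<mu> 0 1) (\<lambda>y. D / 2 * (f (y + m 1) + f (- m 1)))" using f_int by auto
    show "AE y in \<mu> 0 1. norm (f y) \<le> norm (D / 2 * (f (y + m 1) + f (- m 1)))"
    proof (rule AE_I2)
      fix y show "norm (f y) \<le> norm (D / 2 * (f (y + m 1) + f (- m 1)))"
        using f_add[of "y + m 1" "- m 1"] f_nonneg D by simp
    qed
  qed simp
  have 0: "integrable (\<mu> 0 t) f" if t: "0 \<le> t" "t \<le> 1" for t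
    using convolution_convex_integrable_left[OF law law mom mean f_convex f_nonneg, of 0 t t 1] 01 conv[of 0 t 1] t by simp
  \<comment> \<open>Commuted so that the wanted law becomes the left factor, the one to which
    Jensen's inequality gives access.\<close>
  have "\<mu> 0 t = (\<mu> s t \<star> \<mu> 0 s)"
    using conv[of 0 s t] convolution_commute[OF law law, of 0 s s t] st by simp
  then show ?thesis
    using convolution_convex_integrable_left[OF law law mom mean f_convex f_nonneg, of s t 0 s] 0[of t] st by simp
qed

text \<open>By Markov's inequality a variable with law \<open>\<mu> 0 s\<close> stays in
  \<open>[-R, R]\<close> with probability at least one half, for every \<open>s\<close>.\<close>

definition R :: real where "R = 2 * (\<integral>x. \<bar>x\<bar> \<partial>\<mu> 0 1) + 1"
text \<open>Chosen so that the gain of \<open>tail_const * smooth_abs\<close> is at least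
  \<open>3 * (f (R + 1) * \<bar>y\<bar>)\<close> whenever \<open>\<bar>x\<bar> \<le> R\<close> and
  \<open>1 < \<bar>y\<bar>\<close>; there \<open>soft_sq y\<close> is at least
  \<open>\<bar>y\<bar> / 2\<close>.\<close>

definition tail_const :: real where "tail_const = 12 * f (R + 1) * (1 + R) ^ 3"
definition growth_moment :: "real \<Rightarrow> real" where "growth_moment t = (\<integral>x. f x + tail_const * smooth_abs x \<partial>\<mu> 0 t)"
definition J :: "real \<Rightarrow> real \<Rightarrow> real" where "J s t = (\<integral>y. (if 1 < \<bar>y\<bar> then f y else 0) \<partial>\<mu> s t)"

lemma R_ge: "1 \<le> R"
proof -
  have "0 \<le> (\<integral>x. \<bar>x\<bar> \<partial>\<mu> 0 1)" by (rule Bochner_Integration.integral_nonneg) auto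
  then show ?thesis by (simp add: R_def)
qed

lemma tail_const_nonneg: "0 \<le> tail_const" using R_ge f_nonneg by (simp add: tail_const_def)

text \<open>For large \<open>y\<close> the gain of \<open>f\<close> over its tangent at
  \<open>x\<close> has the order of \<open>f y\<close>, up to an error linear in
  \<open>\<bar>y\<bar>\<close>. The gain of \<open>smooth_abs\<close>, which is linear there,
  absorbs that error; the restriction to \<open>\<bar>x\<bar> \<le> R\<close> keeps the slope
  \<open>d\<close> bounded.\<close>

lemma f_gain:
  assumes d: "\<And>y. f x + d * (y - x) \<le> f y"
  shows "(if \<bar>x\<bar> \<le> R then 2 / D * (if 1 < \<bar>y\<bar> then f y else 0) else 0)
     \<le> f (x + y) - f x - d * y + tail_const * (smooth_abs (x + y) - smooth_abs x - x / smooth_abs x * y)"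
proof -
  define g1 where "g1 = f (x + y) - f x - d * y"
  define g2 where "g2 = smooth_abs (x + y) - smooth_abs x - x / smooth_abs x * y"
  have g1: "0 \<le> g1" using d[of "x + y"] by (simp add: g1_def)
  have om2: "soft_sq y / (2 * (1 + \<bar>x\<bar>) ^ 3) \<le> g2" unfolding g2_def by (rule smooth_abs_gain)
  have "0 \<le> soft_sq y / (2 * (1 + \<bar>x\<bar>) ^ 3)" using soft_sq_nonneg[of y] by simp
  then have g2: "0 \<le> g2" using om2 by linarith
  have "(if \<bar>x\<bar> \<le> R then 2 / D * (if 1 < \<bar>y\<bar> then f y else 0) else 0) \<le> g1 + tail_const * g2"
  proof (cases "\<bar>x\<bar> \<le> R \<and> 1 < \<bar>y\<bar>")
    case True
    then have x: "\<bar>x\<bar> \<le> R" and y: "1 < \<bar>y\<bar>" by auto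
    have "f y \<le> D / 2 * (f (x + y) + f x)" using f_add[of "x + y" "- x"] by (simp add: f_sym)
    then have 1: "2 / D * f y \<le> f (x + y) + f x" using D by (simp add: field_simps)
    have fx: "f x \<le> f (R + 1)" using x by (intro f_mono) auto
    have "d \<le> f (x + 1)" "- d \<le> f (x - 1)" using d[of "x + 1"] d[of "x - 1"] f_nonneg[of x] by auto
    moreover have "f (x + 1) \<le> f (R + 1)" "f (x - 1) \<le> f (R + 1)" using x by (auto intro!: f_mono)
    ultimately have "\<bar>d\<bar> \<le> f (R + 1)" by linarith
    then have "\<bar>d\<bar> * \<bar>y\<bar> \<le> f (R + 1) * \<bar>y\<bar>" by (intro mult_right_mono) auto
    then have dy: "d * y \<le> f (R + 1) * \<bar>y\<bar>" by (simp flip: abs_mult)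
    have "f (R + 1) * 1 \<le> f (R + 1) * \<bar>y\<bar>" using y f_nonneg by (intro mult_left_mono) auto
    then have 2: "2 / D * f y - 3 * (f (R + 1) * \<bar>y\<bar>) \<le> g1" using 1 fx dy by (simp add: g1_def)
    have "\<bar>y\<bar> / 2 \<le> soft_sq y"
    proof -
      have "\<bar>y\<bar> * (1 + \<bar>y\<bar>) \<le> \<bar>y\<bar> * (2 * \<bar>y\<bar>)" using y by (intro mult_left_mono) auto
      then have "\<bar>y\<bar> * (1 + \<bar>y\<bar>) \<le> 2 * y\<^sup>2" by (simp add: power2_eq_square abs_mult_self_eq mult.left_commute)
      moreover have "0 < 1 + \<bar>y\<bar>" by simp
      ultimately show ?thesis unfolding soft_sq_def by (simp add: pos_le_divide_eq)
    qed
    then have "tail_const * (\<bar>y\<bar> / 2 / (2 * (1 + R) ^ 3)) \<le> tail_const * (soft_sq y / (2 * (1 + R) ^ 3))"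
      using tail_const_nonneg R_ge by (intro mult_left_mono divide_right_mono) auto
    also have "\<dots> \<le> tail_const * (soft_sq y / (2 * (1 + \<bar>x\<bar>) ^ 3))"
      using x tail_const_nonneg soft_sq_nonneg[of y]
      by (intro mult_left_mono divide_left_mono mult_left_mono power_mono mult_pos_pos zero_less_power) auto
    also have "\<dots> \<le> tail_const * g2" using om2 tail_const_nonneg by (intro mult_left_mono)
    finally have "tail_const * (\<bar>y\<bar> / 2 / (2 * (1 + R) ^ 3)) \<le> tail_const * g2" .
    moreover have "tail_const * (\<bar>y\<bar> / 2 / (2 * (1 + R) ^ 3)) = 3 * (f (R + 1) * \<bar>y\<bar>)"
      using R_ge by (simp add: tail_const_def)
    ultimately show ?thesis using 2 True by simp
  next
    case False
    then show ?thesis using g1 g2 tail_const_nonneg by auto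
  qed
  then show ?thesis by (simp add: g1_def g2_def)
qed

text \<open>The counterpart of \<open>soft_sq_increment\<close> for the \<open>f\<close>-moment of
  increments larger than 1. Almost everywhere it makes \<open>J s (s + h)\<close> of order
  \<open>h\<close>, the second ingredient of uniform integrability.\<close>

lemma J_increment:
  assumes st: "0 \<le> s" "s \<le> t" "t \<le> 1"
  shows "J s t \<le> D * (growth_moment t - growth_moment s)"
proof -
  interpret p0: real_distribution "\<mu> 0 s" using st law by simp
  interpret r: real_distribution "\<mu> s t" using st law by simp
  have sq: "integrable (\<mu> u v) smooth_abs" if "0 \<le> u" "u \<le> v" "v \<le> 1" for u v
    by (rule integrable_lin[where A=1 and B=1]; use that smooth_abs_le smooth_abs_pos in \<open>auto simp: less_imp_le abs_of_pos\<close>)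
  have sh: "integrable (\<mu> s t) (\<lambda>y. smooth_abs (x + y))" for x
  proof (rule integrable_lin[where A="1+\<bar>x\<bar>" and B=1])
    fix y show "\<bar>smooth_abs (x + y)\<bar> \<le> 1 + \<bar>x\<bar> + 1 * \<bar>y\<bar>" using smooth_abs_le[of "x+y"] smooth_abs_pos[of "x+y"] by auto
  qed (use st in auto)
  have fi: "integrable (\<mu> s t) (\<lambda>y. f (x + y))" for x
    using f_shift_integrable[OF law f_integrable, of s t x] st by (simp add: add.commute)
  have Ji: "integrable (\<mu> s t) (\<lambda>y. if 1 < \<bar>y\<bar> then f y else 0)"
    by (rule Bochner_Integration.integrable_bound[OF f_integrable[OF st]]) (auto simp: f_nonneg)
  have J0: "0 \<le> J s t" unfolding J_def by (rule Bochner_Integration.integral_nonneg) (simp add: f_nonneg)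
  have inner: "(if \<bar>x\<bar> \<le> R then 2 / D * J s t else 0) + (f x + tail_const * smooth_abs x) \<le> (\<integral>y. f (x + y) + tail_const * smooth_abs (x + y) \<partial>\<mu> s t)" for x
  proof -
    obtain d where d: "\<And>y. f x + d * (y - x) \<le> f y" using convex_subgradient[OF f_convex] by blast
    have "(if \<bar>x\<bar> \<le> R then 2 / D * J s t else 0) = (\<integral>y. (if \<bar>x\<bar> \<le> R then 2 / D * (if 1 < \<bar>y\<bar> then f y else 0) else 0) \<partial>\<mu> s t)"
      using Ji by (simp add: J_def)
    also have "\<dots> \<le> (\<integral>y. f (x + y) - f x - d * y + tail_const * (smooth_abs (x + y) - smooth_abs x - x / smooth_abs x * y) \<partial>\<mu> s t)"
    proof (intro integral_mono f_gain[OF d])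
      show "integrable (\<mu> s t) (\<lambda>y. if \<bar>x\<bar> \<le> R then 2 / D * (if 1 < \<bar>y\<bar> then f y else 0) else 0)"
        using Ji by (cases "\<bar>x\<bar> \<le> R") auto
      show "integrable (\<mu> s t) (\<lambda>y. f (x + y) - f x - d * y + tail_const * (smooth_abs (x + y) - smooth_abs x - x / smooth_abs x * y))"
        using fi sh mom[OF st] by (intro Bochner_Integration.integrable_add Bochner_Integration.integrable_diff integrable_mult_right) auto
    qed
    also have "\<dots> = (\<integral>y. f (x + y) \<partial>\<mu> s t) - f x + tail_const * ((\<integral>y. smooth_abs (x + y) \<partial>\<mu> s t) - smooth_abs x)"
      using fi sh mom[OF st] mean[OF st] by simp
    finally have "(if \<bar>x\<bar> \<le> R then 2 / D * J s t else 0) \<le> (\<integral>y. f (x + y) \<partial>\<mu> s t) - f x + tail_const * ((\<integral>y. smooth_abs (x + y) \<partial>\<mu> s t) - smooth_abs x)" .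
    moreover have "(\<integral>y. f (x + y) + tail_const * smooth_abs (x + y) \<partial>\<mu> s t) = (\<integral>y. f (x + y) \<partial>\<mu> s t) + tail_const * (\<integral>y. smooth_abs (x + y) \<partial>\<mu> s t)"
      using fi sh by simp
    ultimately show ?thesis unfolding right_diff_distrib by argo
  qed
  have i0: "integrable (\<mu> 0 u) (\<lambda>x. f x + tail_const * smooth_abs x)" if "0 \<le> u" "u \<le> 1" for u
    using f_integrable[of 0 u] sq[of 0 u] that by auto
  have indI: "integrable (\<mu> 0 s) (\<lambda>x. if \<bar>x\<bar> \<le> R then 2 / D * J s t else 0)"
    by (rule p0.integrable_const_bound[where B="\<bar>2 / D * J s t\<bar>"]) auto
  have absI: "integrable (\<mu> 0 s) (\<lambda>x. \<bar>x\<bar>)" using mom[of 0 s] st by simp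
  have linI: "integrable (\<mu> 0 s) (\<lambda>x. 2 / D * J s t * (1 - \<bar>x\<bar> / R))"
    using absI by (intro integrable_mult_right Bochner_Integration.integrable_diff integrable_divide) auto
  have ind: "(\<integral>x. (if \<bar>x\<bar> \<le> R then 2 / D * J s t else 0) \<partial>\<mu> 0 s) \<ge> J s t / D"
  proof -
    \<comment> \<open>\<open>1 - \<bar>x\<bar> / R\<close> lies below the indicator of
      \<open>\<bar>x\<bar> \<le> R\<close> and has mean at least one half.\<close>
    have "2 / D * J s t * (1 - \<bar>x\<bar> / R) \<le> (if \<bar>x\<bar> \<le> R then 2 / D * J s t else 0)" for x
    proof (cases "\<bar>x\<bar> \<le> R")
      case True
      have "0 \<le> \<bar>x\<bar> / R" using R_ge by simp
      then have "2 / D * J s t * (1 - \<bar>x\<bar> / R) \<le> 2 / D * J s t * 1" using J0 D by (intro mult_left_mono) auto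
      then show ?thesis using True by simp
    next
      case False
      then have "1 - \<bar>x\<bar> / R \<le> 0" using R_ge by simp
      then have "2 / D * J s t * (1 - \<bar>x\<bar> / R) \<le> 0" using J0 D by (intro mult_nonneg_nonpos) auto
      then show ?thesis using False by simp
    qed
    then have 1: "(\<integral>x. 2 / D * J s t * (1 - \<bar>x\<bar> / R) \<partial>\<mu> 0 s) \<le> (\<integral>x. (if \<bar>x\<bar> \<le> R then 2 / D * J s t else 0) \<partial>\<mu> 0 s)"
      by (intro integral_mono linI indI)
    have "2 * (\<integral>x. \<bar>x\<bar> \<partial>\<mu> 0 s) \<le> R" using abs_moment_le[of s] st by (simp add: R_def)
    then have "(\<integral>x. \<bar>x\<bar> \<partial>\<mu> 0 s) / R \<le> 1 / 2" using R_ge by (simp add: divide_le_eq)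
    then have h: "1 / 2 \<le> 1 - (\<integral>x. \<bar>x\<bar> \<partial>\<mu> 0 s) / R" by linarith
    have E: "(\<integral>x. 1 - \<bar>x\<bar> / R \<partial>\<mu> 0 s) = 1 - (\<integral>x. \<bar>x\<bar> \<partial>\<mu> 0 s) / R" using absI by simp
    have "J s t / D = 2 / D * J s t * (1 / 2)" by simp
    also have "\<dots> \<le> 2 / D * J s t * (1 - (\<integral>x. \<bar>x\<bar> \<partial>\<mu> 0 s) / R)" using J0 D h by (intro mult_left_mono) auto
    also have "\<dots> = (\<integral>x. 2 / D * J s t * (1 - \<bar>x\<bar> / R) \<partial>\<mu> 0 s)" unfolding integral_mult_right_zero E ..
    finally show ?thesis using 1 by linarith
  qed
  have "J s t / D + growth_moment s \<le> (\<integral>x. (if \<bar>x\<bar> \<le> R then 2 / D * J s t else 0) + (f x + tail_const * smooth_abs x) \<partial>\<mu> 0 s)"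
    unfolding Bochner_Integration.integral_add[OF indI i0[OF st(1) order_trans[OF st(2,3)]]] growth_moment_def[symmetric]
    using ind by simp
  also have "\<dots> \<le> (\<integral>x. \<integral>y. f (x + y) + tail_const * smooth_abs (x + y) \<partial>\<mu> s t \<partial>\<mu> 0 s)"
  proof (intro integral_mono inner Bochner_Integration.integrable_add[OF indI])
    show "integrable (\<mu> 0 s) (\<lambda>x. f x + tail_const * smooth_abs x)" by (rule i0) (use st in auto)
    show "integrable (\<mu> 0 s) (\<lambda>x. \<integral>y. f (x + y) + tail_const * smooth_abs (x + y) \<partial>\<mu> s t)"
      by (rule integral_conv(1)) (use st i0[of t] in auto)
  qed
  also have "\<dots> = growth_moment t"
    unfolding growth_moment_def using i0[of t] st by (intro integral_conv(2)[symmetric]) auto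
  finally show ?thesis using D by (simp add: field_simps)
qed

lemma growth_moment_mono: "0 \<le> s \<Longrightarrow> s \<le> t \<Longrightarrow> t \<le> 1 \<Longrightarrow> growth_moment s \<le> growth_moment t"
proof -
  assume st: "0 \<le> s" "s \<le> t" "t \<le> 1"
  have "0 \<le> J s t" unfolding J_def by (rule Bochner_Integration.integral_nonneg) (simp add: f_nonneg)
  then have "0 \<le> D * (growth_moment t - growth_moment s)" using J_increment[OF st] by linarith
  then show ?thesis using D by (simp add: zero_le_mult_iff)
qed

end

section \<open>Tails and limits of scaled increments\<close>

context f_hemigroup
begin

lemma scaled_integrable:
  assumes st: "0 \<le> s" "s \<le> t" "t \<le> 1" and h: "0 < h"
  shows "integrable (\<mu> s t) (\<lambda>y. f ((y + c) / sqrt h))"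
proof -
  interpret r: real_distribution "\<mu> s t" using law st by simp
  define K where "K = max K0 (1 / sqrt h)"
  have K: "K0 \<le> K" "1 / sqrt h \<le> K" "0 \<le> 1 / sqrt h" using h by (auto simp: K_def)
  have le: "f ((y + c) / sqrt h) \<le> K powr p * f (y + c)" for y
  proof -
    have "f ((y + c) / sqrt h) \<le> f (K * (y + c))"
    proof (rule f_mono)
      have "\<bar>(y + c) / sqrt h\<bar> = 1 / sqrt h * \<bar>y + c\<bar>" using h by (simp add: abs_divide)
      also have "\<dots> \<le> \<bar>K\<bar> * \<bar>y + c\<bar>" using K by (intro mult_right_mono) auto
      finally show "\<bar>(y + c) / sqrt h\<bar> \<le> \<bar>K * (y + c)\<bar>" by (simp add: abs_mult)
    qed
    also have "\<dots> \<le> K powr p * f (y + c)" by (rule f_scale[OF K(1)])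
    finally show ?thesis .
  qed
  show ?thesis
  proof (rule Bochner_Integration.integrable_bound)
    show "integrable (\<mu> s t) (\<lambda>y. K powr p * f (y + c))"
      by (intro integrable_mult_right f_shift_integrable law f_integrable st)
    show "AE y in \<mu> s t. norm (f ((y + c) / sqrt h)) \<le> norm (K powr p * f (y + c))"
      using le f_nonneg by (intro AE_I2) simp
    show "(\<lambda>y. f ((y + c) / sqrt h)) \<in> borel_measurable (\<mu> s t)"
      by (subst measurable_cong_sets[OF r.events_eq_borel refl]) measurable
  qed
qed

text \<open>Here \<open>p < 2\<close> enters twice. For \<open>\<bar>y\<bar> \<le> 1\<close> the
  growth condition gives a multiple of \<open>z powr p\<close>, which is
  \<open>z\<^sup>2 * z powr (p - 2)\<close> for the scaled value \<open>z\<close>; the last factor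
  is small for large \<open>r\<close>, and the square is the truncated variance. For
  \<open>\<bar>y\<bar> > 1\<close> removing the scaling costs \<open>(1 / sqrt h) powr p\<close>;
  against \<open>J\<close> of order \<open>h\<close> this leaves \<open>h powr (1 - p / 2)\<close>,
  which tends to 0.\<close>

lemma tail_bound:
  assumes s: "0 \<le> s" and h: "0 < h" "s + h \<le> 1" "K0 \<le> 1 / sqrt h" and c: "\<bar>c\<bar> \<le> sqrt h" and r: "2 * K0 \<le> r"
  shows "(\<integral>y. (if r < \<bar>(y + c) / sqrt h\<bar> then f ((y + c) / sqrt h) else 0) \<partial>\<mu> s (s + h))
     \<le> D * (f 1 * (r / 2) powr (p - 2) * (trunc_var 1 s (s + h) / h) + (1 / sqrt h) powr p * J s (s + h))"
proof -
  have st: "0 \<le> s" "s \<le> s + h" "s + h \<le> 1" using s h by auto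
  interpret r: real_distribution "\<mu> s (s + h)" using law st by simp
  have sh: "0 < sqrt h" using h by simp
  have r4: "4 \<le> r" using K0 r by linarith
  define A where "A = f 1 * (r / 2) powr (p - 2)"
  define B where "B = (1 / sqrt h) powr p"
  have A0: "0 \<le> A" and B0: "0 \<le> B" by (auto simp: A_def B_def f_nonneg)
  have pt: "(if r < \<bar>(y + c) / sqrt h\<bar> then f ((y + c) / sqrt h) else 0)
     \<le> D * (A * (min (y\<^sup>2) (1\<^sup>2) / h) + B * (if 1 < \<bar>y\<bar> then f y else 0))" for y
  proof (cases "r < \<bar>(y + c) / sqrt h\<bar>")
    case True
    then have "r * sqrt h < \<bar>y + c\<bar>" using sh by (simp add: abs_divide pos_less_divide_eq)
    then have y1: "r * sqrt h < \<bar>y\<bar> + sqrt h" using c by linarith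
    have "r / 2 * sqrt h \<le> (r - 1) * sqrt h" using r4 sh by (intro mult_right_mono) auto
    also have "\<dots> = r * sqrt h - sqrt h" by (simp add: left_diff_distrib)
    finally have y2: "r / 2 * sqrt h < \<bar>y\<bar>" using y1 by linarith
    have "1 * sqrt h \<le> r / 2 * sqrt h" using r4 sh by (intro mult_right_mono) auto
    then have yc: "\<bar>y + c\<bar> \<le> 2 * \<bar>y\<bar>" using y2 c by linarith
    define z where "z = \<bar>y\<bar> / sqrt h"
    have z: "r / 2 < z" using y2 sh by (simp add: z_def pos_less_divide_eq)
    have z0: "0 < z" using z r4 by linarith
    have "f ((y + c) / sqrt h) \<le> f (2 * (y / sqrt h))"
      using yc sh by (intro f_mono) (simp add: abs_divide abs_mult divide_right_mono)
    also have "\<dots> \<le> D * f (y / sqrt h)" by (rule f_double)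
    also have "f (y / sqrt h) = f z" using f_abs[of "y / sqrt h"] sh by (simp add: z_def abs_divide)
    finally have 1: "f ((y + c) / sqrt h) \<le> D * f z" .
    have "f z \<le> A * (min (y\<^sup>2) (1\<^sup>2) / h) + B * (if 1 < \<bar>y\<bar> then f y else 0)"
    proof (cases "1 < \<bar>y\<bar>")
      case True
      have "f z \<le> B * f \<bar>y\<bar>" unfolding z_def B_def using f_scale[OF h(3), of "\<bar>y\<bar>"] by simp
      moreover have "0 \<le> A * (min (y\<^sup>2) (1\<^sup>2) / h)" using A0 h by simp
      ultimately show ?thesis using True by (simp add: f_abs)
    next
      case False
      have "K0 \<le> \<bar>z\<bar>" using z r by linarith
      then have "f z \<le> f 1 * z powr p" using f_growth[of z] z0 by simp
      also have "z powr p = z powr 2 * z powr (p - 2)" by (simp flip: powr_add)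
      also have "z powr 2 = y\<^sup>2 / h" using z0 h by (simp add: powr_numeral z_def power_divide)
      also have "f 1 * (y\<^sup>2 / h * z powr (p - 2)) \<le> f 1 * (y\<^sup>2 / h * (r / 2) powr (p - 2))"
        using z r4 p h f_nonneg by (intro mult_left_mono powr_mono2') auto
      also have "\<dots> = A * (y\<^sup>2 / h)" by (simp add: A_def)
      also have "y\<^sup>2 = min (y\<^sup>2) (1\<^sup>2)" using False by (simp add: abs_square_le_1)
      finally show ?thesis using False by simp
    qed
    then have "D * f z \<le> D * (A * (min (y\<^sup>2) (1\<^sup>2) / h) + B * (if 1 < \<bar>y\<bar> then f y else 0))"
      using D by (intro mult_left_mono) auto
    then show ?thesis using 1 True by simp
  next
    case False
    have "0 \<le> A * (min (y\<^sup>2) (1\<^sup>2) / h)" using A0 h by simp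
    moreover have "0 \<le> B * (if 1 < \<bar>y\<bar> then f y else 0)" using B0 f_nonneg by simp
    ultimately have "0 \<le> D * (A * (min (y\<^sup>2) (1\<^sup>2) / h) + B * (if 1 < \<bar>y\<bar> then f y else 0))"
      using D by (intro mult_nonneg_nonneg[OF _ add_nonneg_nonneg]) auto
    then show ?thesis using False by simp
  qed
  have i1: "integrable (\<mu> s (s + h)) (\<lambda>y. min (y\<^sup>2) (1\<^sup>2))" by (rule trunc_var_integrable[OF st])
  have i2: "integrable (\<mu> s (s + h)) (\<lambda>y. if 1 < \<bar>y\<bar> then f y else 0)"
    by (rule Bochner_Integration.integrable_bound[OF f_integrable[OF st]]) (auto simp: f_nonneg)
  have i3: "integrable (\<mu> s (s + h)) (\<lambda>y. if r < \<bar>(y + c) / sqrt h\<bar> then f ((y + c) / sqrt h) else 0)"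
  proof (rule Bochner_Integration.integrable_bound[OF scaled_integrable[OF st h(1), of c]])
    show "(\<lambda>y. if r < \<bar>(y + c) / sqrt h\<bar> then f ((y + c) / sqrt h) else 0) \<in> borel_measurable (\<mu> s (s + h))"
      by (subst measurable_cong_sets[OF r.events_eq_borel refl]) measurable
  qed (auto simp: f_nonneg)
  have "(\<integral>y. (if r < \<bar>(y + c) / sqrt h\<bar> then f ((y + c) / sqrt h) else 0) \<partial>\<mu> s (s + h))
     \<le> (\<integral>y. D * (A * (min (y\<^sup>2) (1\<^sup>2) / h) + B * (if 1 < \<bar>y\<bar> then f y else 0)) \<partial>\<mu> s (s + h))"
    by (intro integral_mono pt i3 integrable_mult_right Bochner_Integration.integrable_add integrable_divide i1 i2)
  also have "\<dots> = D * (A * (trunc_var 1 s (s + h) / h) + B * J s (s + h))"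
  proof -
    have "(\<integral>y. A * (min (y\<^sup>2) (1\<^sup>2) / h) + B * (if 1 < \<bar>y\<bar> then f y else 0) \<partial>\<mu> s (s + h))
       = (\<integral>y. A * (min (y\<^sup>2) (1\<^sup>2) / h) \<partial>\<mu> s (s + h)) + (\<integral>y. B * (if 1 < \<bar>y\<bar> then f y else 0) \<partial>\<mu> s (s + h))"
      by (intro Bochner_Integration.integral_add integrable_mult_right integrable_divide i1 i2)
    then show ?thesis
      unfolding integral_mult_right_zero integral_divide_zero trunc_var_def J_def by simp
  qed
  finally show ?thesis unfolding A_def B_def .
qed

text \<open>Asymptotic normality becomes weak convergence by Levy's continuity theorem, the drift
  contributing a factor that tends to 1. Weak convergence handles a bounded truncation of
  \<open>f\<close>, and \<open>tail_bound\<close> the remainder. An upper bound is enough, since it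
  will be confronted with the hypothesis on the lower limit.\<close>

lemma scaled_limit:
  fixes h c :: "nat \<Rightarrow> real"
  assumes s: "0 \<le> s" and h: "\<And>n. 0 < h n" "\<And>n. s + h n \<le> 1" "h \<longlonglongrightarrow> 0"
    and c: "(\<lambda>n. c n / sqrt (h n)) \<longlonglongrightarrow> 0" and clt: "clt_at s"
    and g: "(\<lambda>n. gauss_var s (s + h n) / h n) \<longlonglongrightarrow> g"
    and C: "\<And>n. smooth_moment (s + h n) - smooth_moment s \<le> C * h n" "\<And>n. growth_moment (s + h n) - growth_moment s \<le> C * h n"
    and \<epsilon>: "0 < \<epsilon>"
  shows "eventually (\<lambda>n. (\<integral>y. f ((y + c n) / sqrt (h n)) \<partial>\<mu> s (s + h n)) \<le> (\<integral>x. f x \<partial>gau g) + \<epsilon>) sequentially"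
proof -
  have st: "0 \<le> s" "s \<le> s + h n" "s + h n \<le> 1" for n using s h(1)[of n] h(2)[of n] by auto
  have sh: "0 < sqrt (h n)" for n using h(1)[of n] by simp
  have g0: "0 \<le> g"
    by (rule LIMSEQ_le_const[OF g]) (use gauss_var_nonneg[OF st] h(1) in \<open>auto intro!: divide_nonneg_pos\<close>)
  define \<nu> where "\<nu> n = distr (\<mu> s (s + h n)) borel (\<lambda>y. (y + c n) / sqrt (h n))" for n
  have mu: "real_distribution (\<mu> s (s + h n))" for n by (rule law[OF st])
  have meas: "(\<lambda>y. (y + c n) / sqrt (h n)) \<in> borel_measurable (\<mu> s (s + h n))" for n
    by (subst measurable_cong_sets[OF real_distribution.events_eq_borel[OF mu] refl]) measurable
  have nu: "real_distribution (\<nu> n)" for n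
    unfolding \<nu>_def using meas prob_space.real_distribution_distr[OF real_distribution.axioms(1)[OF mu]] by blast
  have chr: "char (\<nu> n) v = iexp (v * (c n / sqrt (h n))) * char (\<mu> s (s + h n)) (v / sqrt (h n))" for n v
  proof -
    have "char (\<nu> n) v = (\<integral>y. iexp (v * ((y + c n) / sqrt (h n))) \<partial>\<mu> s (s + h n))"
      unfolding char_def \<nu>_def by (rule integral_distr[OF meas]) simp
    also have "\<dots> = (\<integral>y. iexp (v * (c n / sqrt (h n))) * iexp (v / sqrt (h n) * y) \<partial>\<mu> s (s + h n))"
    proof (rule Bochner_Integration.integral_cong[OF refl])
      fix y
      have "v * ((y + c n) / sqrt (h n)) = v * (c n / sqrt (h n)) + v / sqrt (h n) * y"
        by (simp add: add_divide_distrib distrib_left)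
      then show "iexp (v * ((y + c n) / sqrt (h n))) = iexp (v * (c n / sqrt (h n))) * iexp (v / sqrt (h n) * y)"
        by (simp only: of_real_add distrib_left exp_add)
    qed
    also have "\<dots> = iexp (v * (c n / sqrt (h n))) * char (\<mu> s (s + h n)) (v / sqrt (h n))"
      unfolding char_def by (rule integral_mult_right_zero)
    finally show ?thesis .
  qed
  have lim_mu: "(\<lambda>n. char (\<mu> s (s + h n)) (v / sqrt (h n))) \<longlonglongrightarrow> complex_of_real (exp (- (g * v\<^sup>2 / 2)))" for v
  proof -
    have "(\<lambda>n. char (\<mu> s (s + h n)) (v / sqrt (h n)) - exp (- (v\<^sup>2 * (gauss_var s (s + h n) / h n) / 2))) \<longlonglongrightarrow> 0"
    proof (rule tendstoI)
      fix d :: real assume "0 < d"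
      then have "0 < d / 2" by simp
      from clt[unfolded clt_at_def, rule_format, OF this, of v]
      obtain \<delta> where \<delta>: "0 < \<delta>" "\<forall>h. 0 < h \<and> h < \<delta> \<and> s + h \<le> 1 \<longrightarrow>
         cmod (char (\<mu> s (s + h)) (v / sqrt h) - exp (- (v\<^sup>2 * (gauss_var s (s + h) / h) / 2))) \<le> d / 2"
        by (elim exE conjE) (rule that)
      have "eventually (\<lambda>n. h n < \<delta>) sequentially" using order_tendstoD(2)[OF h(3) \<delta>(1)] .
      then show "eventually (\<lambda>n. dist (char (\<mu> s (s + h n)) (v / sqrt (h n)) - exp (- (v\<^sup>2 * (gauss_var s (s + h n) / h n) / 2))) 0 < d) sequentially"
      proof eventually_elim
        case (elim n)
        have "cmod (char (\<mu> s (s + h n)) (v / sqrt (h n)) - exp (- (v\<^sup>2 * (gauss_var s (s + h n) / h n) / 2))) \<le> d / 2"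
          by (rule \<delta>(2)[rule_format]) (use h elim in blast)
        then show ?case unfolding dist_norm using \<open>0 < d\<close> by simp
      qed
    qed
    moreover have "(\<lambda>n. complex_of_real (exp (- (v\<^sup>2 * (gauss_var s (s + h n) / h n) / 2)))) \<longlonglongrightarrow> complex_of_real (exp (- (v\<^sup>2 * g / 2)))"
      by (intro tendsto_intros g) simp
    ultimately have "(\<lambda>n. (char (\<mu> s (s + h n)) (v / sqrt (h n)) - exp (- (v\<^sup>2 * (gauss_var s (s + h n) / h n) / 2)))
        + complex_of_real (exp (- (v\<^sup>2 * (gauss_var s (s + h n) / h n) / 2)))) \<longlonglongrightarrow> 0 + complex_of_real (exp (- (v\<^sup>2 * g / 2)))"
      by (rule tendsto_add)
    then show ?thesis by (simp add: mult.commute)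
  qed
  have chl: "(\<lambda>n. char (\<nu> n) v) \<longlonglongrightarrow> char (gau g) v" for v
  proof -
    have "(\<lambda>n. iexp (v * (c n / sqrt (h n))) * char (\<mu> s (s + h n)) (v / sqrt (h n))) \<longlonglongrightarrow> iexp (v * 0) * complex_of_real (exp (- (g * v\<^sup>2 / 2)))"
      by (intro tendsto_mult lim_mu tendsto_exp tendsto_of_real c tendsto_const)
    then show ?thesis unfolding chr char_gau[OF g0] by simp
  qed
  have wc: "weak_conv_m \<nu> (gau g)"
    by (rule levy_continuity[OF nu real_distribution_gau chl])
  define C' where "C' = D * (f 1 * (2 / gain_const * C))"
  have "filterlim (\<lambda>r::real. (1/2) * r) at_top at_top"
    by (rule filterlim_tendsto_pos_mult_at_top[OF tendsto_const _ filterlim_ident]) simp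
  then have "filterlim (\<lambda>r::real. r / 2) at_top at_top" by simp
  then have "((\<lambda>r. (r / 2) powr (p - 2)) \<longlongrightarrow> 0) at_top"
    by (intro tendsto_neg_powr) (use p in auto)
  then have "((\<lambda>r. C' * (r / 2) powr (p - 2)) \<longlongrightarrow> C' * 0) at_top" by (intro tendsto_mult_left)
  then have "eventually (\<lambda>r. C' * (r / 2) powr (p - 2) < \<epsilon> / 3) at_top"
    using order_tendstoD(2)[of _ "C' * 0" at_top "\<epsilon> / 3"] \<epsilon> by simp
  then have "eventually (\<lambda>r. C' * (r / 2) powr (p - 2) < \<epsilon> / 3 \<and> 2 * K0 \<le> r) at_top"
    using eventually_ge_at_top[of "2 * K0"] by (rule eventually_conj)
  then obtain r where r: "C' * (r / 2) powr (p - 2) < \<epsilon> / 3" "2 * K0 \<le> r"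
    by (auto simp: eventually_at_top_linorder)
  have r4: "4 \<le> r" using r K0 by linarith
  \<comment> \<open>As \<open>f\<close> increases with \<open>\<bar>x\<bar>\<close>, cutting its
    values at \<open>f r\<close> changes nothing for \<open>\<bar>x\<bar> \<le> r\<close> and keeps
    continuity.\<close>
  define T where "T x = min (f x) (f r)" for x
  have Tcont: "isCont T x" for x
    unfolding T_def using f_cont by (intro continuous_min continuous_const) (simp_all add: continuous_on_eq_continuous_at)
  have Tb: "norm (T x) \<le> f r" for x using f_nonneg[of x] f_nonneg[of r] by (simp add: T_def)
  have T0: "0 \<le> T x" for x using f_nonneg by (simp add: T_def)
  have Tlim: "(\<lambda>n. \<integral>x. T x \<partial>\<nu> n) \<longlonglongrightarrow> (\<integral>x. T x \<partial>gau g)"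
    by (rule weak_conv_imp_integral_bdd_continuous_conv[OF nu real_distribution_gau wc Tcont Tb])
  have Tm[measurable]: "T \<in> borel_measurable borel" unfolding T_def[abs_def] by measurable
  have Ti: "integrable \<alpha> T" if "real_distribution \<alpha>" for \<alpha>
  proof -
    interpret a: real_distribution \<alpha> by fact
    show ?thesis by (rule a.integrable_const_bound[where B = "f r"]) (use Tb in auto)
  qed
  have Tle: "(\<integral>x. T x \<partial>gau g) \<le> (\<integral>x. f x \<partial>gau g)"
    by (intro integral_mono Ti real_distribution_gau f_gau) (simp add: T_def)
  have ev1: "eventually (\<lambda>n. (\<integral>x. T x \<partial>\<nu> n) < (\<integral>x. f x \<partial>gau g) + \<epsilon> / 3) sequentially"
    using order_tendstoD(2)[OF Tlim, of "(\<integral>x. f x \<partial>gau g) + \<epsilon> / 3"] Tle \<epsilon> by linarith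
  have "(\<lambda>n. D * (D * C * (h n powr (1 - p / 2)))) \<longlonglongrightarrow> D * (D * C * (0 powr (1 - p / 2)))"
    using h(3) p always_eventually[of "\<lambda>n. 0 \<le> h n" sequentially] h(1)
    by (intro tendsto_mult tendsto_const tendsto_powr') (auto simp: less_imp_le)
  then have ev2: "eventually (\<lambda>n. D * (D * C * (h n powr (1 - p / 2))) < \<epsilon> / 3) sequentially"
    using order_tendstoD(2)[of _ "D * (D * C * (0 powr (1 - p / 2)))" sequentially "\<epsilon> / 3"] \<epsilon> by simp
  have ev3: "eventually (\<lambda>n. h n < (1 / K0)\<^sup>2) sequentially"
    using order_tendstoD(2)[OF h(3), of "(1 / K0)\<^sup>2"] K0 by simp
  have ev4: "eventually (\<lambda>n. \<bar>c n / sqrt (h n)\<bar> < 1) sequentially"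
    using order_tendstoD(2)[OF tendsto_rabs[OF c], of 1] by simp
  show ?thesis using ev1 ev2 ev3 ev4
  proof eventually_elim
    case (elim n)
    note hn = h(1)[of n]
    have S: "0 \<le> s" "s \<le> s + h n" "s + h n \<le> 1" by (rule st)+
    have K1: "K0 \<le> 1 / sqrt (h n)"
    proof -
      have "sqrt (h n) \<le> 1 / K0" using elim(3) K0 by (intro real_le_lsqrt) (auto simp: less_imp_le)
      then show ?thesis using sh[of n] K0 by (simp add: field_simps)
    qed
    have c1: "\<bar>c n\<bar> \<le> sqrt (h n)" using elim(4) sh[of n] by (simp add: abs_divide)
    define tl where "tl y = (if r < \<bar>(y + c n) / sqrt (h n)\<bar> then f ((y + c n) / sqrt (h n)) else 0)" for y
    have tli: "integrable (\<mu> s (s + h n)) tl"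
      unfolding tl_def[abs_def]
    proof (rule Bochner_Integration.integrable_bound[OF scaled_integrable[OF S hn, of "c n"]])
      show "(\<lambda>y. if r < \<bar>(y + c n) / sqrt (h n)\<bar> then f ((y + c n) / sqrt (h n)) else 0) \<in> borel_measurable (\<mu> s (s + h n))"
        by (subst measurable_cong_sets[OF real_distribution.events_eq_borel[OF mu] refl]) measurable
    qed (auto simp: f_nonneg)
    have Tni: "integrable (\<mu> s (s + h n)) (\<lambda>y. T ((y + c n) / sqrt (h n)))"
      using Ti[OF nu[of n]] unfolding \<nu>_def by (subst (asm) integrable_distr_eq) (use meas in auto)
    have "(\<integral>y. f ((y + c n) / sqrt (h n)) \<partial>\<mu> s (s + h n)) \<le> (\<integral>y. T ((y + c n) / sqrt (h n)) + tl y \<partial>\<mu> s (s + h n))"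
    proof (intro integral_mono scaled_integrable[OF S hn] Bochner_Integration.integrable_add Tni tli)
      fix y show "f ((y + c n) / sqrt (h n)) \<le> T ((y + c n) / sqrt (h n)) + tl y"
      proof (cases "r < \<bar>(y + c n) / sqrt (h n)\<bar>")
        case True then show ?thesis using T0 by (simp add: tl_def)
      next
        case False
        then have "f ((y + c n) / sqrt (h n)) \<le> f r" using r4 by (intro f_mono) linarith
        then show ?thesis using False by (simp add: tl_def T_def)
      qed
    qed
    also have "\<dots> = (\<integral>y. T ((y + c n) / sqrt (h n)) \<partial>\<mu> s (s + h n)) + (\<integral>y. tl y \<partial>\<mu> s (s + h n))"
      by (rule Bochner_Integration.integral_add[OF Tni tli])
    also have "(\<integral>y. T ((y + c n) / sqrt (h n)) \<partial>\<mu> s (s + h n)) = (\<integral>x. T x \<partial>\<nu> n)"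
      unfolding \<nu>_def by (rule integral_distr[OF meas, symmetric]) simp
    finally have 1: "(\<integral>y. f ((y + c n) / sqrt (h n)) \<partial>\<mu> s (s + h n)) \<le> (\<integral>x. T x \<partial>\<nu> n) + (\<integral>y. tl y \<partial>\<mu> s (s + h n))" .
    have pw: "(1 / sqrt (h n)) powr p * h n = h n powr (1 - p / 2)"
    proof -
      have "(1 / sqrt (h n)) powr p = (h n powr (- (1/2))) powr p"
        using hn by (simp only: powr_minus powr_half_sqrt[OF less_imp_le[OF hn]] inverse_eq_divide)
      also have "\<dots> = h n powr (- (p / 2))" by (simp add: powr_powr)
      finally have "(1 / sqrt (h n)) powr p * h n = h n powr (- (p / 2)) * h n powr 1" using hn by simp
      also have "\<dots> = h n powr (1 - p / 2)"
        unfolding powr_add[symmetric] by (rule arg_cong[where f="\<lambda>a. h n powr a"]) simp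
      finally show ?thesis .
    qed
    have "(\<integral>y. tl y \<partial>\<mu> s (s + h n)) \<le> D * (f 1 * (r / 2) powr (p - 2) * (trunc_var 1 s (s + h n) / h n) + (1 / sqrt (h n)) powr p * J s (s + h n))"
      unfolding tl_def by (rule tail_bound[OF s hn h(2) K1 c1 r(2)])
    also have "\<dots> \<le> D * (f 1 * (r / 2) powr (p - 2) * (2 / gain_const * C) + (1 / sqrt (h n)) powr p * (D * (C * h n)))"
    proof (intro mult_left_mono add_mono)
      have "trunc_var 1 s (s + h n) \<le> 2 / gain_const * (smooth_moment (s + h n) - smooth_moment s)" using S by (intro trunc_var_incr) auto
      also have "\<dots> \<le> 2 / gain_const * (C * h n)" using C(1) gain_const_pos by (intro mult_left_mono) auto
      finally show "trunc_var 1 s (s + h n) / h n \<le> 2 / gain_const * C" using hn by (simp add: pos_divide_le_eq)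
      have "J s (s + h n) \<le> D * (growth_moment (s + h n) - growth_moment s)" by (rule J_increment[OF S])
      also have "\<dots> \<le> D * (C * h n)" using C(2) D by (intro mult_left_mono) auto
      finally show "J s (s + h n) \<le> D * (C * h n)" .
    qed (use D f_nonneg in auto)
    also have "\<dots> = C' * (r / 2) powr (p - 2) + D * (D * C * (h n powr (1 - p / 2)))"
      unfolding pw[symmetric] C'_def by (simp add: algebra_simps)
    finally have "(\<integral>y. tl y \<partial>\<mu> s (s + h n)) \<le> C' * (r / 2) powr (p - 2) + D * (D * C * (h n powr (1 - p / 2)))" .
    then show ?case using 1 elim(1,2) r(1) by linarith
  qed
qed

section \<open>Lower bound for the variance of the Gaussian part\<close>

definition Kf :: real where "Kf = (\<integral>y. f (y + m 1) \<partial>\<mu> 0 1)"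

definition lim_at :: "real \<Rightarrow> bool" where
  "lim_at s \<longleftrightarrow> ennreal Kf \<le> Liminf (at_right 0)
     (\<lambda>h. \<integral>\<^sup>+y. ennreal (f (h powr (- 1 / 2) * (y + (m (s + h) - m s)))) \<partial>\<mu> s (s + h))"

definition dini_at :: "(real \<Rightarrow> real) \<Rightarrow> real \<Rightarrow> bool" where
  "dini_at \<Phi> s \<longleftrightarrow> (\<exists>C \<delta>. 0 < \<delta> \<and> (\<forall>h. 0 < h \<longrightarrow> h < \<delta> \<longrightarrow> s + h \<le> 1 \<longrightarrow> \<Phi> (s + h) - \<Phi> s \<le> C * h))"

definition flat_at :: "real \<Rightarrow> bool" where
  "flat_at s \<longleftrightarrow> (\<forall>c>0. \<forall>\<delta>>0. \<exists>h. 0 < h \<and> h < \<delta> \<and> \<bar>m (s + h) - m s\<bar> < c * sqrt h)"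

lemma dini_at_ae:
  assumes "mono_on {0..1} \<Phi>" shows "negligible {s\<in>{0..<1}. \<not> dini_at \<Phi> s}"
proof (rule negligible_subset[OF mono_finite_upper_dini[of 0 1 \<Phi>]])
  have "\<forall>c. \<forall>\<delta>>0. \<exists>h. 0 < h \<and> h < \<delta> \<and> s + h \<le> 1 \<and> c * h < \<Phi> (s + h) - \<Phi> s" if "\<not> dini_at \<Phi> s" for s
    using that unfolding dini_at_def by (meson linorder_not_less)
  then show "{s\<in>{0..<1}. \<not> dini_at \<Phi> s} \<subseteq> {s\<in>{0..<1}. \<forall>c. \<forall>\<delta>>0. \<exists>h. 0 < h \<and> h < \<delta> \<and> s + h \<le> 1 \<and> c * h < \<Phi> (s + h) - \<Phi> s}"
    by blast
qed (use assms in auto)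

lemma flat_at_ae: "negligible {s. \<not> flat_at s}"
proof (rule negligible_subset[OF liminf_sqrt_increment_zero[of m]])
  have "\<exists>c>0. \<exists>\<delta>>0. \<forall>h. 0 < h \<and> h < \<delta> \<longrightarrow> c * sqrt h \<le> \<bar>m (s + h) - m s\<bar>" if "\<not> flat_at s" for s
    using that unfolding flat_at_def by (meson linorder_not_less)
  then show "{s. \<not> flat_at s} \<subseteq> {s. \<exists>c>0. \<exists>\<delta>>0. \<forall>h. 0 < h \<and> h < \<delta> \<longrightarrow> c * sqrt h \<le> \<bar>m (s + h) - m s\<bar>}"
    by blast
qed

text \<open>If the claim fails, the variance quotients lie in \<open>[0, c]\<close> for all small
  \<open>h\<close>. Pick \<open>h n\<close> tending to 0 along which the drift is negligible, and a
  subsequence along which the quotients converge to some \<open>g \<le> c\<close>. Then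
  \<open>scaled_limit\<close> pushes the scaled \<open>f\<close>-moments below \<open>Kf\<close>,
  although the lower limit over all small \<open>h\<close> is at least \<open>Kf\<close>.\<close>

lemma good_point:
  assumes s: "0 \<le> s" "s < b" "b \<le> 1" and clt: "clt_at s" and dini: "dini_at smooth_moment s" "dini_at growth_moment s"
    and fl: "flat_at s" and lim: "lim_at s" and c: "0 \<le> c" "(\<integral>x. f x \<partial>gau c) < Kf" and \<delta>: "0 < \<delta>"
  shows "\<exists>h. 0 < h \<and> h < \<delta> \<and> s + h \<le> b \<and> c * h \<le> gauss_var s (s + h)"
proof (rule ccontr)
  assume neg: "\<not> ?thesis"
  obtain C1 \<delta>1 where C1: "0 < \<delta>1" "\<And>h. 0 < h \<Longrightarrow> h < \<delta>1 \<Longrightarrow> s + h \<le> 1 \<Longrightarrow> smooth_moment (s + h) - smooth_moment s \<le> C1 * h"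
    using dini(1) unfolding dini_at_def by blast
  obtain C2 \<delta>2 where C2: "0 < \<delta>2" "\<And>h. 0 < h \<Longrightarrow> h < \<delta>2 \<Longrightarrow> s + h \<le> 1 \<Longrightarrow> growth_moment (s + h) - growth_moment s \<le> C2 * h"
    using dini(2) unfolding dini_at_def by blast
  define \<delta>' where "\<delta>' = min (min \<delta> (b - s)) (min \<delta>1 \<delta>2)"
  have \<delta>': "0 < \<delta>'" using \<delta> s C1 C2 by (simp add: \<delta>'_def)
  have "\<exists>h. 0 < h \<and> h < min \<delta>' (1 / real (Suc n)) \<and> \<bar>m (s + h) - m s\<bar> < 1 / real (Suc n) * sqrt h" for n
    by (rule fl[unfolded flat_at_def, rule_format]) (use \<delta>' in auto)
  then have "\<exists>h. \<forall>n. 0 < h n \<and> h n < min \<delta>' (1 / real (Suc n)) \<and> \<bar>m (s + h n) - m s\<bar> < 1 / real (Suc n) * sqrt (h n)"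
    by (intro choice) blast
  then obtain h where h: "\<And>n. 0 < h n" "\<And>n. h n < min \<delta>' (1 / real (Suc n))"
    "\<And>n. \<bar>m (s + h n) - m s\<bar> < 1 / real (Suc n) * sqrt (h n)" by blast
  have hb: "s + h n \<le> b" "h n < \<delta>" "h n < \<delta>1" "h n < \<delta>2" "s + h n \<le> 1" for n
    using h(2)[of n] s by (auto simp: \<delta>'_def)
  have hl: "h \<longlonglongrightarrow> 0"
    by (rule tendsto_sandwich[OF _ _ tendsto_const LIMSEQ_Suc[OF lim_1_over_n]])
       (use h in \<open>auto intro!: always_eventually less_imp_le\<close>)
  have ml: "(\<lambda>n. (m (s + h n) - m s) / sqrt (h n)) \<longlonglongrightarrow> 0"
  proof (rule Lim_null_comparison[OF always_eventually LIMSEQ_Suc[OF lim_1_over_n]], rule allI)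
    fix n show "norm ((m (s + h n) - m s) / sqrt (h n)) \<le> 1 / real (Suc n)"
      using h(3)[of n] h(1)[of n] by (simp add: abs_divide pos_divide_le_eq less_imp_le)
  qed
  define q where "q n = gauss_var s (s + h n) / h n" for n
  have q: "q n \<in> {0..c}" for n
  proof -
    have "gauss_var s (s + h n) < c * h n" using neg hb h(1) by (meson linorder_not_less)
    moreover have "0 \<le> gauss_var s (s + h n)" using gauss_var_nonneg[of s "s + h n"] s hb(5)[of n] h(1)[of n] by simp
    ultimately show ?thesis using h(1)[of n] by (simp add: q_def pos_divide_le_eq less_imp_le)
  qed
  obtain g r where g: "g \<in> {0..c}" "strict_mono r" "(q \<circ> r) \<longlonglongrightarrow> g"
    using q compact_imp_seq_compact[OF compact_Icc] by (blast elim: seq_compactE)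
  define \<epsilon> where "\<epsilon> = (Kf - (\<integral>x. f x \<partial>gau c)) / 2"
  have \<epsilon>: "0 < \<epsilon>" using c by (simp add: \<epsilon>_def)
  define C where "C = max C1 C2"
  have ev: "eventually (\<lambda>n. (\<integral>y. f ((y + (m (s + h (r n)) - m s)) / sqrt (h (r n))) \<partial>\<mu> s (s + h (r n))) \<le> (\<integral>x. f x \<partial>gau g) + \<epsilon>) sequentially"
  proof (rule scaled_limit[OF s(1) _ _ _ _ clt _ _ _ \<epsilon>])
    show "(\<lambda>n. h (r n)) \<longlonglongrightarrow> 0" using LIMSEQ_subseq_LIMSEQ[OF hl g(2)] by (simp add: o_def)
    show "(\<lambda>n. (m (s + h (r n)) - m s) / sqrt (h (r n))) \<longlonglongrightarrow> 0"
      using LIMSEQ_subseq_LIMSEQ[OF ml g(2)] by (simp add: o_def)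
    show "(\<lambda>n. gauss_var s (s + h (r n)) / h (r n)) \<longlonglongrightarrow> g" using g(3) by (simp add: o_def q_def)
    show "smooth_moment (s + h (r n)) - smooth_moment s \<le> C * h (r n)" for n
    proof -
      have "smooth_moment (s + h (r n)) - smooth_moment s \<le> C1 * h (r n)" by (intro C1 h hb)
      also have "\<dots> \<le> C * h (r n)" using h(1)[of "r n"] by (intro mult_right_mono) (auto simp: C_def)
      finally show ?thesis .
    qed
    show "growth_moment (s + h (r n)) - growth_moment s \<le> C * h (r n)" for n
    proof -
      have "growth_moment (s + h (r n)) - growth_moment s \<le> C2 * h (r n)" by (intro C2 h hb)
      also have "\<dots> \<le> C * h (r n)" using h(1)[of "r n"] by (intro mult_right_mono) (auto simp: C_def)
      finally show ?thesis .
    qed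
  qed (use h hb in auto)
  define Y where "Y = (\<integral>x. f x \<partial>gau g) + \<epsilon>"
  have gc: "(\<integral>x. f x \<partial>gau g) \<le> (\<integral>x. f x \<partial>gau c)" using g(1) by (intro gau_f_mono) auto
  have Y0: "0 \<le> Y" unfolding Y_def using \<epsilon> f_nonneg by (intro add_nonneg_nonneg Bochner_Integration.integral_nonneg) auto
  have "Y < Kf" using gc \<epsilon> unfolding Y_def \<epsilon>_def by argo
  then have "ennreal Y < ennreal Kf" using Y0 by (simp add: ennreal_less_iff)
  then have "eventually (\<lambda>h. ennreal Y < (\<integral>\<^sup>+y. ennreal (f (h powr (- 1 / 2) * (y + (m (s + h) - m s)))) \<partial>\<mu> s (s + h))) (at_right 0)"
    using lim unfolding lim_at_def le_Liminf_iff by blast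
  moreover have "filterlim (\<lambda>n. h (r n)) (at_right 0) sequentially"
    unfolding filterlim_at using LIMSEQ_subseq_LIMSEQ[OF hl g(2)] h(1) less_imp_neq[OF h(1), symmetric] by (auto simp: o_def intro: always_eventually)
  ultimately have "eventually (\<lambda>n. ennreal Y < (\<integral>\<^sup>+y. ennreal (f (h (r n) powr (- 1 / 2) * (y + (m (s + h (r n)) - m s)))) \<partial>\<mu> s (s + h (r n)))) sequentially"
    by (rule eventually_compose_filterlim)
  then have "eventually (\<lambda>n. False) sequentially"
    using ev
  proof eventually_elim
    case (elim n)
    define k where "k = h (r n)"
    have k: "0 < k" "s + k \<le> 1" using h hb by (auto simp: k_def)
    have pw: "k powr (- 1 / 2) = 1 / sqrt k"
    proof -
      have "(- 1 / 2 :: real) = - (1 / 2)" by simp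
      then show ?thesis using k by (simp only: powr_minus powr_half_sqrt[OF less_imp_le[OF k(1)]] inverse_eq_divide)
    qed
    have i: "integrable (\<mu> s (s + k)) (\<lambda>y. f ((y + (m (s + k) - m s)) / sqrt k))"
      by (rule scaled_integrable) (use s k in auto)
    have "(\<integral>\<^sup>+y. ennreal (f (k powr (- 1 / 2) * (y + (m (s + k) - m s)))) \<partial>\<mu> s (s + k)) = ennreal (\<integral>y. f ((y + (m (s + k) - m s)) / sqrt k) \<partial>\<mu> s (s + k))"
      unfolding pw using nn_integral_eq_integral[OF i] f_nonneg by simp
    also have "\<dots> \<le> ennreal Y" using elim(2) unfolding k_def Y_def by (rule ennreal_leI)
    finally show False using elim(1) unfolding k_def by simp
  qed
  then show False by simp
qed

lemma gauss_var_lower: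
  assumes ae: "AE s in lborel. s \<in> {0..<1} \<longrightarrow> lim_at s" and s2: "0 \<le> s2" "(\<integral>x. f x \<partial>gau s2) = Kf"
    and ab: "0 \<le> a" "a \<le> b" "b \<le> 1"
  shows "s2 * (b - a) \<le> gauss_var a b"
proof (rule field_le_epsilon)
  fix \<eta> :: real assume \<eta>: "0 < \<eta>"
  show "s2 * (b - a) \<le> gauss_var a b + \<eta>"
  proof (cases "s2 = 0")
    case True
    then show ?thesis using gauss_var_nonneg[OF ab] \<eta> by simp
  next
    case False
    \<comment> \<open>Slightly below \<open>s2\<close>, because \<open>good_point\<close> needs a
      normal moment strictly less than \<open>Kf\<close>.\<close>
    define c where "c = max 0 (s2 - \<eta>)"
    have c: "0 \<le> c" "c < s2" using False s2 \<eta> by (auto simp: c_def)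
    have cK: "(\<integral>x. f x \<partial>gau c) < Kf" using gau_f_strict_mono[OF c] s2 by simp
    define N where "N = {s\<in>{0..<1}. \<not> clt_at s} \<union> {s\<in>{0..<1}. \<not> dini_at smooth_moment s} \<union> {s\<in>{0..<1}. \<not> dini_at growth_moment s}
      \<union> {s. \<not> flat_at s} \<union> {s. \<not> (s \<in> {0..<1} \<longrightarrow> lim_at s)}"
    have nl: "negligible {s. \<not> (s \<in> {0..<1} \<longrightarrow> lim_at s)}"
    proof -
      obtain N where N: "{s. \<not> (s \<in> {0..<1} \<longrightarrow> lim_at s)} \<subseteq> N" "N \<in> null_sets lborel"
      proof -
        obtain N where "\<And>s. s \<in> space lborel - N \<Longrightarrow> s \<in> {0..<1} \<longrightarrow> lim_at s" "N \<in> null_sets lborel"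
          using AE_E3[OF ae] by blast
        then show ?thesis by (intro that[of N]) auto
      qed
      then have "N \<in> null_sets lebesgue" by (intro null_sets_completionI)
      then show ?thesis using N(1) by (auto simp: negligible_iff_null_sets[symmetric] intro: negligible_subset)
    qed
    have N: "negligible N"
      unfolding N_def
      by (intro negligible_Un clt_at_ae dini_at_ae flat_at_ae nl mono_onI) (auto intro: smooth_moment_mono growth_moment_mono)
    have "c * (b - a) \<le> gauss_var 0 b - gauss_var 0 a"
    proof (rule increment_lower_bound[OF _ ab(2) c(1) N])
      show "mono_on {a..b} (gauss_var 0)"
      proof (rule mono_onI)
        fix x y assume "x \<in> {a..b}" "y \<in> {a..b}" "x \<le> y"
        then show "gauss_var 0 x \<le> gauss_var 0 y" using gauss_var_add[of 0 x y] gauss_var_nonneg[of x y] ab by simp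
      qed
      fix s \<delta> :: real assume s: "s \<in> {a..<b}" "s \<notin> N" "0 < \<delta>"
      have "\<exists>h. 0 < h \<and> h < \<delta> \<and> s + h \<le> b \<and> c * h \<le> gauss_var s (s + h)"
        by (rule good_point) (use s ab c cK in \<open>auto simp: N_def\<close>)
      then obtain h where h: "0 < h" "h < \<delta>" "s + h \<le> b" "c * h \<le> gauss_var s (s + h)" by blast
      moreover have "gauss_var 0 (s + h) = gauss_var 0 s + gauss_var s (s + h)" using h s ab by (intro gauss_var_add) auto
      ultimately show "\<exists>h>0. h < \<delta> \<and> s + h \<le> b \<and> c * h \<le> gauss_var 0 (s + h) - gauss_var 0 s" by (intro exI[of _ h]) auto
    qed
    moreover have "gauss_var 0 b = gauss_var 0 a + gauss_var a b" using ab by (intro gauss_var_add) auto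
    moreover have "(s2 - \<eta>) * (b - a) \<le> c * (b - a)" using ab by (intro mult_right_mono) (auto simp: c_def)
    moreover have "(s2 - \<eta>) * (b - a) = s2 * (b - a) - \<eta> * (b - a)" by (simp add: left_diff_distrib)
    moreover have "\<eta> * (b - a) \<le> \<eta> * 1" using ab \<eta> by (intro mult_left_mono) auto
    ultimately show ?thesis by linarith
  qed
qed

end

subsection \<open>The equality case\<close>

lemma convex_if_subgradients:
  fixes h :: "real \<Rightarrow> real"
  assumes "\<And>x. \<exists>s. \<forall>y. h x + s * (y - x) \<le> h y"
  shows "convex_on UNIV h"
proof (intro convex_onI)
  fix t x y :: real assume t: "0 < t" "t < 1"
  define z where "z = (1 - t) * x + t * y"
  obtain s where s: "\<And>y. h z + s * (y - z) \<le> h y" using assms[of z] by blast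
  have "(1 - t) * (h z + s * (x - z)) + t * (h z + s * (y - z)) \<le> (1 - t) * h x + t * h y"
    using t by (intro add_mono mult_left_mono s) auto
  moreover have "(1 - t) * (h z + s * (x - z)) + t * (h z + s * (y - z)) = h z"
  proof -
    have "(1 - t) * (h z + s * (x - z)) + t * (h z + s * (y - z)) = h z + s * ((1 - t) * x + t * y - z)"
      by (simp add: algebra_simps)
    then show ?thesis by (simp add: z_def)
  qed
  ultimately show "h ((1 - t) *\<^sub>R x + t *\<^sub>R y) \<le> (1 - t) * h x + t * h y" by (simp add: z_def)
qed auto

lemma convex_shift:
  fixes h :: "real \<Rightarrow> real"
  assumes "convex_on UNIV h" shows "convex_on UNIV (\<lambda>y. h (y + c))" "convex_on UNIV (\<lambda>y. h (c + y))"
proof -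
  have 1: "\<exists>s. \<forall>y. h (x + c) + s * (y - x) \<le> h (y + c)" for x
  proof -
    obtain d where "\<And>y. h (x + c) + d * (y - (x + c)) \<le> h y" using convex_subgradient[OF assms, of "x + c"] by blast
    from this[of "_ + c"] show ?thesis by (intro exI[of _ d] allI) simp
  qed
  then show "convex_on UNIV (\<lambda>y. h (y + c))" by (rule convex_if_subgradients)
  then show "convex_on UNIV (\<lambda>y. h (c + y))" by (simp add: add.commute)
qed

text \<open>The ramp \<open>\<phi> n\<close>, equal to 0 up to \<open>x\<close> and to 1 from
  \<open>x + 1 / Suc n\<close> on, is a combination of two functions
  \<open>\<bar>y - k\<bar>\<close> and a constant. It converges to the indicator of
  \<open>{x<..}\<close>, so the distribution functions agree.\<close>

lemma abs_moments_determine: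
  assumes a: "real_distribution \<alpha>" "integrable \<alpha> (\<lambda>x. x)" and b: "real_distribution \<beta>" "integrable \<beta> (\<lambda>x. x)"
    and eq: "\<And>k. (\<integral>y. \<bar>y - k\<bar> \<partial>\<alpha>) = (\<integral>y. \<bar>y - k\<bar> \<partial>\<beta>)"
  shows "\<alpha> = \<beta>"
proof (rule cdf_unique[OF a(1) b(1)], rule ext)
  fix x
  define \<phi> where "\<phi> n y = (\<bar>y - x\<bar> - \<bar>y - (x + 1 / real (Suc n))\<bar> + 1 / real (Suc n)) / (2 / real (Suc n))" for n :: nat and y
  have bnd: "norm (\<phi> n y) \<le> 1" for n y
  proof -
    define e where "e = 1 / real (Suc n)"
    have e: "0 < e" by (simp add: e_def)
    have "0 \<le> \<bar>y - x\<bar> - \<bar>y - (x + e)\<bar> + e" "\<bar>y - x\<bar> - \<bar>y - (x + e)\<bar> + e \<le> 2 * e" using e by linarith+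
    then have "0 \<le> (\<bar>y - x\<bar> - \<bar>y - (x + e)\<bar> + e) / (2 * e)" "(\<bar>y - x\<bar> - \<bar>y - (x + e)\<bar> + e) / (2 * e) \<le> 1"
      using e by (auto simp: divide_le_eq)
    moreover have "\<phi> n y = (\<bar>y - x\<bar> - \<bar>y - (x + e)\<bar> + e) / (2 * e)" by (simp add: \<phi>_def e_def)
    ultimately have "0 \<le> \<phi> n y" "\<phi> n y \<le> 1" by (simp_all only:)
    then show ?thesis by simp
  qed
  have lim: "(\<lambda>n. \<phi> n y) \<longlonglongrightarrow> indicator {x<..} y" for y
  proof (cases "y \<le> x")
    case True
    have "\<bar>y - x\<bar> - \<bar>y - (x + e)\<bar> + e = 0" if "0 < e" for e :: real using True that by linarith
    then have "\<phi> n y = 0" for n unfolding \<phi>_def by (simp only: div_0 zero_less_divide_1_iff of_nat_0_less_iff zero_less_Suc)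
    then show ?thesis using True by simp
  next
    case False
    then obtain N where N: "1 / real (Suc N) < y - x" using nat_approx_posE[of "y - x"] by auto
    have "\<phi> n y = 1" if "N \<le> n" for n
    proof -
      have "1 / real (Suc n) \<le> 1 / real (Suc N)" using that by (simp add: frac_le)
      then have "1 / real (Suc n) \<le> y - x" using N by linarith
      then have "\<bar>y - x\<bar> - \<bar>y - (x + 1 / real (Suc n))\<bar> + 1 / real (Suc n) = 2 / real (Suc n)" using False by simp
      then show ?thesis by (simp add: \<phi>_def)
    qed
    then show ?thesis using False by (intro tendsto_eventually) (auto simp: eventually_sequentially)
  qed
  have L: "(\<lambda>n. \<integral>y. \<phi> n y \<partial>\<gamma>) \<longlonglongrightarrow> (\<integral>y. indicator {x<..} y \<partial>\<gamma>)"
    if \<gamma>: "real_distribution \<gamma>" for \<gamma>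
  proof (rule integral_dominated_convergence[where w = "\<lambda>_. 1"])
    interpret c: real_distribution \<gamma> by fact
    show "integrable \<gamma> (\<lambda>_. 1::real)" by simp
    show "\<phi> n \<in> borel_measurable \<gamma>" for n
      unfolding \<phi>_def[abs_def] by (subst measurable_cong_sets[OF c.events_eq_borel refl]) measurable
    show "(indicator {x<..} :: real \<Rightarrow> real) \<in> borel_measurable \<gamma>"
      by (subst measurable_cong_sets[OF c.events_eq_borel refl]) measurable
  qed (use lim bnd in auto)
  have I: "(\<integral>y. \<phi> n y \<partial>\<gamma>) = ((\<integral>y. \<bar>y - x\<bar> \<partial>\<gamma>) - (\<integral>y. \<bar>y - (x + 1 / real (Suc n))\<bar> \<partial>\<gamma>) + 1 / real (Suc n)) / (2 / real (Suc n))"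
    if \<gamma>: "real_distribution \<gamma>" "integrable \<gamma> (\<lambda>x. x)" for \<gamma> n
  proof -
    interpret c: real_distribution \<gamma> by fact
    have i: "integrable \<gamma> (\<lambda>y. \<bar>y - k\<bar>)" for k using \<gamma>(2) by (intro integrable_abs Bochner_Integration.integrable_diff) auto
    show ?thesis unfolding \<phi>_def integral_divide_zero using i by simp
  qed
  have "(\<integral>y. \<phi> n y \<partial>\<beta>) = (\<integral>y. \<phi> n y \<partial>\<alpha>)" for n unfolding I[OF a] I[OF b] eq ..
  then have "(\<lambda>n. \<integral>y. \<phi> n y \<partial>\<alpha>) \<longlonglongrightarrow> (\<integral>y. indicator {x<..} y \<partial>\<beta>)" using L[OF b(1)] by (simp only:)
  then have "(\<integral>y. indicat_real {x<..} y \<partial>\<alpha>) = (\<integral>y. indicator {x<..} y \<partial>\<beta>)"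
    by (rule LIMSEQ_unique[OF L[OF a(1)]])
  then have m: "measure \<alpha> {x<..} = measure \<beta> {x<..}"
    using real_distribution.events_eq_borel[OF a(1)] real_distribution.events_eq_borel[OF b(1)] by simp
  have "cdf \<gamma> x = 1 - measure \<gamma> {x<..}" if "real_distribution \<gamma>" for \<gamma>
  proof -
    interpret c: real_distribution \<gamma> by fact
    have "{..x} = space \<gamma> - {x<..}" by auto
    then show ?thesis unfolding cdf_def by (simp only:) (rule c.prob_compl, simp)
  qed
  then show "cdf \<alpha> x = cdf \<beta> x" using m a(1) b(1) by simp
qed

lemma gau_symmetric:
  fixes g :: "real \<Rightarrow> real"
  assumes v: "0 \<le> v" and g: "g \<in> borel_measurable borel"
  shows "(\<integral>z. g (- z) \<partial>gau v) = (\<integral>z. g z \<partial>gau v)"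
proof -
  interpret n: real_distribution "gau v" by (rule real_distribution_gau)
  have um: "uminus \<in> borel_measurable (gau v)" by (simp add: gau_def)
  have "distr (gau v) borel uminus = gau v"
  proof (rule Levy_uniqueness)
    show "real_distribution (distr (gau v) borel uminus)" by (rule n.real_distribution_distr[OF um])
    show "char (distr (gau v) borel uminus) = char (gau v)"
    proof
      fix t
      have "char (distr (gau v) borel uminus) t = (\<integral>z. iexp (t * - z) \<partial>gau v)"
        unfolding char_def by (rule integral_distr[OF um]) simp
      also have "\<dots> = char (gau v) (- t)" unfolding char_def by (rule Bochner_Integration.integral_cong) auto
      finally show "char (distr (gau v) borel uminus) t = char (gau v) t" using v by (simp add: char_gau)
    qed
  qed (rule real_distribution_gau)
  then have "(\<integral>z. g z \<partial>gau v) = (\<integral>z. g z \<partial>distr (gau v) borel uminus)" by simp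
  also have "\<dots> = (\<integral>z. g (- z) \<partial>gau v)" by (rule integral_distr[OF um g])
  finally show ?thesis ..
qed

text \<open>Full support of the normal law: its density is positive, so the open set where
  \<open>h\<close> does not vanish is Lebesgue null and hence empty.\<close>

lemma gau_AE_zero_imp_zero:
  fixes h :: "real \<Rightarrow> real"
  assumes v: "0 < v" and h: "continuous_on UNIV h" and ae: "AE z in gau v. h z = 0"
  shows "h x = 0"
proof -
  have hm: "h \<in> borel_measurable borel" using h by (rule borel_measurable_continuous_onI)
  have "AE z in std_normal_distribution. h (sqrt v * z) = 0"
    using ae unfolding gau_def by (subst (asm) AE_distr_iff) (use hm in auto)
  then have "AE z in lborel. h (sqrt v * z) = 0"
    by (subst (asm) AE_density) (auto elim!: eventually_mono simp: normal_density_pos)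
  then obtain N where N: "\<And>z. z \<in> space lborel - N \<Longrightarrow> h (sqrt v * z) = 0" "N \<in> null_sets lborel"
    by (rule AE_E3) blast
  define S where "S = {z. h (sqrt v * z) \<noteq> 0}"
  have "negligible N" using N(2) null_sets_completionI by (auto simp: negligible_iff_null_sets)
  then have "negligible S" by (rule negligible_subset) (use N(1) in \<open>auto simp: S_def\<close>)
  moreover have "open S"
    unfolding S_def by (intro open_Collect_neq continuous_on_compose2[OF h] continuous_intros) auto
  ultimately have "S = {}" using open_not_negligible by blast
  then have "h (sqrt v * z) = 0" for z unfolding S_def by blast
  then have "h (sqrt v * (x / sqrt v)) = 0" .
  moreover have "sqrt v * (x / sqrt v) = x" using v by simp
  ultimately show ?thesis by metis
qed

section \<open>Equality of \<open>f\<close>-moments under the convex order\<close>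

context growth_function
begin

text \<open>\<open>f\<close> on \<open>[-r, r]\<close>, continued by a supporting line at
  \<open>r\<close> and by its mirror image at \<open>-r\<close>.\<close>

definition f1 :: "real \<Rightarrow> real \<Rightarrow> real \<Rightarrow> real" where
  "f1 r d x = (if \<bar>x\<bar> \<le> r then f x else f r + d * (\<bar>x\<bar> - r))"

lemma f1_split:
  assumes r: "0 < r" and d: "\<And>y. f r + d * (y - r) \<le> f y"
  shows "0 < d" "convex_on UNIV (f1 r d)" "convex_on UNIV (\<lambda>x. f x - f1 r d x)" "\<bar>f1 r d x - d * \<bar>x\<bar>\<bar> \<le> d * r"
proof -
  have frd: "f r \<le> d * r" using d[of 0] by simp
  then have "0 < d * r" using f_pos[of r] r by simp
  then show d0: "0 < d" using r by (simp add: zero_less_mult_iff)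
  have "\<forall>x. \<exists>s. \<forall>y. f x + s * (y - x) \<le> f y"
    by (meson convex_subgradient[OF f_convex])
  then obtain s where s: "\<And>x y. f x + s x * (y - x) \<le> f y" by metis
  have dm: "f r + d * (- y - r) \<le> f y" for y using d[of "- y"] by (simp add: f_sym)
  \<comment> \<open>Monotonicity of subgradients: they are at most \<open>d\<close> left of
    \<open>r\<close> and at least \<open>d\<close> right of it, and correspondingly for
    \<open>- d\<close> at \<open>- r\<close>. Each subgradient needed below is one of
    \<open>s x\<close>, \<open>s x - d\<close>, \<open>s x + d\<close>, \<open>d\<close>,
    \<open>- d\<close> and 0.\<close>
  have s1: "s x \<le> d" if "x < r" for x
  proof -
    have "s x * (r - x) \<le> d * (r - x)" using s[of x r] d[of x] by (simp add: algebra_simps)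
    then show ?thesis using that by simp
  qed
  have s2: "- d \<le> s x" if "- r < x" for x
  proof -
    have "(- d) * (x + r) \<le> s x * (x + r)" using s[of x "- r"] dm[of x] by (simp add: algebra_simps f_sym)
    then show ?thesis using mult_right_le_imp_le[of "- d" "x + r" "s x"] that by simp
  qed
  have s3: "d \<le> s x" if "r < x" for x
  proof -
    have "d * (x - r) \<le> s x * (x - r)" using s[of x r] d[of x] by (simp add: algebra_simps)
    then show ?thesis using that by simp
  qed
  have s4: "s x \<le> - d" if "x < - r" for x
  proof -
    have "d * (- x - r) \<le> (- s x) * (- x - r)" using s[of x "- r"] dm[of x] by (simp add: algebra_simps f_sym)
    then have "d \<le> - s x" using mult_right_le_imp_le[of d "- x - r" "- s x"] that by simp
    then show ?thesis by simp
  qed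
  show "convex_on UNIV (f1 r d)"
  proof (rule convex_if_subgradients)
    fix x
    consider "r \<le> x" | "x \<le> - r" | "- r < x" "x < r" by linarith
    then show "\<exists>k. \<forall>y. f1 r d x + k * (y - x) \<le> f1 r d y"
    proof cases
      case 1
      have e: "f1 r d x + d * (y - x) = f r + d * (y - r)" for y
        using 1 r by (cases "x = r") (auto simp: f1_def algebra_simps)
      have "f r + d * (y - r) \<le> f1 r d y" for y
        using d[of y] d0 by (auto simp: f1_def)
      then show ?thesis using e by (intro exI[of _ d]) simp
    next
      case 2
      have e: "f1 r d x + (- d) * (y - x) = f r + d * (- y - r)" for y
        using 2 r by (cases "x = - r") (auto simp: f1_def algebra_simps f_sym)
      have "f r + d * (- y - r) \<le> f1 r d y" for y
        using dm[of y] d0 by (auto simp: f1_def)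
      then show ?thesis using e by (intro exI[of _ "- d"]) simp
    next
      case 3
      have x: "f1 r d x = f x" using abs_le_iff[of x r] 3 by (simp add: f1_def)
      have "f x + s x * (y - x) \<le> f1 r d y" for y
      proof -
        consider "\<bar>y\<bar> \<le> r" | "r < y" | "y < - r" by linarith
        then show ?thesis
        proof cases
          case 1 then show ?thesis using s[of x y] by (simp add: f1_def)
        next
          case 2
          have "s x * (y - r) \<le> d * (y - r)" using s1[OF 3(2)] 2 by (intro mult_right_mono) auto
          moreover have "s x * (y - x) = s x * (r - x) + s x * (y - r)" by (simp add: algebra_simps)
          moreover have "f1 r d y = f r + d * (y - r)" using 2 r by (simp add: f1_def)
          ultimately show ?thesis using s[of x r] by (simp only:; argo)
        next
          case y: 3
          have "s x * (y + r) \<le> (- d) * (y + r)" using s2[OF 3(1)] y by (intro mult_right_mono_neg) auto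
          moreover have "s x * (y - x) = s x * (- r - x) + s x * (y + r)" by (simp add: algebra_simps)
          moreover have "f1 r d y = f r + (- d) * (y + r)" using y r by (simp add: f1_def algebra_simps)
          ultimately show ?thesis using s[of x "- r"] by (simp only: f_sym; argo)
        qed
      qed
      then show ?thesis unfolding x by blast
    qed
  qed
  show "convex_on UNIV (\<lambda>x. f x - f1 r d x)"
  proof (rule convex_if_subgradients)
    fix x
    have h0: "0 \<le> f y - f1 r d y" for y using d[of "\<bar>y\<bar>"] by (simp add: f1_def f_abs)
    consider "\<bar>x\<bar> \<le> r" | "r < x" | "x < - r" by linarith
    then show "\<exists>k. \<forall>y. f x - f1 r d x + k * (y - x) \<le> f y - f1 r d y"
    proof cases
      case 1 then show ?thesis using h0 by (intro exI[of _ 0]) (simp add: f1_def)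
    next
      case 2
      have x: "f x - f1 r d x = f x - f r - d * (x - r)" using 2 r by (simp add: f1_def)
      have "f x - f r - d * (x - r) + (s x - d) * (y - x) \<le> f y - f1 r d y" for y
      proof (cases "r < y")
        case True
        then have "f1 r d y = f r + d * (y - r)" using r by (simp add: f1_def)
        then show ?thesis using s[of x y] by (simp add: algebra_simps)
      next
        case False
        have "(s x - d) * (y - x) \<le> (s x - d) * (r - x)" using s3[OF 2] False by (intro mult_left_mono) auto
        moreover have "f x - f r - d * (x - r) + (s x - d) * (r - x) = f x - f r + s x * (r - x)" by (simp add: algebra_simps)
        ultimately show ?thesis using s[of x r] h0[of y] by linarith
      qed
      then show ?thesis unfolding x by blast
    next
      case 3
      have x: "f x - f1 r d x = f x - f r - d * (- x - r)" using 3 r by (simp add: f1_def)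
      have "f x - f r - d * (- x - r) + (s x + d) * (y - x) \<le> f y - f1 r d y" for y
      proof (cases "y < - r")
        case True
        then have "f1 r d y = f r + d * (- y - r)" using r by (simp add: f1_def)
        then show ?thesis using s[of x y] by (simp add: algebra_simps)
      next
        case False
        have "(s x + d) * (y - x) \<le> (s x + d) * (- r - x)" using s4[OF 3] False by (intro mult_left_mono_neg) auto
        moreover have "f x - f r - d * (- x - r) + (s x + d) * (- r - x) = f x - f r + s x * (- r - x)" by (simp add: algebra_simps)
        ultimately show ?thesis using s[of x "- r"] h0[of y] by (simp add: f_sym)
      qed
      then show ?thesis unfolding x by blast
    qed
  qed
  show "\<bar>f1 r d x - d * \<bar>x\<bar>\<bar> \<le> d * r"
  proof (cases "\<bar>x\<bar> \<le> r")
    case True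
    have "d * \<bar>x\<bar> \<le> d * r" using True d0 by (intro mult_left_mono) auto
    moreover have "f x \<le> f r" using True by (intro f_mono) auto
    moreover have "0 \<le> d * \<bar>x\<bar>" using d0 by simp
    ultimately show ?thesis using True frd f_nonneg[of x] by (simp add: f1_def)
  next
    case False
    then have "f1 r d x - d * \<bar>x\<bar> = f r - d * r" by (simp add: f1_def right_diff_distrib)
    then show ?thesis using frd f_nonneg[of r] by simp
  qed
qed

text \<open>Both parts of \<open>f = f1 r d + (f - f1 r d)\<close> are convex, so equality for \<open>f\<close> forces equality for
  \<open>f1 r d\<close>, which is within \<open>d * r\<close> of \<open>d * \<bar>x\<bar>\<close>.\<close>

lemma shifts_determine:
  assumes a: "real_distribution \<alpha>" "integrable \<alpha> (\<lambda>x. x)" "integrable \<alpha> f"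
    and b: "real_distribution \<gamma>" "integrable \<gamma> (\<lambda>x. x)" "integrable \<gamma> f"
    and cx: "\<And>G. convex_on UNIV G \<Longrightarrow> integrable \<gamma> G \<Longrightarrow> integrable \<alpha> G \<Longrightarrow> (\<integral>x. G x \<partial>\<gamma>) \<le> (\<integral>x. G x \<partial>\<alpha>)"
    and eq: "\<And>x. (\<integral>y. f (y + x) \<partial>\<alpha>) = (\<integral>y. f (y + x) \<partial>\<gamma>)"
  shows "\<alpha> = \<gamma>"
proof (rule abs_moments_determine[OF a(1,2) b(1,2)])
  fix k
  \<comment> \<open>The slope \<open>d\<close> depends on \<open>r\<close> and may tend to 0 with
    it. This does no harm: two errors of size \<open>d * r\<close>, divided by \<open>d\<close>,
    leave \<open>2 * r\<close>.\<close>
  have "\<bar>(\<integral>y. \<bar>y - k\<bar> \<partial>\<alpha>) - (\<integral>y. \<bar>y - k\<bar> \<partial>\<gamma>)\<bar> \<le> 2 * r" if r: "0 < r" for r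
  proof -
    obtain d where d: "\<And>y. f r + d * (y - r) \<le> f y" using convex_subgradient[OF f_convex, of r] by blast
    note S = f1_split[OF r d]
    define g where "g y = f1 r d (y + (- k))" for y
    define h where "h y = f (y + (- k)) - g y" for y
    have gm: "g \<in> borel_measurable borel" unfolding g_def[abs_def] f1_def[abs_def] by measurable
    have gb: "\<bar>g y - d * \<bar>y - k\<bar>\<bar> \<le> d * r" for y using S(4)[of "y + (- k)"] by (simp add: g_def)
    have gi: "integrable \<beta> g" if "real_distribution \<beta>" "integrable \<beta> (\<lambda>x. x)" for \<beta>
    proof (rule real_distribution.integrable_linear_growth[OF that gm])
      fix y
      have "d * \<bar>y - k\<bar> \<le> d * (\<bar>y\<bar> + \<bar>k\<bar>)" using S(1) by (intro mult_left_mono) auto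
      moreover have "0 \<le> d * \<bar>y - k\<bar>" using S(1) by simp
      ultimately show "\<bar>g y\<bar> \<le> (d * r + d * \<bar>k\<bar>) + d * \<bar>y\<bar>" using gb[of y] by (simp add: distrib_left)
    qed
    have hi: "integrable \<beta> h" if "real_distribution \<beta>" "integrable \<beta> (\<lambda>x. x)" "integrable \<beta> f" for \<beta>
      unfolding h_def[abs_def] by (intro Bochner_Integration.integrable_diff gi f_shift_integrable that)
    have g_cv: "convex_on UNIV g" unfolding g_def[abs_def] by (rule convex_shift(1)[OF S(2)])
    have h_cv: "convex_on UNIV h" unfolding h_def[abs_def] g_def by (rule convex_shift(1)[OF S(3)])
    have sum: "(\<integral>y. f (y + (- k)) \<partial>\<beta>) = (\<integral>y. g y \<partial>\<beta>) + (\<integral>y. h y \<partial>\<beta>)"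
      if "real_distribution \<beta>" "integrable \<beta> (\<lambda>x. x)" "integrable \<beta> f" for \<beta>
    proof -
      have e: "f (y + (- k)) = g y + h y" for y by (simp add: h_def)
      show ?thesis unfolding e by (rule Bochner_Integration.integral_add[OF gi[OF that(1,2)] hi[OF that]])
    qed
    have geq: "(\<integral>y. g y \<partial>\<alpha>) = (\<integral>y. g y \<partial>\<gamma>)"
      using cx[OF g_cv gi[OF b(1,2)] gi[OF a(1,2)]] cx[OF h_cv hi[OF b] hi[OF a]] sum[OF a] sum[OF b] eq[of "- k"] by linarith
    have close: "\<bar>d * (\<integral>y. \<bar>y - k\<bar> \<partial>\<beta>) - (\<integral>y. g y \<partial>\<beta>)\<bar> \<le> d * r" if B: "real_distribution \<beta>" "integrable \<beta> (\<lambda>x. x)" for \<beta>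
    proof -
      interpret b: real_distribution \<beta> by fact
      have i: "integrable \<beta> (\<lambda>y. d * \<bar>y - k\<bar>)" using B(2) by (intro integrable_mult_right integrable_abs Bochner_Integration.integrable_diff) auto
      have "\<bar>\<integral>y. d * \<bar>y - k\<bar> - g y \<partial>\<beta>\<bar> \<le> (\<integral>y. \<bar>d * \<bar>y - k\<bar> - g y\<bar> \<partial>\<beta>)" by (rule integral_abs_bound)
      also have "\<dots> \<le> (\<integral>y. d * r \<partial>\<beta>)"
        using gb i gi[OF B] by (intro integral_mono integrable_abs Bochner_Integration.integrable_diff) (auto simp: abs_minus_commute)
      finally show ?thesis using i gi[OF B] by simp
    qed
    have "\<bar>d * (\<integral>y. \<bar>y - k\<bar> \<partial>\<alpha>) - d * (\<integral>y. \<bar>y - k\<bar> \<partial>\<gamma>)\<bar> \<le> 2 * (d * r)"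
      using close[OF a(1,2)] close[OF b(1,2)] geq by linarith
    then have "d * \<bar>(\<integral>y. \<bar>y - k\<bar> \<partial>\<alpha>) - (\<integral>y. \<bar>y - k\<bar> \<partial>\<gamma>)\<bar> \<le> d * (2 * r)"
      using S(1) by (simp add: right_diff_distrib[symmetric] abs_mult)
    then show ?thesis using S(1) by simp
  qed
  then have "(\<integral>y. \<bar>y - k\<bar> \<partial>\<alpha>) - (\<integral>y. \<bar>y - k\<bar> \<partial>\<gamma>) = 0"
    by (intro dense_eq0_I) (metis field_sum_of_halves half_gt_zero mult_2)
  then show "(\<integral>y. \<bar>y - k\<bar> \<partial>\<alpha>) = (\<integral>y. \<bar>y - k\<bar> \<partial>\<gamma>)" by simp
qed

text \<open>By symmetry the shifts by \<open>c\<close> and by \<open>- c\<close> have the same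
  integral, so the nonnegative second difference \<open>P\<close> integrates to 0 and vanishes
  identically. Its value at 0 is \<open>2 * f c\<close>.\<close>

lemma gau_shift_eq_imp_zero:
  assumes v: "0 < v" and le: "(\<integral>x. f (x + c) \<partial>gau v) \<le> (\<integral>x. f x \<partial>gau v)"
  shows "c = 0"
proof -
  define P where "P x = f (x + c) + f (x + (- c)) - 2 * f x" for x
  have P0: "0 \<le> P x" for x using convex_midpoint[OF f_convex, of x c] by (simp add: P_def)
  have sy: "(\<integral>x. f (x + (- c)) \<partial>gau v) = (\<integral>x. f (x + c) \<partial>gau v)"
  proof -
    have "f (x + (- c)) = f (- x + c)" for x using f_sym[of "x - c"] by simp
    then show ?thesis using gau_symmetric[of v "\<lambda>x. f (x + c)"] v by simp
  qed
  have Pi: "integrable (gau v) P"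
    unfolding P_def[abs_def] by (intro Bochner_Integration.integrable_diff Bochner_Integration.integrable_add integrable_mult_right f_gau_shift f_gau)
  have "(\<integral>x. P x \<partial>gau v) = (\<integral>x. f (x + c) \<partial>gau v) + (\<integral>x. f (x + (- c)) \<partial>gau v) - 2 * (\<integral>x. f x \<partial>gau v)"
    unfolding P_def
    by (subst Bochner_Integration.integral_diff) (auto intro!: Bochner_Integration.integrable_add f_gau_shift f_gau simp: f_gau_shift[of _ "- c", simplified] f_gau_shift)
  then have "(\<integral>x. P x \<partial>gau v) \<le> 0" using le sy by linarith
  moreover have "0 \<le> (\<integral>x. P x \<partial>gau v)" using P0 by (intro Bochner_Integration.integral_nonneg) auto
  ultimately have "(\<integral>x. P x \<partial>gau v) = 0" by linarith
  then have "AE x in gau v. P x = 0"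
    using integral_nonneg_eq_0_iff_AE[OF Pi] P0 by simp
  moreover have "continuous_on UNIV P"
    unfolding P_def[abs_def] by (intro continuous_intros continuous_on_compose2[OF f_cont]) auto
  ultimately have "P 0 = 0" by (intro gau_AE_zero_imp_zero[OF v]) auto
  then have "f c = 0" by (simp add: P_def f_sym)
  then show ?thesis using f_pos[of c] by auto
qed

text \<open>Let \<open>A\<close> and \<open>N\<close> be the averages of \<open>f\<close> over
  shifts by \<open>\<alpha>\<close> and by \<open>gau va\<close>. Each of the following is at least
  the next: the moment under \<open>\<beta> \<star> \<alpha>\<close>, the integral of
  \<open>A\<close> over \<open>gau vb\<close>, the integral of \<open>N\<close> over
  \<open>gau vb\<close>, and the unshifted normal moment; the shift by \<open>c\<close> applies to
  all but the last. The hypothesis \<open>le\<close> closes the chain. Its last link gives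
  \<open>c = 0\<close>; the link between \<open>A\<close> and \<open>N\<close> gives
  \<open>A = N\<close> everywhere, by continuity and full support of \<open>gau vb\<close>, and then
  \<open>shifts_determine\<close> applies.\<close>

lemma equality_core:
  assumes a: "real_distribution \<alpha>" "integrable \<alpha> (\<lambda>x. x)" "integrable \<alpha> f"
    and b: "real_distribution \<beta>" "integrable \<beta> (\<lambda>x. x)"
    and v: "0 \<le> va" "0 < vb"
    and cxa: "\<And>G. convex_on UNIV G \<Longrightarrow> integrable (gau va) G \<Longrightarrow> integrable \<alpha> G \<Longrightarrow> (\<integral>x. G x \<partial>gau va) \<le> (\<integral>x. G x \<partial>\<alpha>)"
    and cxb: "\<And>G. convex_on UNIV G \<Longrightarrow> integrable (gau vb) G \<Longrightarrow> integrable \<beta> G \<Longrightarrow> (\<integral>x. G x \<partial>gau vb) \<le> (\<integral>x. G x \<partial>\<beta>)"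
    and int: "integrable (\<beta> \<star> \<alpha>) (\<lambda>x. f (x + c))"
    and le: "(\<integral>x. f (x + c) \<partial>(\<beta> \<star> \<alpha>)) \<le> (\<integral>x. f x \<partial>gau (vb + va))"
  shows "c = 0 \<and> \<alpha> = gau va"
proof -
  interpret a: real_distribution \<alpha> by fact
  note R = real_distribution_gau
  define A where "A x = (\<integral>y. f (y + x) \<partial>\<alpha>)" for x
  define N where "N x = (\<integral>y. f (y + x) \<partial>gau va)" for x
  have fai: "integrable \<alpha> (\<lambda>y. f (y + x))" for x by (rule f_shift_integrable[OF a(1,3)])
  have fgi: "integrable (gau va) (\<lambda>y. f (y + x))" for x by (rule f_gau_shift)
  have cvx: "convex_on UNIV (\<lambda>x. \<integral>y. f (y + x) \<partial>\<beta>)" if "\<And>x. integrable \<beta> (\<lambda>y. f (y + x))" for \<beta>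
  proof (rule convex_onI)
    fix t x y :: real assume t: "0 < t" "t < 1"
    have "(\<integral>z. f (z + ((1 - t) *\<^sub>R x + t *\<^sub>R y)) \<partial>\<beta>) \<le> (\<integral>z. (1 - t) * f (z + x) + t * f (z + y) \<partial>\<beta>)"
    proof (intro integral_mono Bochner_Integration.integrable_add integrable_mult_right that)
      fix z
      have "z + ((1 - t) *\<^sub>R x + t *\<^sub>R y) = (1 - t) *\<^sub>R (z + x) + t *\<^sub>R (z + y)" by (simp add: algebra_simps)
      then show "f (z + ((1 - t) *\<^sub>R x + t *\<^sub>R y)) \<le> (1 - t) * f (z + x) + t * f (z + y)"
        using convex_onD[OF f_convex, of t "z + x" "z + y"] t by simp
    qed
    also have "\<dots> = (1 - t) * (\<integral>z. f (z + x) \<partial>\<beta>) + t * (\<integral>z. f (z + y) \<partial>\<beta>)" using that by simp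
    finally show "(\<integral>z. f (z + ((1 - t) *\<^sub>R x + t *\<^sub>R y)) \<partial>\<beta>) \<le> (1 - t) * (\<integral>z. f (z + x) \<partial>\<beta>) + t * (\<integral>z. f (z + y) \<partial>\<beta>)" .
  qed auto
  have Acv: "convex_on UNIV A" unfolding A_def[abs_def] by (rule cvx[OF fai])
  have Ncv: "convex_on UNIV N" unfolding N_def[abs_def] by (rule cvx[OF fgi])
  have cont: "continuous_on UNIV A" "continuous_on UNIV N" using Acv Ncv by (auto intro: convex_on_continuous)
  have NA: "N x \<le> A x" for x
    unfolding N_def A_def by (rule cxa[OF convex_shift(1)[OF f_convex] fgi fai])
  have Am[measurable]: "A \<in> borel_measurable borel" and Nm[measurable]: "N \<in> borel_measurable borel"
    using cont by (auto intro: borel_measurable_continuous_onI)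
  have A0: "0 \<le> A x" "0 \<le> N x" for x unfolding A_def N_def using f_nonneg by (auto intro!: Bochner_Integration.integral_nonneg)
  have Agi: "integrable (gau vb) (\<lambda>x. A (x + c))"
  proof (rule Bochner_Integration.integrable_bound)
    show "integrable (gau vb) (\<lambda>x. D / 2 * ((\<integral>y. f y \<partial>\<alpha>) + f (x + c)))"
    proof -
      interpret n: real_distribution "gau vb" by (rule R)
      show ?thesis by (intro integrable_mult_right Bochner_Integration.integrable_add f_gau_shift n.integrable_const)
    qed
    show "AE x in gau vb. norm (A (x + c)) \<le> norm (D / 2 * ((\<integral>y. f y \<partial>\<alpha>) + f (x + c)))"
    proof (rule AE_I2)
      fix x
      have "A (x + c) \<le> (\<integral>y. D / 2 * (f y + f (x + c)) \<partial>\<alpha>)"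
        unfolding A_def using a(3) by (intro integral_mono fai f_add) auto
      also have "\<dots> = D / 2 * ((\<integral>y. f y \<partial>\<alpha>) + f (x + c))" using a(3) by simp
      finally show "norm (A (x + c)) \<le> norm (D / 2 * ((\<integral>y. f y \<partial>\<alpha>) + f (x + c)))" using A0(1)[of "x + c"] by simp
    qed
    show "(\<lambda>x. A (x + c)) \<in> borel_measurable (gau vb)" by (simp add: gau_def)
  qed
  have Ngi: "integrable (gau vb) (\<lambda>x. N (x + c))"
  proof (rule Bochner_Integration.integrable_bound[OF Agi])
    show "(\<lambda>x. N (x + c)) \<in> borel_measurable (gau vb)" by (simp add: gau_def)
  qed (use NA A0 in \<open>auto simp: abs_of_nonneg\<close>)
  have ord: "f (x + y + c) = f (y + (x + c))" for x y by (simp add: add_ac)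
  have Abi: "integrable \<beta> (\<lambda>x. A (x + c))" and Aeq: "(\<integral>x. f (x + c) \<partial>(\<beta> \<star> \<alpha>)) = (\<integral>x. A (x + c) \<partial>\<beta>)"
    using convolution_integral(1,2)[OF b(1) a(1) int] unfolding A_def ord by auto
  have gN: "(\<integral>x. f (x + c) \<partial>gau (vb + va)) = (\<integral>x. N (x + c) \<partial>gau vb)"
  proof -
    have g: "gau (vb + va) = (gau vb \<star> gau va)" using gau_convolution[of vb va] v by simp
    have "integrable (gau vb \<star> gau va) (\<lambda>x. f (x + c))" unfolding g[symmetric] by (rule f_gau_shift)
    from convolution_integral(2)[OF R R this] show ?thesis unfolding g N_def ord .
  qed
  have sym_le: "(\<integral>x. f x \<partial>gau (vb + va)) \<le> (\<integral>x. f (x + c) \<partial>gau (vb + va))"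
  proof -
    have "(\<integral>x. f (x + (- c)) \<partial>gau (vb + va)) = (\<integral>x. f (x + c) \<partial>gau (vb + va))"
    proof -
      have "f (x + (- c)) = f (- x + c)" for x using f_sym[of "x - c"] by simp
      then show ?thesis using gau_symmetric[of "vb + va" "\<lambda>x. f (x + c)"] v by simp
    qed
    moreover have "2 * (\<integral>x. f x \<partial>gau (vb + va)) \<le> (\<integral>x. f (x + c) + f (x + (- c)) \<partial>gau (vb + va))"
      unfolding integral_mult_right_zero[symmetric]
      by (intro integral_mono integrable_mult_right Bochner_Integration.integrable_add f_gau f_gau_shift)
         (use convex_midpoint[OF f_convex] in simp)
    moreover have "(\<integral>x. f (x + c) + f (x + (- c)) \<partial>gau (vb + va)) = (\<integral>x. f (x + c) \<partial>gau (vb + va)) + (\<integral>x. f (x + (- c)) \<partial>gau (vb + va))"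
      by (intro Bochner_Integration.integral_add f_gau_shift)
    ultimately show ?thesis by linarith
  qed
  have "(\<integral>x. A (x + c) \<partial>gau vb) \<le> (\<integral>x. A (x + c) \<partial>\<beta>)"
    by (rule cxb[OF convex_shift(1)[OF Acv] Agi Abi])
  moreover have "(\<integral>x. N (x + c) \<partial>gau vb) \<le> (\<integral>x. A (x + c) \<partial>gau vb)"
    by (intro integral_mono Ngi Agi NA)
  ultimately have eq: "(\<integral>x. N (x + c) \<partial>gau vb) = (\<integral>x. A (x + c) \<partial>gau vb)" "(\<integral>x. f (x + c) \<partial>gau (vb + va)) \<le> (\<integral>x. f x \<partial>gau (vb + va))"
    using le sym_le gN Aeq by linarith+
  have c0: "c = 0" by (rule gau_shift_eq_imp_zero[OF _ eq(2)]) (use v in simp)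
  have di: "integrable (gau vb) (\<lambda>x. A (x + c) - N (x + c))" by (intro Bochner_Integration.integrable_diff Agi Ngi)
  have "(\<integral>x. A (x + c) - N (x + c) \<partial>gau vb) = 0" using Bochner_Integration.integral_diff[OF Agi Ngi] eq(1) by simp
  then have "AE x in gau vb. A (x + c) - N (x + c) = 0"
    using integral_nonneg_eq_0_iff_AE[OF di] NA by simp
  moreover have "continuous_on UNIV (\<lambda>x. A (x + c) - N (x + c))"
    by (intro continuous_intros continuous_on_compose2[OF cont(1)] continuous_on_compose2[OF cont(2)]) auto
  ultimately have "A (x + c) - N (x + c) = 0" for x by (intro gau_AE_zero_imp_zero[OF v(2)]) auto
  then have "A x = N x" for x using c0 by simp
  then have "\<alpha> = gau va"
    by (intro shifts_determine[OF a R gau_mom(1) f_gau cxa]) (simp_all add: A_def N_def)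
  then show ?thesis using c0 by simp
qed

end

context f_hemigroup
begin

text \<open>The value \<open>Kf\<close> belongs to the whole interval and also to the normal law of
  variance \<open>s2\<close>, so cutting \<open>[0,1]\<close> anywhere leaves no slack and
  \<open>equality_core\<close> applies. It needs a second factor of positive variance, hence the
  separate case \<open>s2 = 0\<close>: there \<open>f (y + m 1)\<close> vanishes almost surely and
  all first absolute moments are 0.\<close>

theorem gaussian_increments:
  assumes ae: "AE s in lborel. s \<in> {0..<1} \<longrightarrow> lim_at s" and s2: "0 \<le> s2" "(\<integral>x. f x \<partial>gau s2) = Kf"
  shows "m 1 = 0 \<and> (\<forall>s t. 0 \<le> s \<and> s \<le> t \<and> t \<le> 1 \<longrightarrow> \<mu> s t = gau (s2 * (t - s)))"
proof (cases "s2 = 0")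
  case True
  interpret r: real_distribution "\<mu> 0 1" by (rule law) auto
  have "(\<integral>y. f (y + m 1) \<partial>\<mu> 0 1) = 0"
  proof -
    have "(\<integral>x. f x \<partial>gau s2) = 0" unfolding True gau_0 by (subst integral_return) auto
    then show ?thesis using s2 by (simp add: Kf_def)
  qed
  then have "AE y in \<mu> 0 1. f (y + m 1) = 0"
    using integral_nonneg_eq_0_iff_AE[OF f_int] f_nonneg by simp
  then have ae0: "AE y in \<mu> 0 1. y = - m 1"
  proof eventually_elim
    case (elim y) then show ?case using f_pos[of "y + m 1"] by force
  qed
  have "(\<integral>y. y \<partial>\<mu> 0 1) = (\<integral>y. - m 1 \<partial>\<mu> 0 1)"
    by (rule integral_cong_AE) (use ae0 in auto)
  then have m1: "m 1 = 0" using mean[of 0 1] by simp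
  have "(\<integral>y. \<bar>y\<bar> \<partial>\<mu> 0 1) = (\<integral>y. 0 \<partial>\<mu> 0 1)"
    by (rule integral_cong_AE) (use ae0 m1 in auto)
  then have abs0: "(\<integral>y. \<bar>y\<bar> \<partial>\<mu> 0 1) = 0" by simp
  have "\<mu> s t = gau 0" if st: "0 \<le> s" "s \<le> t" "t \<le> 1" for s t
  proof (rule abs_moments_determine[OF law[OF st] mom[OF st] real_distribution_gau gau_mom(1)])
    fix k
    interpret l: real_distribution "\<mu> s t" by (rule law[OF st])
    interpret l0: real_distribution "\<mu> 0 s" by (rule law) (use st in auto)
    have ab: "convex_on UNIV (\<lambda>x::real. \<bar>x\<bar>)" using convex_abs[of 0] by simp
    have eqc: "\<mu> 0 t = (\<mu> s t \<star> \<mu> 0 s)"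
      using conv[of 0 s t] convolution_commute[OF law law, of 0 s s t] st by simp
    have i0: "integrable (\<mu> 0 t) (\<lambda>x. \<bar>x\<bar>)" using mom[of 0 t] st by simp
    have ist: "integrable (\<mu> s t) (\<lambda>x. \<bar>x\<bar>)" using mom[of s t] st by simp
    note C = convolution_integral[OF law[OF st] law[of 0 s] i0[unfolded eqc]]
    have "(\<integral>y. \<bar>y\<bar> \<partial>\<mu> s t) \<le> (\<integral>x. \<integral>y. \<bar>x + y\<bar> \<partial>\<mu> 0 s \<partial>\<mu> s t)"
    proof (rule integral_mono_AE[OF ist])
      show "integrable (\<mu> s t) (\<lambda>x. \<integral>y. \<bar>x + y\<bar> \<partial>\<mu> 0 s)" by (rule C(1)) (use st in auto)
      have "AE x in \<mu> s t. integrable (\<mu> 0 s) (\<lambda>y. \<bar>x + y\<bar>)" by (rule C(3)) (use st in auto)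
      then show "AE x in \<mu> s t. \<bar>x\<bar> \<le> (\<integral>y. \<bar>x + y\<bar> \<partial>\<mu> 0 s)"
        by eventually_elim (rule l0.jensen_shift[OF ab]; use mom[of 0 s] mean[of 0 s] st in auto)
    qed
    also have "\<dots> = (\<integral>x. \<bar>x\<bar> \<partial>\<mu> 0 t)" unfolding eqc by (rule C(2)[symmetric]) (use st in auto)
    also have "\<dots> \<le> 0" using abs_moment_le[of t] abs0 st by simp
    finally have "(\<integral>y. \<bar>y\<bar> \<partial>\<mu> s t) = 0" by (simp add: antisym Bochner_Integration.integral_nonneg)
    then have "AE y in \<mu> s t. y = 0" using integral_nonneg_eq_0_iff_AE[OF ist] by simp
    then have "(\<integral>y. \<bar>y - k\<bar> \<partial>\<mu> s t) = (\<integral>y. \<bar>k\<bar> \<partial>\<mu> s t)"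
      by (intro integral_cong_AE) (auto elim: eventually_mono)
    moreover have "(\<integral>y. \<bar>y - k\<bar> \<partial>gau 0) = \<bar>k\<bar>" unfolding gau_0 by (subst integral_return) auto
    ultimately show "(\<integral>y. \<bar>y - k\<bar> \<partial>\<mu> s t) = (\<integral>y. \<bar>y - k\<bar> \<partial>gau 0)" by simp
  qed
  then show ?thesis using m1 True by simp
next
  case False
  then have s2': "0 < s2" using s2 by simp
  have cx: "(\<integral>x. G x \<partial>gau (s2 * (b - a))) \<le> (\<integral>x. G x \<partial>\<mu> a b)"
    if "0 \<le> a" "a \<le> b" "b \<le> 1" "convex_on UNIV G" "integrable (gau (s2 * (b - a))) G" "integrable (\<mu> a b) G" for a b G
    by (rule gau_le_increment[OF that(1-3) _ gauss_var_lower[OF ae s2 that(1-3)] that(4-6)]) (use s2' that in auto)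
  have int01: "integrable (\<mu> 0 1) (\<lambda>x. f (x + m 1))" by (rule f_int)
  have le01: "(\<integral>x. f (x + m 1) \<partial>\<mu> 0 1) \<le> (\<integral>x. f x \<partial>gau s2)" using s2 by (simp add: Kf_def)
  \<comment> \<open>The second factor is \<open>\<mu> t 1\<close>, whose comparison variance
    \<open>s2 * (1 - t)\<close> is positive because \<open>t < 1\<close>.\<close>
  have A: "m 1 = 0 \<and> \<mu> 0 t = gau (s2 * (t - 0))" if t: "0 < t" "t < 1" for t
  proof (rule equality_core)
    have e: "(\<mu> t 1 \<star> \<mu> 0 t) = \<mu> 0 1"
      using conv[of 0 t 1] convolution_commute[OF law law, of 0 t t 1] t by simp
    show "integrable (\<mu> t 1 \<star> \<mu> 0 t) (\<lambda>x. f (x + m 1))" unfolding e by (rule int01)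
    have "s2 * (1 - t) + s2 * (t - 0) = s2" by (simp add: algebra_simps)
    then show "(\<integral>x. f (x + m 1) \<partial>(\<mu> t 1 \<star> \<mu> 0 t)) \<le> (\<integral>x. f x \<partial>gau (s2 * (1 - t) + s2 * (t - 0)))"
      unfolding e by (simp only: le01)
    show "\<And>G. convex_on UNIV G \<Longrightarrow> integrable (gau (s2 * (1 - t))) G \<Longrightarrow> integrable (\<mu> t 1) G \<Longrightarrow> (\<integral>x. G x \<partial>gau (s2 * (1 - t))) \<le> (\<integral>x. G x \<partial>\<mu> t 1)"
      by (rule cx) (use t in auto)
    show "\<And>G. convex_on UNIV G \<Longrightarrow> integrable (gau (s2 * (t - 0))) G \<Longrightarrow> integrable (\<mu> 0 t) G \<Longrightarrow> (\<integral>x. G x \<partial>gau (s2 * (t - 0))) \<le> (\<integral>x. G x \<partial>\<mu> 0 t)"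
      by (rule cx) (use t in auto)
  qed (use t s2' law mom f_integrable in auto)
  \<comment> \<open>The preceding step does not reach \<open>t = 1\<close>. Here the upper half is
    identified, with the lower half as second factor, and convolving both halves yields
    \<open>\<mu> 0 1\<close>.\<close>
  have B: "m 1 = 0 \<and> \<mu> (1/2) 1 = gau (s2 * (1 - 1/2))"
  proof (rule equality_core)
    have e: "(\<mu> 0 (1/2) \<star> \<mu> (1/2) 1) = \<mu> 0 1" using conv[of 0 "1/2" 1] by simp
    show "integrable (\<mu> 0 (1/2) \<star> \<mu> (1/2) 1) (\<lambda>x. f (x + m 1))" unfolding e by (rule int01)
    have "s2 * (1/2 - 0) + s2 * (1 - 1/2) = s2" by simp
    then show "(\<integral>x. f (x + m 1) \<partial>(\<mu> 0 (1/2) \<star> \<mu> (1/2) 1)) \<le> (\<integral>x. f x \<partial>gau (s2 * (1/2 - 0) + s2 * (1 - 1/2)))"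
      unfolding e by (simp only: le01)
    show "\<And>G. convex_on UNIV G \<Longrightarrow> integrable (gau (s2 * (1/2 - 0))) G \<Longrightarrow> integrable (\<mu> 0 (1/2)) G \<Longrightarrow> (\<integral>x. G x \<partial>gau (s2 * (1/2 - 0))) \<le> (\<integral>x. G x \<partial>\<mu> 0 (1/2))"
      by (rule cx) auto
    show "\<And>G. convex_on UNIV G \<Longrightarrow> integrable (gau (s2 * (1 - 1/2))) G \<Longrightarrow> integrable (\<mu> (1/2) 1) G \<Longrightarrow> (\<integral>x. G x \<partial>gau (s2 * (1 - 1/2))) \<le> (\<integral>x. G x \<partial>\<mu> (1/2) 1)"
      by (rule cx) auto
  qed (use s2' law mom f_integrable in auto)
  have Z: "\<mu> 0 t = gau (s2 * t)" if t: "0 \<le> t" "t \<le> 1" for t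
  proof -
    consider "t = 0" | "0 < t" "t < 1" | "t = 1" using t by linarith
    then show ?thesis
    proof cases
      case 1 then show ?thesis by (simp add: diag gau_0)
    next
      case 2 then show ?thesis using A by simp
    next
      case 3
      have "\<mu> 0 1 = (\<mu> 0 (1/2) \<star> \<mu> (1/2) 1)" by (rule conv) auto
      also have "\<dots> = (gau (s2 * (1/2)) \<star> gau (s2 * (1/2)))" using A[of "1/2"] B by simp
      also have "\<dots> = gau (s2 * (1/2) + s2 * (1/2))" by (rule gau_convolution) (use s2' in auto)
      finally show ?thesis using 3 by simp
    qed
  qed
  \<comment> \<open>Division of characteristic functions, as that of a normal law has no
    zeros.\<close>
  have "\<mu> s t = gau (s2 * (t - s))" if st: "0 \<le> s" "s \<le> t" "t \<le> 1" for s t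
  proof (rule Levy_uniqueness[OF law[OF st] real_distribution_gau], rule ext)
    fix u
    have p: "0 \<le> s2 * s" "0 \<le> s2 * t" "0 \<le> s2 * (t - s)" using s2' st by auto
    have "char (\<mu> 0 t) u = char (\<mu> 0 s) u * char (\<mu> s t) u"
      using conv[of 0 s t] char_convolution[OF law law, of 0 s s t] st by simp
    then have 1: "char (gau (s2 * t)) u = char (gau (s2 * s)) u * char (\<mu> s t) u" using Z st by simp
    have "gau (s2 * t) = (gau (s2 * s) \<star> gau (s2 * (t - s)))"
      using gau_convolution[OF p(1,3)] by (simp add: algebra_simps)
    then have 2: "char (gau (s2 * t)) u = char (gau (s2 * s)) u * char (gau (s2 * (t - s))) u"
      by (simp add: char_convolution real_distribution_gau)
    have "char (gau (s2 * s)) u \<noteq> 0" unfolding char_gau[OF p(1)] by simp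
    then show "char (\<mu> s t) u = char (gau (s2 * (t - s))) u" using 1 2 by simp
  qed
  then show ?thesis using B by simp
qed

end

text \<open>By Fubini almost every shift of the identity is integrable, and one such shift is
  enough. This works before any centring is possible.\<close>

lemma convolution_integrable_right:
  assumes a: "real_distribution \<alpha>" and b: "real_distribution \<beta>"
    and i: "integrable (\<alpha> \<star> \<beta>) (\<lambda>x. x)"
  shows "integrable \<beta> (\<lambda>x. x)"
proof -
  interpret a: real_distribution \<alpha> by fact
  interpret b: real_distribution \<beta> by fact
  obtain x where "integrable \<beta> (\<lambda>y. x + y)"
    using eventually_happens'[OF a.ae_filter_bot convolution_integral(3)[OF a b i]] by blast
  then have "integrable \<beta> (\<lambda>y. x + y - x)" by (rule Bochner_Integration.integrable_diff) simp
  then show ?thesis by simp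
qed

text \<open>Turns a combination of values of a process into one of its increments. In the induction
  step \<open>c (Suc n) * x (Suc n)\<close> is split into \<open>c (Suc n)\<close> times the last
  increment and a contribution to the coefficient of \<open>x n\<close>.\<close>

lemma abel_summation_ex:
  fixes c :: "nat \<Rightarrow> real"
  shows "\<exists>b B. \<forall>x :: nat \<Rightarrow> real. (\<Sum>i\<le>n. c i * x i) = B * x 0 + (\<Sum>j<n. b j * (x (Suc j) - x j))"
proof (induction n arbitrary: c)
  case 0
  show ?case by (intro exI[of _ c] exI[of _ "c 0"]) simp
next
  case (Suc n)
  obtain b B where b: "\<And>x :: nat \<Rightarrow> real. (\<Sum>i\<le>n. (c(n := c n + c (Suc n))) i * x i) = B * x 0 + (\<Sum>j<n. b j * (x (Suc j) - x j))"
    using Suc.IH[of "c(n := c n + c (Suc n))"] by blast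
  have "(\<Sum>i\<le>Suc n. c i * x i) = B * x 0 + (\<Sum>j<Suc n. (b(n := c (Suc n))) j * (x (Suc j) - x j))" for x
  proof -
    have e1: "(\<Sum>i<n. (c(n := c n + c (Suc n))) i * x i) = (\<Sum>i<n. c i * x i)" by (rule sum.cong) auto
    have e2: "(\<Sum>j<n. (b(n := c (Suc n))) j * (x (Suc j) - x j)) = (\<Sum>j<n. b j * (x (Suc j) - x j))" by (rule sum.cong) auto
    have s1: "(\<Sum>i\<le>n. c i * x i) = (\<Sum>i<n. c i * x i) + c n * x n" by (simp add: lessThan_Suc_atMost[symmetric])
    have s2: "(\<Sum>i\<le>n. (c(n := c n + c (Suc n))) i * x i) = (\<Sum>i<n. c i * x i) + (c n + c (Suc n)) * x n"
      unfolding lessThan_Suc_atMost[symmetric] sum.lessThan_Suc e1 by simp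
    show ?thesis using b[of x] unfolding s2 sum.atMost_Suc sum.lessThan_Suc e2 s1 by (simp add: algebra_simps)
  qed
  then show ?case by (intro exI allI)
qed

subsection \<open>Gaussian random variables\<close>

lemma gau_density:
  assumes v: "0 < v"
  shows "gau v = density lborel (\<lambda>x. ennreal (normal_density 0 (sqrt v) x))"
proof -
  interpret s: real_distribution std_normal_distribution by (rule real_dist_normal_dist)
  have "distributed std_normal_distribution lborel (\<lambda>z. z) std_normal_density"
    unfolding distributed_def by (simp add: distr_id2 cong: distr_cong)
  from s.normal_density_affine[OF this, of "sqrt v" 0]
  have "distributed std_normal_distribution lborel (\<lambda>z. sqrt v * z) (normal_density 0 (sqrt v))" using v by simp
  then have "distr std_normal_distribution lborel (\<lambda>z. sqrt v * z) = density lborel (normal_density 0 (sqrt v))"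
    by (rule distributed_distr_eq_density)
  moreover have "distr std_normal_distribution lborel (\<lambda>z. sqrt v * z) = gau v"
    unfolding gau_def by (rule distr_cong) auto
  ultimately show ?thesis by simp
qed

lemma gau_scale: "0 \<le> c \<Longrightarrow> distr (gau v) borel (\<lambda>x. c * x) = gau (c\<^sup>2 * v)"
  unfolding gau_def by (subst distr_distr) (auto simp: o_def real_sqrt_mult mult.assoc intro!: distr_cong)

lemma (in prob_space) gaussian_rv_of_char:
  assumes Z [measurable]: "Z \<in> borel_measurable M" and v: "0 \<le> v"
    and ch: "\<And>u. char (distr M borel Z) u = iexp (u * a) * exp (- (v * u\<^sup>2 / 2))"
  shows "gaussian_rv M Z"
proof -
  have eq: "distr M borel (\<lambda>\<omega>. Z \<omega> - a) = gau v"
  proof (rule Levy_uniqueness)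
    show "real_distribution (distr M borel (\<lambda>\<omega>. Z \<omega> - a))" by (rule real_distribution_distr) measurable
    show "char (distr M borel (\<lambda>\<omega>. Z \<omega> - a)) = char (gau v)"
    proof
      fix u
      have "char (distr M borel (\<lambda>\<omega>. Z \<omega> - a)) u = (\<integral>\<omega>. iexp (u * (Z \<omega> - a)) \<partial>M)"
        unfolding char_def by (subst integral_distr) auto
      also have "\<dots> = (\<integral>\<omega>. iexp (- (u * a)) * iexp (u * Z \<omega>) \<partial>M)"
        by (rule Bochner_Integration.integral_cong) (auto simp: exp_add[symmetric] algebra_simps)
      also have "\<dots> = iexp (- (u * a)) * (\<integral>\<omega>. iexp (u * Z \<omega>) \<partial>M)" by (rule integral_mult_right_zero)
      also have "(\<integral>\<omega>. iexp (u * Z \<omega>) \<partial>M) = char (distr M borel Z) u"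
        unfolding char_def by (subst integral_distr) auto
      also have "iexp (- (u * a)) * char (distr M borel Z) u = (iexp (- (u * a)) * iexp (u * a)) * exp (- (v * u\<^sup>2 / 2))"
        unfolding ch by (simp only: mult.assoc)
      also have "iexp (- (u * a)) * iexp (u * a) = 1" by (simp add: exp_add[symmetric])
      finally show "char (distr M borel (\<lambda>\<omega>. Z \<omega> - a)) u = char (gau v) u" using v by (simp add: char_gau)
    qed
  qed (rule real_distribution_gau)
  show ?thesis
  proof (cases "v = 0")
    case True
    have "AE x in distr M borel (\<lambda>\<omega>. Z \<omega> - a). x = 0"
      unfolding eq True gau_0 by (subst AE_return) auto
    then have "AE \<omega> in M. Z \<omega> - a = 0" by (subst (asm) AE_distr_iff) auto
    then have "AE \<omega> in M. Z \<omega> = a" by eventually_elim simp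
    then show ?thesis unfolding gaussian_rv_def using Z by blast
  next
    case False
    then have v0: "0 < v" "0 < sqrt v" using v by auto
    have "distr M lborel (\<lambda>\<omega>. Z \<omega> - a) = distr M borel (\<lambda>\<omega>. Z \<omega> - a)" by (rule distr_cong) auto
    then have "distributed M lborel (\<lambda>\<omega>. Z \<omega> - a) (normal_density 0 (sqrt v))"
      unfolding distributed_def using eq gau_density[OF v0(1)] by simp
    from normal_density_affine[OF this v0(2), of 1 a]
    have "distributed M lborel Z (normal_density a (sqrt v))" by simp
    then show ?thesis unfolding gaussian_rv_def using Z v0(2) by blast
  qed
qed

lemma (in prob_space) gaussian_rv_moments:
  assumes "gaussian_rv M Z"
  shows "integrable M Z" "integrable M (\<lambda>\<omega>. (Z \<omega>)\<^sup>2)"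
proof -
  have Z [measurable]: "Z \<in> borel_measurable M" using assms by (simp add: gaussian_rv_def)
  have "integrable M Z \<and> integrable M (\<lambda>\<omega>. (Z \<omega>)\<^sup>2)"
    using assms unfolding gaussian_rv_def
  proof (elim conjE disjE exE)
    fix c assume c: "AE \<omega> in M. Z \<omega> = c"
    have "integrable M Z \<longleftrightarrow> integrable M (\<lambda>_. c)" by (rule integrable_cong_AE) (use c in auto)
    moreover have "integrable M (\<lambda>\<omega>. (Z \<omega>)\<^sup>2) \<longleftrightarrow> integrable M (\<lambda>_. c\<^sup>2)"
      by (rule integrable_cong_AE) (use c in \<open>auto elim: eventually_mono\<close>)
    ultimately show ?thesis by simp
  next
    fix a s :: real assume s: "s > 0" and D: "distributed M lborel Z (normal_density a s)"
    have 1: "integrable lborel (\<lambda>x. normal_density a s x * (x - a) ^ k)" for k by (rule integrable_normal_moment[OF s])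
    have "integrable lborel (\<lambda>x. normal_density a s x * x)"
      using Bochner_Integration.integrable_add[OF 1[of 1] integrable_mult_right[OF 1[of 0], of a]]
      by (simp add: algebra_simps)
    moreover have "integrable lborel (\<lambda>x. normal_density a s x * x\<^sup>2)"
      using Bochner_Integration.integrable_add[OF Bochner_Integration.integrable_add[OF 1[of 2] integrable_mult_right[OF 1[of 1], of "2 * a"]] integrable_mult_right[OF 1[of 0], of "a\<^sup>2"]]
      by (simp add: algebra_simps power2_eq_square)
    ultimately show ?thesis
      using distributed_integrable[OF D, of "\<lambda>x. x"] distributed_integrable[OF D, of "\<lambda>x. x\<^sup>2"] by auto
  qed
  then show "integrable M Z" "integrable M (\<lambda>\<omega>. (Z \<omega>)\<^sup>2)" by auto
qed

lemma (in prob_space) gaussian_rv_law: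
  assumes Z: "gaussian_rv M Z" and m: "expectation Z = 0" and v: "expectation (\<lambda>\<omega>. (Z \<omega>)\<^sup>2) = v" "0 < v"
  shows "distr M borel Z = gau v"
  using Z unfolding gaussian_rv_def
proof (elim conjE disjE exE)
  fix c assume [measurable]: "Z \<in> borel_measurable M" and c: "AE \<omega> in M. Z \<omega> = c"
  have "expectation Z = expectation (\<lambda>_. c)" by (rule integral_cong_AE) (use c in auto)
  then have "c = 0" using m prob_space by simp
  have "expectation (\<lambda>\<omega>. (Z \<omega>)\<^sup>2) = expectation (\<lambda>_. c\<^sup>2)"
    by (rule integral_cong_AE) (use c in \<open>auto elim: eventually_mono\<close>)
  then show ?thesis using v \<open>c = 0\<close> by simp
next
  fix a s :: real assume s: "s > 0" and D: "distributed M lborel Z (normal_density a s)"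
  have a: "a = 0" using normal_distributed_expectation[OF s D] m by simp
  have "s\<^sup>2 = v" using normal_distributed_variance[OF s D] m v by simp
  then have "sqrt v = s" using s by (metis real_sqrt_abs abs_of_pos)
  moreover have "distr M lborel Z = distr M borel Z" by (rule distr_cong) auto
  ultimately show ?thesis using distributed_distr_eq_density[OF D] a gau_density[OF v(2)] by simp
qed

text \<open>The increment is a linear combination, hence Gaussian, with mean 0 and variance
  \<open>t + s - 2 * min t s\<close>, which is \<open>t - s\<close>; these two moments fix the
  law.\<close>

lemma brownian_increment_law:
  assumes W: "std_brownian_motion N W" and st: "0 \<le> s" "s < t" "t \<le> 1"
  shows "distr N borel (\<lambda>\<omega>. W t \<omega> - W s \<omega>) = gau (t - s)"
proof -
  interpret prob_space N using W by (simp add: std_brownian_motion_def)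
  have G: "gaussian_rv N (\<lambda>\<omega>. \<Sum>r\<in>J. c r * W r \<omega>)" if "finite J" "J \<subseteq> {0..1}" for J c
    using W that by (simp add: std_brownian_motion_def gaussian_process_def)
  have M: "expectation (W r) = 0" "expectation (\<lambda>\<omega>. W r \<omega> * W q \<omega>) = min r q" if "r \<in> {0..1}" "q \<in> {0..1}" for r q
    using W that by (auto simp: std_brownian_motion_def)
  have g: "gaussian_rv N (W r)" if "r \<in> {0..1}" for r
    using G[of "{r}" "\<lambda>_. 1"] that by simp
  have "gaussian_rv N (\<lambda>\<omega>. \<Sum>r\<in>{s, t}. (if r = t then 1 else - 1) * W r \<omega>)" by (rule G) (use st in auto)
  then have gD: "gaussian_rv N (\<lambda>\<omega>. W t \<omega> - W s \<omega>)" using st by simp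
  have r: "s \<in> {0..1}" "t \<in> {0..1}" using st by auto
  note i = gaussian_rv_moments[OF g[OF r(1)]] gaussian_rv_moments[OF g[OF r(2)]] gaussian_rv_moments[OF gD]
  have [measurable]: "W t \<in> borel_measurable N" "W s \<in> borel_measurable N" using g[OF r(1)] g[OF r(2)] by (auto simp: gaussian_rv_def)
  \<comment> \<open>Polarization: the Gaussian property gives integrable squares of linear
    combinations, and the product is expressed by these.\<close>
  have ip: "integrable N (\<lambda>\<omega>. W t \<omega> * W s \<omega>)"
  proof -
    have "integrable N (\<lambda>\<omega>. ((W t \<omega>)\<^sup>2 + (W s \<omega>)\<^sup>2 - (W t \<omega> - W s \<omega>)\<^sup>2) / 2)" using i by auto
    moreover have "((x::real)\<^sup>2 + y\<^sup>2 - (x - y)\<^sup>2) / 2 = x * y" for x y by (simp add: power2_eq_square algebra_simps)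
    ultimately show ?thesis by simp
  qed
  have e2: "(W t \<omega> - W s \<omega>)\<^sup>2 = W t \<omega> * W t \<omega> + W s \<omega> * W s \<omega> - 2 * (W t \<omega> * W s \<omega>)" for \<omega>
    by (simp add: power2_eq_square algebra_simps)
  have "expectation (\<lambda>\<omega>. (W t \<omega> - W s \<omega>)\<^sup>2) = t + s - 2 * s"
    unfolding e2 using i ip M(2)[OF r(2,2)] M(2)[OF r(1,1)] M(2)[OF r(2,1)] st by (simp add: power2_eq_square)
  moreover have "expectation (\<lambda>\<omega>. W t \<omega> - W s \<omega>) = 0" using i M(1)[OF r(1,1)] M(1)[OF r(2,2)] by simp
  ultimately show ?thesis by (intro gaussian_rv_law[OF gD]) (use st in auto)
qed

section \<open>The function \<Psi>\<close>

context growth_function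
begin

lemma Psi_integrable: "integrable std_normal (\<lambda>w. f (x * w))"
proof -
  have "integrable std_normal_distribution (\<lambda>z. f (sqrt (x\<^sup>2) * z))"
    using f_gau[of "x\<^sup>2"] by (subst (asm) integrable_gau_iff) auto
  moreover have "f (sqrt (x\<^sup>2) * z) = f (x * z)" for z
    by (metis f_abs abs_mult real_sqrt_abs abs_idempotent)
  ultimately show ?thesis by (simp add: std_normal_def)
qed

lemma Psi_eq_gau: "0 \<le> x \<Longrightarrow> Psi f x = (\<integral>z. f z \<partial>gau (x\<^sup>2))"
  by (simp add: Psi_def std_normal_def integral_gau)

lemma Psi_0: "Psi f 0 = 0"
  by (simp add: Psi_def)

lemma Psi_strict_mono: "strict_mono_on {0..} (Psi f)"
  by (intro strict_mono_onI) (simp add: Psi_eq_gau gau_f_strict_mono power_strict_mono)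

text \<open>Convexity on the whole line yields continuity everywhere, including the end point 0 of
  the range of interest, and also unboundedness.\<close>

lemma Psi_convex: "convex_on UNIV (Psi f)"
proof (intro convex_onI)
  fix t x y :: real assume t: "0 < t" "t < 1"
  have "Psi f ((1 - t) *\<^sub>R x + t *\<^sub>R y) \<le> (\<integral>w. (1 - t) * f (x * w) + t * f (y * w) \<partial>std_normal)"
    unfolding Psi_def
  proof (rule integral_mono[OF Psi_integrable])
    show "integrable std_normal (\<lambda>w. (1 - t) * f (x * w) + t * f (y * w))" using Psi_integrable by simp
    fix w
    have "((1 - t) *\<^sub>R x + t *\<^sub>R y) * w = (1 - t) *\<^sub>R (x * w) + t *\<^sub>R (y * w)" by (simp add: algebra_simps)
    then show "f (((1 - t) *\<^sub>R x + t *\<^sub>R y) * w) \<le> (1 - t) * f (x * w) + t * f (y * w)"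
      using convex_onD[OF f_convex, of t "x * w" "y * w"] t by simp
  qed
  also have "\<dots> = (1 - t) * Psi f x + t * Psi f y" using Psi_integrable by (simp add: Psi_def)
  finally show "Psi f ((1 - t) *\<^sub>R x + t *\<^sub>R y) \<le> (1 - t) * Psi f x + t * Psi f y" .
qed auto

lemma Psi_continuous: "continuous_on S (Psi f)"
  using convex_on_continuous[OF open_UNIV Psi_convex] by (rule continuous_on_subset) simp

text \<open>Convexity and \<open>Psi f 0 = 0\<close> give \<open>x * Psi f 1 \<le> Psi f x\<close>
  for \<open>x \<ge> 1\<close>, so large values are attained; the intermediate value theorem
  supplies the others.\<close>

lemma Psi_range:
  assumes K: "0 \<le> K"
  shows "K \<in> Psi f ` {0..}"
proof -
  have P1: "0 < Psi f 1"
    using strict_mono_onD[OF Psi_strict_mono, of 0 1] by (simp add: Psi_0)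
  define x where "x = max 1 (K / Psi f 1)"
  have x: "1 \<le> x" "K / Psi f 1 \<le> x" by (auto simp: x_def)
  have "Psi f ((1 - 1 / x) *\<^sub>R 0 + (1 / x) *\<^sub>R x) \<le> (1 - 1 / x) * Psi f 0 + (1 / x) * Psi f x"
    by (rule convex_onD[OF Psi_convex]) (use x in auto)
  then have "x * Psi f 1 \<le> Psi f x" using x by (simp add: Psi_0 field_simps)
  then have "K \<le> Psi f x" using x P1 by (simp add: pos_divide_le_eq)
  then obtain y where "0 \<le> y" "Psi f y = K"
    using IVT'[of "Psi f" 0 K x] K x Psi_continuous by (auto simp: Psi_0)
  then show ?thesis by auto
qed

end

subsection \<open>Processes with independent increments\<close>

locale independent_increments_process = prob_space M
  for M :: "'a measure" +
  fixes X :: "real \<Rightarrow> 'a \<Rightarrow> real"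
  assumes increments: "independent_increments M X"
begin

lemma X_measurable: "0 \<le> t \<Longrightarrow> t \<le> 1 \<Longrightarrow> X t \<in> borel_measurable M"
  using increments by (auto simp: independent_increments_def)

lemma increments_indep_vars:
  fixes t :: "nat \<Rightarrow> real"
  assumes "t ` {..n} \<subseteq> {0..1}" "strict_mono_on {..n} t"
  shows "indep_vars (\<lambda>_. borel) (\<lambda>i \<omega>. X (t (Suc i)) \<omega> - X (t i) \<omega>) {..<n}"
  using increments assms by (simp add: independent_increments_def)

lemma increments_indep_var:
  assumes st: "0 \<le> s" "s < t" "t < u" "u \<le> 1"
  shows "indep_var borel (\<lambda>\<omega>. X t \<omega> - X s \<omega> - a) borel (\<lambda>\<omega>. X u \<omega> - X t \<omega> - b)"
proof -
  define p :: "nat \<Rightarrow> real" where "p i = (if i = 0 then s else if i = 1 then t else u)" for i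
  have "indep_vars (\<lambda>_. borel) (\<lambda>i \<omega>. X (p (Suc i)) \<omega> - X (p i) \<omega>) {..<2}"
  proof (rule increments_indep_vars)
    show "p ` {..2} \<subseteq> {0..1}" using st by (auto simp: p_def)
    show "strict_mono_on {..2} p"
      using st by (intro strict_mono_onI) (auto simp: p_def)
  qed
  moreover have "{..<2} = insert 0 {1::nat}" by auto
  ultimately have "indep_var borel (\<lambda>\<omega>. X t \<omega> - X s \<omega>) borel (\<lambda>\<omega>. X u \<omega> - X t \<omega>)"
    using indep_vars_sum[of "{1::nat}" 0 "\<lambda>i \<omega>. X (p (Suc i)) \<omega> - X (p i) \<omega>"] by (simp add: p_def)
  from indep_var_compose[OF this, of "\<lambda>x. x - a" borel "\<lambda>x. x - b" borel] show ?thesis by (simp add: o_def)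
qed

text \<open>The centring function is a parameter: integrability of the increments is derived with
  the zero function, before means are available, and only then is the mean function
  inserted.\<close>

definition increment_law :: "(real \<Rightarrow> real) \<Rightarrow> real \<Rightarrow> real \<Rightarrow> real measure" where
  "increment_law m s t = distr M borel (\<lambda>\<omega>. X t \<omega> - X s \<omega> - (m t - m s))"

lemma centred_increment_measurable:
  "0 \<le> s \<Longrightarrow> s \<le> t \<Longrightarrow> t \<le> 1 \<Longrightarrow> (\<lambda>\<omega>. X t \<omega> - X s \<omega> - (m t - m s)) \<in> borel_measurable M"
  using X_measurable[of s] X_measurable[of t] by simp

lemma real_distribution_increment_law:
  "0 \<le> s \<Longrightarrow> s \<le> t \<Longrightarrow> t \<le> 1 \<Longrightarrow> real_distribution (increment_law m s t)"
  unfolding increment_law_def by (intro real_distribution_distr centred_increment_measurable) auto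

lemma increment_law_refl: "increment_law m s s = return borel 0"
  by (simp add: increment_law_def)

lemma increment_law_conv:
  assumes st: "0 \<le> s" "s \<le> t" "t \<le> u" "u \<le> 1"
  shows "increment_law m s u = (increment_law m s t \<star> increment_law m t u)"
proof (rule Levy_uniqueness)
  have r: "real_distribution (increment_law m s t)" "real_distribution (increment_law m t u)"
    using st by (auto intro: real_distribution_increment_law)
  show "real_distribution (increment_law m s t \<star> increment_law m t u)" by (rule real_distribution_convolution[OF r])
  have c0: "char (return borel 0) v = 1" for v unfolding char_def by (subst integral_return) auto
  have "char (increment_law m s u) v = char (increment_law m s t) v * char (increment_law m t u) v" for v
  proof -
    \<comment> \<open>Independence is assumed for strictly increasing times, so empty intervals are
      treated apart.\<close>
    consider "s = t" | "t = u" | "s < t" "t < u" using st by linarith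
    then show ?thesis
    proof cases
      case 3
      have e: "increment_law m s u = distr M borel (\<lambda>\<omega>. (X t \<omega> - X s \<omega> - (m t - m s)) + (X u \<omega> - X t \<omega> - (m u - m t)))"
        unfolding increment_law_def by (rule distr_cong) auto
      show ?thesis unfolding e unfolding increment_law_def
        by (rule char_distr_add[OF increments_indep_var[OF st(1) 3 st(4)]])
    qed (simp_all add: increment_law_refl c0)
  qed
  then show "char (increment_law m s u) = char (increment_law m s t \<star> increment_law m t u)"
    using char_convolution[OF r] by auto
qed (use st in \<open>auto intro: real_distribution_increment_law\<close>)

lemma integrable_increment_law_iff:
  assumes "0 \<le> s" "s \<le> t" "t \<le> 1" "g \<in> borel_measurable borel"
  shows "integrable (increment_law m s t) g \<longleftrightarrow> integrable M (\<lambda>\<omega>. g (X t \<omega> - X s \<omega> - (m t - m s)) :: real)"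
  unfolding increment_law_def by (rule integrable_distr_eq[OF centred_increment_measurable]) (use assms in auto)

lemma integrable_increments:
  assumes i: "integrable M (\<lambda>\<omega>. X 1 \<omega> - X 0 \<omega>)" and t: "0 \<le> t" "t \<le> 1"
  shows "integrable M (\<lambda>\<omega>. X t \<omega> - X 0 \<omega>)"
proof -
  let ?L = "increment_law (\<lambda>_. 0)"
  have r: "real_distribution (?L 0 t)" "real_distribution (?L t 1)"
    using t by (auto intro: real_distribution_increment_law)
  have e: "?L 0 1 = (?L t 1 \<star> ?L 0 t)"
    using increment_law_conv[of 0 t 1] convolution_commute[OF r] t by simp
  have "integrable (?L 0 1) (\<lambda>x. x)" using i by (subst integrable_increment_law_iff) auto
  then have "integrable (?L 0 t) (\<lambda>x. x)" unfolding e by (rule convolution_integrable_right[OF r(2,1)])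
  then show ?thesis using t by (subst (asm) integrable_increment_law_iff) auto
qed

text \<open>A linear combination of values is a multiple of \<open>X 0\<close>, which is almost
  surely 0, plus a combination of independent increments, each a shifted normal variable. The
  product of their characteristic functions is again of normal form, possibly with variance
  0.\<close>

lemma gaussian_process_of_increments:
  assumes X0: "AE \<omega> in M. X 0 \<omega> = 0" and v: "0 \<le> v"
    and g: "\<And>s t. 0 \<le> s \<Longrightarrow> s \<le> t \<Longrightarrow> t \<le> 1 \<Longrightarrow> increment_law m s t = gau (v * (t - s))"
  shows "gaussian_process M X"
  unfolding gaussian_process_def
proof (intro allI impI, elim conjE)
  fix J :: "real set" and c :: "real \<Rightarrow> real" assume J: "finite J" "J \<subseteq> {0..1}"
  \<comment> \<open>Time 0 is added so that the partition starts at 0 and the boundary term of the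
    summation by parts is a multiple of \<open>X 0\<close>.\<close>
  define L where "L = sorted_list_of_set (insert 0 J)"
  define n where "n = card (insert 0 J) - 1"
  define p where "p i = L ! i" for i
  have "0 < card (insert 0 J)" using J card_gt_0_iff by blast
  then have len: "length L = Suc n" unfolding L_def n_def length_sorted_list_of_set by (rule Suc_diff_1[symmetric])
  have setL: "set L = insert 0 J" unfolding L_def by (rule set_sorted_list_of_set) (use J in simp)
  have srt: "sorted_wrt (<) L" unfolding L_def by (rule strict_sorted_list_of_set)
  have bij: "bij_betw p {..n} (insert 0 J)"
    unfolding p_def
  proof (rule bij_betw_nth)
    show "distinct L" unfolding L_def by (rule distinct_sorted_list_of_set)
    show "{..n} = {..<length L}" unfolding len lessThan_Suc_atMost ..
    show "insert 0 J = set L" by (rule setL[symmetric])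
  qed
  have im: "p ` {..n} = insert 0 J" using bij by (rule bij_betw_imp_surj_on)
  have sm: "strict_mono_on {..n} p"
    using sorted_wrt_nth_less[OF srt] len by (intro strict_mono_onI) (auto simp: p_def)
  have p01: "0 \<le> p i" "p i \<le> 1" if "i \<le> n" for i
  proof -
    have "p i \<in> insert 0 J" using im that by blast
    then show "0 \<le> p i" "p i \<le> 1" using J by auto
  qed
  have p0: "p 0 = 0"
  proof -
    obtain k where k: "k \<le> n" "p k = 0" using im by (metis atMost_iff imageE insertI1)
    then show ?thesis using strict_mono_onD[OF sm, of 0 k] p01[of 0] by (cases "k = 0") auto
  qed
  \<comment> \<open>The added time 0 gets coefficient 0 unless it was in \<open>J\<close>
    already.\<close>
  define c' where "c' t = (if t \<in> J then c t else 0)" for t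
  obtain b B where b: "\<And>x :: nat \<Rightarrow> real. (\<Sum>i\<le>n. c' (p i) * x i) = B * x 0 + (\<Sum>j<n. b j * (x (Suc j) - x j))"
    using abel_summation_ex[of "\<lambda>i. c' (p i)" n] by blast
  define D where "D j \<omega> = b j * (X (p (Suc j)) \<omega> - X (p j) \<omega>)" for j \<omega>
  have eq: "(\<Sum>t\<in>J. c t * X t \<omega>) = B * X 0 \<omega> + (\<Sum>j<n. D j \<omega>)" for \<omega>
  proof -
    have "(\<Sum>t\<in>J. c t * X t \<omega>) = (\<Sum>t\<in>insert 0 J. c' t * X t \<omega>)"
      using J by (intro sum.mono_neutral_cong_left) (auto simp: c'_def)
    also have "\<dots> = (\<Sum>i\<le>n. c' (p i) * X (p i) \<omega>)" by (rule sum.reindex_bij_betw[OF bij, symmetric])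
    finally show ?thesis using b[of "\<lambda>i. X (p i) \<omega>"] p0 by (simp add: D_def)
  qed
  have ind: "indep_vars (\<lambda>_. borel) D {..<n}"
  proof -
    have "indep_vars (\<lambda>_. borel) (\<lambda>i \<omega>. X (p (Suc i)) \<omega> - X (p i) \<omega>) {..<n}"
      by (rule increments_indep_vars[OF _ sm]) (use im J in auto)
    then have "indep_vars (\<lambda>_. borel) (\<lambda>i \<omega>. b i * (X (p (Suc i)) \<omega> - X (p i) \<omega>)) {..<n}"
      by (rule indep_vars_compose2) simp
    then show ?thesis by (simp add: D_def[abs_def])
  qed
  define a where "a j = b j * (m (p (Suc j)) - m (p j))" for j
  define w where "w j = (b j)\<^sup>2 * (v * (p (Suc j) - p j))" for j
  have step: "char (distr M borel (D j)) u = iexp (u * a j) * exp (- (w j * u\<^sup>2 / 2))" "0 \<le> w j" if j: "j < n" for j u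
  proof -
    have st: "0 \<le> p j" "p j \<le> p (Suc j)" "p (Suc j) \<le> 1"
      using strict_mono_onD[OF sm, of j "Suc j"] p01[of j] p01[of "Suc j"] j by auto
    have [measurable]: "X (p j) \<in> borel_measurable M" "X (p (Suc j)) \<in> borel_measurable M"
      using st by (auto intro: X_measurable)
    have vp: "0 \<le> v * (p (Suc j) - p j)" using v st by simp
    then show "0 \<le> w j" by (simp add: w_def)
    have [measurable]: "D j \<in> borel_measurable M" unfolding D_def[abs_def] by measurable
    have "char (distr M borel (D j)) u = (\<integral>\<omega>. iexp (u * D j \<omega>) \<partial>M)"
      unfolding char_def by (subst integral_distr) auto
    also have "\<dots> = (\<integral>\<omega>. iexp (u * a j) * iexp (u * b j * (X (p (Suc j)) \<omega> - X (p j) \<omega> - (m (p (Suc j)) - m (p j)))) \<partial>M)"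
      by (rule Bochner_Integration.integral_cong) (auto simp: exp_add[symmetric] D_def a_def algebra_simps)
    also have "\<dots> = iexp (u * a j) * (\<integral>\<omega>. iexp (u * b j * (X (p (Suc j)) \<omega> - X (p j) \<omega> - (m (p (Suc j)) - m (p j)))) \<partial>M)"
      by (rule integral_mult_right_zero)
    also have "(\<integral>\<omega>. iexp (u * b j * (X (p (Suc j)) \<omega> - X (p j) \<omega> - (m (p (Suc j)) - m (p j)))) \<partial>M) = char (increment_law m (p j) (p (Suc j))) (u * b j)"
      unfolding char_def increment_law_def by (subst integral_distr) auto
    also have "\<dots> = exp (- (v * (p (Suc j) - p j) * (u * b j)\<^sup>2 / 2))" unfolding g[OF st] char_gau[OF vp] ..
    also have "v * (p (Suc j) - p j) * (u * b j)\<^sup>2 = w j * u\<^sup>2" by (simp add: w_def power_mult_distrib)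
    finally show "char (distr M borel (D j)) u = iexp (u * a j) * exp (- (w j * u\<^sup>2 / 2))" .
  qed
  have Dm: "D j \<in> borel_measurable M" if "j < n" for j
  proof -
    have "\<forall>j\<in>{..<n}. D j \<in> borel_measurable M" using ind unfolding indep_vars_def by (rule conjunct1)
    then show ?thesis using that by simp
  qed
  have Xm [measurable]: "X 0 \<in> borel_measurable M" by (rule X_measurable) auto
  have Sm [measurable]: "(\<lambda>\<omega>. \<Sum>j<n. D j \<omega>) \<in> borel_measurable M" using Dm by (intro borel_measurable_sum) auto
  show "gaussian_rv M (\<lambda>\<omega>. \<Sum>t\<in>J. c t * X t \<omega>)"
  proof (rule gaussian_rv_of_char)
    show "(\<lambda>\<omega>. \<Sum>t\<in>J. c t * X t \<omega>) \<in> borel_measurable M" unfolding eq by measurable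
    show "0 \<le> (\<Sum>j<n. w j)" using step(2) by (intro sum_nonneg) auto
    fix u
    have "char (distr M borel (\<lambda>\<omega>. \<Sum>t\<in>J. c t * X t \<omega>)) u = char (distr M borel (\<lambda>\<omega>. \<Sum>j<n. D j \<omega>)) u"
    proof -
      have "distr M borel (\<lambda>\<omega>. \<Sum>t\<in>J. c t * X t \<omega>) = distr M borel (\<lambda>\<omega>. \<Sum>j<n. D j \<omega>)"
        unfolding eq by (rule distr_cong_AE) (use X0 in auto)
      then show ?thesis by simp
    qed
    also have "\<dots> = (\<Prod>j<n. char (distr M borel (D j)) u)" by (rule char_distr_sum[OF ind])
    also have "\<dots> = (\<Prod>j<n. iexp (u * a j) * complex_of_real (exp (- (w j * u\<^sup>2 / 2))))" by (rule prod.cong) (use step(1) in auto)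
    also have "\<dots> = (\<Prod>j<n. iexp (u * a j)) * complex_of_real (\<Prod>j<n. exp (- (w j * u\<^sup>2 / 2)))" by (simp add: prod.distrib)
    also have "(\<Prod>j<n. iexp (u * a j)) = iexp (u * (\<Sum>j<n. a j))"
      by (simp add: exp_sum[symmetric] sum_distrib_left)
    also have "(\<Prod>j<n. exp (- (w j * u\<^sup>2 / 2))) = exp (- ((\<Sum>j<n. w j) * u\<^sup>2 / 2))"
      by (simp add: exp_sum[symmetric] sum_distrib_right sum_divide_distrib sum_negf)
    finally show "char (distr M borel (\<lambda>\<omega>. \<Sum>t\<in>J. c t * X t \<omega>)) u
        = iexp (u * (\<Sum>j<n. a j)) * exp (- ((\<Sum>j<n. w j) * u\<^sup>2 / 2))" .
  qed
qed

lemma same_increments_brownian: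
  assumes g: "\<And>s t. 0 \<le> s \<Longrightarrow> s \<le> t \<Longrightarrow> t \<le> 1 \<Longrightarrow> increment_law m s t = gau (c\<^sup>2 * (t - s))"
    and c: "0 \<le> c" and W: "std_brownian_motion N W"
  shows "same_increments M X N (\<lambda>t \<omega>. c * W t \<omega> + m t)"
  unfolding same_increments_def
proof (intro allI impI, elim conjE)
  fix s t :: real assume st: "0 \<le> s" "s < t" "t \<le> 1"
  have [measurable]: "X s \<in> borel_measurable M" "X t \<in> borel_measurable M" using st by (auto intro: X_measurable)
  have [measurable]: "W s \<in> borel_measurable N" "W t \<in> borel_measurable N"
    using W st by (auto simp: std_brownian_motion_def independent_increments_def)
  have "distr M borel (\<lambda>\<omega>. X t \<omega> - X s \<omega>) = distr (increment_law m s t) borel (\<lambda>x. x + (m t - m s))"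
    unfolding increment_law_def by (subst distr_distr) (auto simp: o_def)
  also have "increment_law m s t = gau (c\<^sup>2 * (t - s))" using g st by simp
  also have "\<dots> = distr (distr N borel (\<lambda>\<omega>. W t \<omega> - W s \<omega>)) borel (\<lambda>x. c * x)"
    unfolding brownian_increment_law[OF W st] gau_scale[OF c] ..
  also have "distr \<dots> borel (\<lambda>x. x + (m t - m s)) = distr N borel (\<lambda>\<omega>. c * W t \<omega> + m t - (c * W s \<omega> + m s))"
    by (simp add: distr_distr o_def algebra_simps)
  finally show "distr M borel (\<lambda>\<omega>. X t \<omega> - X s \<omega>) = distr N borel (\<lambda>\<omega>. c * W t \<omega> + m t - (c * W s \<omega> + m s))" .
qed

end

theorem theorem1:
  fixes f :: "real \<Rightarrow> real"
    and M :: "'a measure"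
    and X :: "real \<Rightarrow> 'a \<Rightarrow> real"
  assumes "condition_F f"
    and "prob_space M"
    and "independent_increments M X"
    and "AE \<omega> in M. X 0 \<omega> = 0"
    and "integrable M (\<lambda>\<omega>. f (X 1 \<omega>))"
    and "AE s in lborel. s \<in> {0..<1} \<longrightarrow>
           Liminf (at_right 0)
             (\<lambda>h. \<integral>\<^sup>+\<omega>. ennreal (f (h powr (- 1 / 2) * (X (s + h) \<omega> - X s \<omega>))) \<partial>M)
           \<ge> ennreal (\<integral>\<omega>. f (X 1 \<omega>) \<partial>M)"
  defines "\<sigma> \<equiv> the_inv_into {0..} (Psi f) (\<integral>\<omega>. f (X 1 \<omega>) \<partial>M)"
  shows "gaussian_process M X
    \<and> (\<forall>t\<in>{0..1}. integrable M (X t))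
    \<and> (\<integral>\<omega>. X 1 \<omega> \<partial>M) = 0
    \<and> (\<forall>x\<ge>0. integrable std_normal (\<lambda>w. f (x * w)))
    \<and> Psi f 0 = 0
    \<and> continuous_on {0..} (Psi f)
    \<and> strict_mono_on {0..} (Psi f)
    \<and> (\<integral>\<omega>. f (X 1 \<omega>) \<partial>M) \<in> Psi f ` {0..}
    \<and> (\<forall>(N :: 'b measure) W. std_brownian_motion N W \<longrightarrow>
         same_increments M X N (\<lambda>t \<omega>. \<sigma> * W t \<omega> + (\<integral>\<omega>'. X t \<omega>' \<partial>M)))"
proof -
  interpret growth_function f by (rule growth_function.intro) fact
  interpret prob_space M by fact
  interpret independent_increments_process M X by unfold_locales fact
  note X0 = assms(4) and fX = assms(5) and lim = assms(6)
  define m where "m t = (\<integral>\<omega>. X t \<omega> \<partial>M)" for t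
  let ?K = "\<integral>\<omega>. f (X 1 \<omega>) \<partial>M"
  have Xm [measurable]: "X 0 \<in> borel_measurable M" "X 1 \<in> borel_measurable M" by (auto intro: X_measurable)
  have X1: "integrable M (X 1)"
  proof (rule Bochner_Integration.integrable_bound)
    show "integrable M (\<lambda>\<omega>. 1 + f (X 1 \<omega>) / f 1)" using fX by auto
    show "AE \<omega> in M. norm (X 1 \<omega>) \<le> norm (1 + f (X 1 \<omega>) / f 1)"
      using order_trans[OF f_linear abs_ge_self] by (intro AE_I2) simp
  qed measurable
  have X0i: "integrable M (X 0)" and m0: "m 0 = 0"
    using X0 integrable_cong_AE[of "X 0" M "\<lambda>_. 0"] integral_cong_AE[of "X 0" M "\<lambda>_. 0"] by (auto simp: m_def)
  have Xi: "integrable M (X t)" if t: "0 \<le> t" "t \<le> 1" for t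
  proof -
    have "integrable M (\<lambda>\<omega>. X t \<omega> - X 0 \<omega>)" by (rule integrable_increments) (use X1 X0i t in auto)
    from Bochner_Integration.integrable_add[OF this X0i] show ?thesis by simp
  qed
  \<comment> \<open>\<open>X 0 = 0\<close> holds only almost surely, so \<open>X 1\<close> and
    \<open>X 1 - X 0\<close> are exchanged under the integral; \<open>m 0 = 0\<close> takes care of
    the centring.\<close>
  have f1: "integrable M (\<lambda>\<omega>. f (X 1 \<omega> - X 0 \<omega> - (m 1 - m 0) + m 1))"
    and K1: "(\<integral>\<omega>. f (X 1 \<omega> - X 0 \<omega> - (m 1 - m 0) + m 1) \<partial>M) = ?K"
  proof -
    have ae: "AE \<omega> in M. f (X 1 \<omega> - X 0 \<omega> - (m 1 - m 0) + m 1) = f (X 1 \<omega>)" using X0 by eventually_elim (simp add: m0)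
    show "integrable M (\<lambda>\<omega>. f (X 1 \<omega> - X 0 \<omega> - (m 1 - m 0) + m 1))"
      using fX by (rule integrable_cong_AE_imp) (use ae in auto)
    show "(\<integral>\<omega>. f (X 1 \<omega> - X 0 \<omega> - (m 1 - m 0) + m 1) \<partial>M) = ?K" by (rule integral_cong_AE) (use ae in auto)
  qed
  interpret H: f_hemigroup "increment_law m" f m
  proof (intro f_hemigroup.intro centred_hemigroup.intro f_hemigroup_axioms.intro)
    fix s t :: real assume st: "0 \<le> s" "s \<le> t" "t \<le> 1"
    have i: "integrable M (X s)" "integrable M (X t)" using Xi st by auto
    show "integrable (increment_law m s t) (\<lambda>x. x)"
      using i st by (subst integrable_increment_law_iff) auto
    have "(\<integral>x. x \<partial>increment_law m s t) = (\<integral>\<omega>. X t \<omega> - X s \<omega> - (m t - m s) \<partial>M)"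
      unfolding increment_law_def by (rule integral_distr[OF centred_increment_measurable[OF st]]) simp
    also have "\<dots> = 0" using i by (simp add: m_def prob_space)
    finally show "(\<integral>x. x \<partial>increment_law m s t) = 0" .
  next
    show "integrable (increment_law m 0 1) (\<lambda>y. f (y + m 1))"
      using f1 by (subst integrable_increment_law_iff) auto
  next
    show "increment_law m s u = (increment_law m s t \<star> increment_law m t u)"
      if "0 \<le> s" "s \<le> t" "t \<le> u" "u \<le> 1" for s t u
      using that by (rule increment_law_conv)
  qed (rule growth_function_axioms increment_law_refl real_distribution_increment_law; assumption)+
  have Kf: "H.Kf = ?K"
    unfolding H.Kf_def K1[symmetric] increment_law_def by (rule integral_distr[OF centred_increment_measurable]) auto
  \<comment> \<open>The laws describe \<open>X (s + h)\<close> only for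
    \<open>s + h \<le> 1\<close>. A lower limit at 0 depends on small \<open>h\<close> alone, so the
    integrals may be transported there.\<close>
  have lim': "H.lim_at s" if s: "0 \<le> s" "s < 1"
    and l: "ennreal ?K \<le> Liminf (at_right 0) (\<lambda>h. \<integral>\<^sup>+\<omega>. ennreal (f (h powr (- 1 / 2) * (X (s + h) \<omega> - X s \<omega>))) \<partial>M)" for s
  proof -
    have "(\<integral>\<^sup>+\<omega>. ennreal (f (h powr (- 1 / 2) * (X (s + h) \<omega> - X s \<omega>))) \<partial>M)
        = (\<integral>\<^sup>+y. ennreal (f (h powr (- 1 / 2) * (y + (m (s + h) - m s)))) \<partial>increment_law m s (s + h))"
      if "0 < h" "h < 1 - s" for h
      unfolding increment_law_def
      by (subst nn_integral_distr[OF centred_increment_measurable]) (use s that in auto)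
    moreover have "eventually (\<lambda>h. h \<in> {0<..<1 - s}) (at_right 0)" using s by (intro eventually_at_right_real) simp
    ultimately have "Liminf (at_right 0) (\<lambda>h. \<integral>\<^sup>+\<omega>. ennreal (f (h powr (- 1 / 2) * (X (s + h) \<omega> - X s \<omega>))) \<partial>M)
        = Liminf (at_right 0) (\<lambda>h. \<integral>\<^sup>+y. ennreal (f (h powr (- 1 / 2) * (y + (m (s + h) - m s)))) \<partial>increment_law m s (s + h))"
      by (intro Liminf_eq) (auto elim!: eventually_mono)
    then show ?thesis using l by (simp add: H.lim_at_def Kf)
  qed
  have K0: "0 \<le> ?K" using f_nonneg by (intro Bochner_Integration.integral_nonneg) auto
  have inj: "inj_on (Psi f) {0..}" by (rule strict_mono_on_imp_inj_on[OF Psi_strict_mono])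
  have \<sigma>: "0 \<le> \<sigma>" "Psi f \<sigma> = ?K"
    using the_inv_into_into[OF inj Psi_range[OF K0], of "{0..}"] f_the_inv_into_f[OF inj Psi_range[OF K0]]
    by (auto simp: \<sigma>_def)
  have G: "m 1 = 0 \<and> (\<forall>s t. 0 \<le> s \<and> s \<le> t \<and> t \<le> 1 \<longrightarrow> increment_law m s t = gau (\<sigma>\<^sup>2 * (t - s)))"
  proof (rule H.gaussian_increments)
    show "AE s in lborel. s \<in> {0..<1} \<longrightarrow> H.lim_at s"
      using lim by eventually_elim (auto intro: lim')
    show "(\<integral>x. f x \<partial>gau (\<sigma>\<^sup>2)) = H.Kf" using \<sigma> by (simp add: Kf Psi_eq_gau)
  qed simp
  have gp: "gaussian_process M X"
    by (rule gaussian_process_of_increments[OF X0, of "\<sigma>\<^sup>2" m]) (use G in auto)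
  have bm: "same_increments M X N (\<lambda>t \<omega>. \<sigma> * W t \<omega> + (\<integral>\<omega>'. X t \<omega>' \<partial>M))"
    if "std_brownian_motion N W" for N :: "'b measure" and W
    using same_increments_brownian[OF _ \<sigma>(1) that, of m] G by (simp add: m_def)
  show ?thesis
    using gp Xi G bm Psi_integrable Psi_0 Psi_continuous Psi_strict_mono Psi_range[OF K0] by (auto simp: m_def)
qed

end
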